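(* Fix a prime $p$, and let $G$ be a group all of whose $p$-subgroups are locally finite. Then for each $\mathbb{Z}G$-module $M$, $$\Lambda^*(G;M) \cong \Lambda^*_f(G;M).$$
   Context: A $p$-group is a group each of whose elements has (finite) $p$-power order. A group is locally finite if each of its finitely generated subgroups is finite. Higher limits: for a small category $\mathcal{C}$, a $\mathcal{C}$-module is a functor $\mathcal{C}^{\mathrm{op}}\to\mathrm{Ab}$, and $\varprojlim^i_{\mathcal{C}}(\Phi)$ denotes the $i$-th right derived functor of the inverse limit functor on the category of $\mathcal{C}$-modules. Orbit categories: for a group $G$, $\mathcal{O}(G)$ is the category whose objects are the subgroups of $G$, with $\mathrm{Mor}_{\mathcal{O}(G)}(H,K)=\{Kg \mid g\in G,\ gHg^{-1}\le K\}$ and composition $Lx\circ Kg=Lxg$; write $[g]=Kg$. $\mathcal{O}_p^f(G)\subseteq\mathcal{O}_p(G)\subseteq\mathcal{O}(G)$ are the full subcategories whose objects are the finite $p$-subgroups, respectively all $p$-subgroups, of $G$. For a $\mathbb{Z}G$-module $M$, $F_M\colon\mathcal{O}_p(G)^{\mathrm{op}}\to\mathrm{Ab}$ is the functor with $F_M(P)=M$ if $P=1$ and $F_M(P)=0$ if $P\ne1$, where $\mathrm{Aut}_{\mathcal{O}_p(G)}(1)\cong G$ acts on $F_M(1)=M$ through the given action ($F_M([g])$ is multiplication by $g^{-1}$). Set $\Lambda^*(G;M)=\varprojlim^*_{\mathcal{O}_p(G)}(F_M)$ and $\Lambda^*_f(G;M)=\varprojlim^*_{\mathcal{O}_p^f(G)}(F_M|_{\mathcal{O}_p^f(G)})$.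 *)

theory Defs
  imports "HOL-Algebra.Algebra" "HOL-Computational_Algebra.Primes"
begin

text \<open>Abelian groups are multiplicatively written commutative groups of HOL-Algebra throughout.\<close>

section \<open>Small categories, modules over them, inverse limits\<close>

text \<open>Arrow sets need not be disjoint: an arrow is determined by its source, its target and a label,
  and \<open>Cmp C g f\<close> is \<open>g\<close> after \<open>f\<close>.\<close>

record ('o, 'a) cat =
  Obj :: "'o set"
  Arr :: "'o \<Rightarrow> 'o \<Rightarrow> 'a set"
  Idn :: "'o \<Rightarrow> 'a"
  Cmp :: "'a \<Rightarrow> 'a \<Rightarrow> 'a"

locale small_category =
  fixes C :: "('o, 'a) cat"
  assumes Idn_in_Arr: "c \<in> Obj C \<Longrightarrow> Idn C c \<in> Arr C c c"
    and Cmp_in_Arr: "\<lbrakk>b \<in> Obj C; c \<in> Obj C; d \<in> Obj C; f \<in> Arr C b c; g \<in> Arr C c d\<rbrakk>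
          \<Longrightarrow> Cmp C g f \<in> Arr C b d"
    and Cmp_Idn_left: "\<lbrakk>c \<in> Obj C; d \<in> Obj C; f \<in> Arr C c d\<rbrakk> \<Longrightarrow> Cmp C (Idn C d) f = f"
    and Cmp_Idn_right: "\<lbrakk>c \<in> Obj C; d \<in> Obj C; f \<in> Arr C c d\<rbrakk> \<Longrightarrow> Cmp C f (Idn C c) = f"
    and Cmp_assoc: "\<lbrakk>a \<in> Obj C; b \<in> Obj C; c \<in> Obj C; d \<in> Obj C;
          f \<in> Arr C a b; g \<in> Arr C b c; h \<in> Arr C c d\<rbrakk>
          \<Longrightarrow> Cmp C h (Cmp C g f) = Cmp C (Cmp C h g) f"

definition full_subcategory :: "('o, 'a) cat \<Rightarrow> ('o \<Rightarrow> bool) \<Rightarrow> ('o, 'a) cat" where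
  "full_subcategory C P = C\<lparr>Obj := {c \<in> Obj C. P c}\<rparr>"

text \<open>Contravariant functors to abelian groups; for an arrow \<open>f\<close> from \<open>c\<close> to \<open>d\<close>,
  \<open>Res \<Phi> c d f\<close> is the induced map from \<open>Val \<Phi> d\<close> to \<open>Val \<Phi> c\<close>. Only the values at objects and
  arrows of the category matter, so that the restriction of a functor to a subcategory is
  represented by the same record.\<close>

record ('o, 'a, 'x) presheaf =
  Val :: "'o \<Rightarrow> 'x monoid"
  Res :: "'o \<Rightarrow> 'o \<Rightarrow> 'a \<Rightarrow> 'x \<Rightarrow> 'x"

locale cat_module =
  fixes C :: "('o, 'a) cat" and \<Phi> :: "('o, 'a, 'x) presheaf"
  assumes Val_comm_group: "c \<in> Obj C \<Longrightarrow> comm_group (Val \<Phi> c)"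
    and Res_hom: "\<lbrakk>c \<in> Obj C; d \<in> Obj C; f \<in> Arr C c d\<rbrakk>
          \<Longrightarrow> Res \<Phi> c d f \<in> hom (Val \<Phi> d) (Val \<Phi> c)"
    and Res_Idn: "\<lbrakk>c \<in> Obj C; x \<in> carrier (Val \<Phi> c)\<rbrakk> \<Longrightarrow> Res \<Phi> c c (Idn C c) x = x"
    and Res_Cmp: "\<lbrakk>b \<in> Obj C; c \<in> Obj C; d \<in> Obj C; f \<in> Arr C b c; g \<in> Arr C c d;
          x \<in> carrier (Val \<Phi> d)\<rbrakk>
          \<Longrightarrow> Res \<Phi> b d (Cmp C g f) x = Res \<Phi> b c f (Res \<Phi> c d g x)"

definition module_hom ::
  "('o, 'a) cat \<Rightarrow> ('o, 'a, 'x) presheaf \<Rightarrow> ('o, 'a, 'y) presheaf \<Rightarrow> ('o \<Rightarrow> 'x \<Rightarrow> 'y) set" where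
  "module_hom C \<Phi> \<Psi> = {\<eta>. (\<forall>c\<in>Obj C. \<eta> c \<in> hom (Val \<Phi> c) (Val \<Psi> c)) \<and>
     (\<forall>c\<in>Obj C. \<forall>d\<in>Obj C. \<forall>f\<in>Arr C c d. \<forall>x\<in>carrier (Val \<Phi> d).
        \<eta> c (Res \<Phi> c d f x) = Res \<Psi> c d f (\<eta> d x))}"

definition module_mono ::
  "('o, 'a) cat \<Rightarrow> ('o, 'a, 'x) presheaf \<Rightarrow> ('o, 'a, 'y) presheaf \<Rightarrow> ('o \<Rightarrow> 'x \<Rightarrow> 'y) set" where
  "module_mono C \<Phi> \<Psi> = {\<eta> \<in> module_hom C \<Phi> \<Psi>. \<forall>c\<in>Obj C. inj_on (\<eta> c) (carrier (Val \<Phi> c))}"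

definition inv_lim :: "('o, 'a) cat \<Rightarrow> ('o, 'a, 'x) presheaf \<Rightarrow> ('o \<Rightarrow> 'x) monoid" where
  "inv_lim C \<Phi> = (product_group (Obj C) (Val \<Phi>))
     \<lparr>carrier := {t \<in> carrier (product_group (Obj C) (Val \<Phi>)).
        \<forall>c\<in>Obj C. \<forall>d\<in>Obj C. \<forall>f\<in>Arr C c d. Res \<Phi> c d f (t d) = t c}\<rparr>"

definition inv_lim_map :: "('o, 'a) cat \<Rightarrow> ('o \<Rightarrow> 'x \<Rightarrow> 'y) \<Rightarrow> ('o \<Rightarrow> 'x) \<Rightarrow> ('o \<Rightarrow> 'y)" where
  "inv_lim_map C \<eta> t = (\<lambda>c\<in>Obj C. \<eta> c (t c))"

section \<open>Higher limits\<close>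

text \<open>Quantification over all modules, as in the definition of injectivity, needs a fixed type for
  the elements of their values. The following type is large enough for the homological algebra of
  modules over a category with objects in \<open>'o\<close> and arrows in \<open>'a\<close>. If \<open>F\<close> is a module with elements
  in \<open>'m\<close> or in this type, then the divisible group \<open>D c\<close> containing \<open>Val F c\<close>, obtained from
  the rational vector space on \<open>Val F c\<close> by dividing out the relations of \<open>Val F c\<close>, can be
  represented in it (by \<open>Seq\<close> and \<open>Num\<close>, with chosen representatives for cosets); so can, by \<open>Fam\<close>,
  the module whose value at \<open>x\<close> is the product of the \<open>D c\<close> over all pairs \<open>(c, f)\<close> with \<open>f\<close> an
  arrow from \<open>c\<close> to \<open>x\<close>, and this is an injective module containing \<open>F\<close>; finally, so can cokernels.
  Hence there are enough injectives. Submodules of representable modules are also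
  represented, so that injectivity among these modules is, by Baer's criterion, injectivity
  among all modules.\<close>

datatype ('i, 'm) univ =
    Elem 'm
  | Num rat
  | Seq "('i, 'm) univ list"
  | Fam "'i \<Rightarrow> ('i, 'm) univ"

definition injective_module :: "('o, 'a) cat \<Rightarrow> ('o, 'a, 'x) presheaf \<Rightarrow> bool" where
  "injective_module C I \<longleftrightarrow> cat_module C I \<and>
     (\<forall>(A :: ('o, 'a, 'x) presheaf) (B :: ('o, 'a, 'x) presheaf) \<iota> \<alpha>.
        cat_module C A \<and> cat_module C B \<and> \<iota> \<in> module_mono C A B \<and> \<alpha> \<in> module_hom C A I \<longrightarrow>
        (\<exists>\<beta> \<in> module_hom C B I. \<forall>c\<in>Obj C. \<forall>x\<in>carrier (Val A c). \<beta> c (\<iota> c x) = \<alpha> c x))"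

definition injective_resolution ::
  "('o, 'a) cat \<Rightarrow> ('o, 'a, 'x) presheaf \<Rightarrow> ('o \<Rightarrow> 'x \<Rightarrow> 'y) \<Rightarrow>
   (nat \<Rightarrow> ('o, 'a, 'y) presheaf) \<Rightarrow> (nat \<Rightarrow> 'o \<Rightarrow> 'y \<Rightarrow> 'y) \<Rightarrow> bool" where
  "injective_resolution C \<Phi> \<epsilon> I \<delta> \<longleftrightarrow>
     (\<forall>n. injective_module C (I n)) \<and>
     \<epsilon> \<in> module_mono C \<Phi> (I 0) \<and>
     (\<forall>n. \<delta> n \<in> module_hom C (I n) (I (Suc n))) \<and>
     (\<forall>c\<in>Obj C. \<epsilon> c ` carrier (Val \<Phi> c) = kernel (Val (I 0) c) (Val (I 1) c) (\<delta> 0 c)) \<and>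
     (\<forall>n. \<forall>c\<in>Obj C. \<delta> n c ` carrier (Val (I n) c) =
        kernel (Val (I (Suc n)) c) (Val (I (Suc (Suc n))) c) (\<delta> (Suc n) c))"

text \<open>The cohomology in degree \<open>i\<close> of the complex obtained by applying the inverse limit to
  \<open>I 0 \<rightarrow> I 1 \<rightarrow> I 2 \<rightarrow> \<dots>\<close>.\<close>

definition lim_cocycles ::
  "('o, 'a) cat \<Rightarrow> (nat \<Rightarrow> ('o, 'a, 'x) presheaf) \<Rightarrow> (nat \<Rightarrow> 'o \<Rightarrow> 'x \<Rightarrow> 'x) \<Rightarrow> nat \<Rightarrow> ('o \<Rightarrow> 'x) set" where
  "lim_cocycles C I \<delta> i =
     kernel (inv_lim C (I i)) (inv_lim C (I (Suc i))) (inv_lim_map C (\<delta> i))"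

fun lim_coboundaries ::
  "('o, 'a) cat \<Rightarrow> (nat \<Rightarrow> ('o, 'a, 'x) presheaf) \<Rightarrow> (nat \<Rightarrow> 'o \<Rightarrow> 'x \<Rightarrow> 'x) \<Rightarrow> nat \<Rightarrow> ('o \<Rightarrow> 'x) set" where
  "lim_coboundaries C I \<delta> 0 = {\<one>\<^bsub>inv_lim C (I 0)\<^esub>}"
| "lim_coboundaries C I \<delta> (Suc i) = inv_lim_map C (\<delta> i) ` carrier (inv_lim C (I i))"

definition lim_cohomology ::
  "('o, 'a) cat \<Rightarrow> (nat \<Rightarrow> ('o, 'a, 'x) presheaf) \<Rightarrow> (nat \<Rightarrow> 'o \<Rightarrow> 'x \<Rightarrow> 'x) \<Rightarrow> nat
   \<Rightarrow> ('o \<Rightarrow> 'x) set monoid" where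
  "lim_cohomology C I \<delta> i =
     (inv_lim C (I i))\<lparr>carrier := lim_cocycles C I \<delta> i\<rparr> Mod lim_coboundaries C I \<delta> i"

text \<open>The choice of resolution depends only on the category and the module, not on the degree.\<close>

definition chosen_resolution ::
  "('o, 'a) cat \<Rightarrow> ('o, 'a, 'm) presheaf \<Rightarrow>
   (nat \<Rightarrow> ('o, 'a, ('o \<times> 'a, 'm) univ) presheaf) \<times>
   (nat \<Rightarrow> 'o \<Rightarrow> ('o \<times> 'a, 'm) univ \<Rightarrow> ('o \<times> 'a, 'm) univ)" where
  "chosen_resolution C \<Phi> = (SOME (I, \<delta>). \<exists>\<epsilon>. injective_resolution C \<Phi> \<epsilon> I \<delta>)"

definition higher_lim ::
  "('o, 'a) cat \<Rightarrow> ('o, 'a, 'm) presheaf \<Rightarrow> nat \<Rightarrow> ('o \<Rightarrow> ('o \<times> 'a, 'm) univ) set monoid" where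
  "higher_lim C \<Phi> i = (case chosen_resolution C \<Phi> of (I, \<delta>) \<Rightarrow> lim_cohomology C I \<delta> i)"

section \<open>Orbit categories\<close>

definition p_group :: "nat \<Rightarrow> ('g, 'b) monoid_scheme \<Rightarrow> bool" where
  "p_group p G \<longleftrightarrow> group G \<and> (\<forall>x\<in>carrier G. \<exists>n. group.ord G x = p ^ n)"

definition locally_finite_group :: "('g, 'b) monoid_scheme \<Rightarrow> bool" where
  "locally_finite_group G \<longleftrightarrow>
     group G \<and> (\<forall>S. S \<subseteq> carrier G \<and> finite S \<longrightarrow> finite (generate G S))"

text \<open>For cosets \<open>L x\<close> from \<open>K\<close> to \<open>L\<close> and \<open>K g\<close>, the product of sets \<open>(L x)(K g)\<close> is
  \<open>L (x K x\<inverse>) x g = L x g\<close>; see \<open>orbit_category_Cmp\<close> below.\<close>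

definition orbit_category :: "('g, 'b) monoid_scheme \<Rightarrow> ('g set, 'g set) cat" where
  "orbit_category G = \<lparr>
     Obj = {H. subgroup H G},
     Arr = (\<lambda>H K. {K #>\<^bsub>G\<^esub> g |g. g \<in> carrier G \<and> (\<forall>h\<in>H. g \<otimes>\<^bsub>G\<^esub> h \<otimes>\<^bsub>G\<^esub> inv\<^bsub>G\<^esub> g \<in> K)}),
     Idn = (\<lambda>H. H #>\<^bsub>G\<^esub> \<one>\<^bsub>G\<^esub>),
     Cmp = (\<lambda>\<beta> \<alpha>. \<beta> <#>\<^bsub>G\<^esub> \<alpha>)\<rparr>"

definition orbit_category_p :: "nat \<Rightarrow> ('g, 'b) monoid_scheme \<Rightarrow> ('g set, 'g set) cat" where
  "orbit_category_p p G =
     full_subcategory (orbit_category G) (\<lambda>H. p_group p (G\<lparr>carrier := H\<rparr>))"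

definition orbit_category_pf :: "nat \<Rightarrow> ('g, 'b) monoid_scheme \<Rightarrow> ('g set, 'g set) cat" where
  "orbit_category_pf p G =
     full_subcategory (orbit_category G) (\<lambda>H. finite H \<and> p_group p (G\<lparr>carrier := H\<rparr>))"

lemma orbit_category_Cmp:
  assumes "group G" "subgroup K G" "subgroup L G" "x \<in> carrier G" "g \<in> carrier G"
    and conj: "\<And>k. k \<in> K \<Longrightarrow> x \<otimes>\<^bsub>G\<^esub> k \<otimes>\<^bsub>G\<^esub> inv\<^bsub>G\<^esub> x \<in> L"
  shows "Cmp (orbit_category G) (L #>\<^bsub>G\<^esub> x) (K #>\<^bsub>G\<^esub> g) = L #>\<^bsub>G\<^esub> (x \<otimes>\<^bsub>G\<^esub> g)"
proof -
  interpret group G by fact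
  note in_G = subgroup.mem_carrier[OF assms(2)] subgroup.mem_carrier[OF assms(3)]
  have move: "(l \<otimes>\<^bsub>G\<^esub> x) \<otimes>\<^bsub>G\<^esub> (k \<otimes>\<^bsub>G\<^esub> g) =
      (l \<otimes>\<^bsub>G\<^esub> (x \<otimes>\<^bsub>G\<^esub> k \<otimes>\<^bsub>G\<^esub> inv\<^bsub>G\<^esub> x)) \<otimes>\<^bsub>G\<^esub> (x \<otimes>\<^bsub>G\<^esub> g)" if "l \<in> L" "k \<in> K" for l k
    using that in_G assms(4,5) by (simp add: m_assoc inv_solve_left)
  have "(L #>\<^bsub>G\<^esub> x) <#>\<^bsub>G\<^esub> (K #>\<^bsub>G\<^esub> g) = L #>\<^bsub>G\<^esub> (x \<otimes>\<^bsub>G\<^esub> g)"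
  proof (intro equalityI subsetI)
    fix y assume "y \<in> (L #>\<^bsub>G\<^esub> x) <#>\<^bsub>G\<^esub> (K #>\<^bsub>G\<^esub> g)"
    then obtain l k where lk: "l \<in> L" "k \<in> K" "y = (l \<otimes>\<^bsub>G\<^esub> x) \<otimes>\<^bsub>G\<^esub> (k \<otimes>\<^bsub>G\<^esub> g)"
      unfolding set_mult_def r_coset_def by blast
    have "l \<otimes>\<^bsub>G\<^esub> (x \<otimes>\<^bsub>G\<^esub> k \<otimes>\<^bsub>G\<^esub> inv\<^bsub>G\<^esub> x) \<in> L"
      using lk conj subgroup.m_closed[OF assms(3)] by blast
    then show "y \<in> L #>\<^bsub>G\<^esub> (x \<otimes>\<^bsub>G\<^esub> g)"
      unfolding r_coset_def using lk move by blast
  next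
    fix y assume "y \<in> L #>\<^bsub>G\<^esub> (x \<otimes>\<^bsub>G\<^esub> g)"
    then obtain l where l: "l \<in> L" "y = l \<otimes>\<^bsub>G\<^esub> (x \<otimes>\<^bsub>G\<^esub> g)"
      unfolding r_coset_def by blast
    have "y = (l \<otimes>\<^bsub>G\<^esub> x) \<otimes>\<^bsub>G\<^esub> (\<one>\<^bsub>G\<^esub> \<otimes>\<^bsub>G\<^esub> g)"
      using l in_G assms(4,5) by (simp add: m_assoc)
    then show "y \<in> (L #>\<^bsub>G\<^esub> x) <#>\<^bsub>G\<^esub> (K #>\<^bsub>G\<^esub> g)"
      unfolding set_mult_def r_coset_def
      using l subgroup.one_closed[OF assms(2)] by blast
  qed
  then show ?thesis by (simp add: orbit_category_def)
qed

lemma small_category_full_subcategory: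
  "small_category C \<Longrightarrow> small_category (full_subcategory C P)"
  apply (rule small_category.intro; simp add: full_subcategory_def)
      apply (elim conjE; rule small_category.Idn_in_Arr; assumption)
     apply (elim conjE; rule small_category.Cmp_in_Arr; assumption)
    apply (elim conjE; rule small_category.Cmp_Idn_left; assumption)
   apply (elim conjE; rule small_category.Cmp_Idn_right; assumption)
  apply (elim conjE; rule small_category.Cmp_assoc; assumption)
  done

lemma small_category_orbit_category:
  fixes G (structure)
  assumes "group G"
  shows "small_category (orbit_category G)"
proof -
  interpret group G by fact
  let ?C = "orbit_category G"
  have obj: "c \<in> Obj ?C \<longleftrightarrow> subgroup c G" for c by (simp add: orbit_category_def)
  have arr: "f \<in> Arr ?C H K \<longleftrightarrow>
      (\<exists>g. f = K #> g \<and> g \<in> carrier G \<and> (\<forall>h\<in>H. g \<otimes> h \<otimes> inv g \<in> K))" for f H K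
    by (auto simp add: orbit_category_def)
  have idn: "Idn ?C H = H #> \<one>" for H by (simp add: orbit_category_def)
  have idn_arr: "Idn ?C c \<in> Arr ?C c c" if "subgroup c G" for c
    unfolding arr idn using subgroup.mem_carrier[OF that] by (intro exI[of _ \<one>]) simp
  have conj_mult: "(x \<otimes> g) \<otimes> h \<otimes> inv (x \<otimes> g) = x \<otimes> (g \<otimes> h \<otimes> inv g) \<otimes> inv x"
    if "x \<in> carrier G" "g \<in> carrier G" "h \<in> carrier G" for x g h
    using that by (simp add: m_assoc inv_mult_group)
  show ?thesis
  proof
    fix c assume "c \<in> Obj ?C" then show "Idn ?C c \<in> Arr ?C c c" using idn_arr obj by blast
  next
    fix b c d f g
    assume *: "b \<in> Obj ?C" "c \<in> Obj ?C" "d \<in> Obj ?C" "f \<in> Arr ?C b c" "g \<in> Arr ?C c d"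
    then have sg: "subgroup b G" "subgroup c G" "subgroup d G" by (simp_all add: obj)
    obtain y where y: "f = c #> y" "y \<in> carrier G" "\<And>h. h \<in> b \<Longrightarrow> y \<otimes> h \<otimes> inv y \<in> c"
      using *(4) unfolding arr by blast
    obtain x where x: "g = d #> x" "x \<in> carrier G" "\<And>h. h \<in> c \<Longrightarrow> x \<otimes> h \<otimes> inv x \<in> d"
      using *(5) unfolding arr by blast
    have "Cmp ?C g f = d #> (x \<otimes> y)"
      unfolding x(1) y(1) by (rule orbit_category_Cmp[OF assms sg(2,3) x(2) y(2) x(3)])
    then show "Cmp ?C g f \<in> Arr ?C b d"
      unfolding arr using x(2,3) y(2,3) conj_mult[OF x(2) y(2) subgroup.mem_carrier[OF sg(1)]]
      by (intro exI[of _ "x \<otimes> y"]) auto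
  next
    fix c d f assume *: "c \<in> Obj ?C" "d \<in> Obj ?C" "f \<in> Arr ?C c d"
    then have sg: "subgroup c G" "subgroup d G" by (simp_all add: obj)
    obtain y where y: "f = d #> y" "y \<in> carrier G" "\<And>h. h \<in> c \<Longrightarrow> y \<otimes> h \<otimes> inv y \<in> d"
      using *(3) unfolding arr by blast
    show "Cmp ?C (Idn ?C d) f = f"
      unfolding idn y(1) using orbit_category_Cmp[OF assms sg(2,2) one_closed y(2)] y(2)
        subgroup.mem_carrier[OF sg(2)] by simp
    show "Cmp ?C f (Idn ?C c) = f"
      unfolding idn y(1) using orbit_category_Cmp[OF assms sg(1,2) y(2) one_closed y(3)] y(2) by simp
  next
    fix a b c d f g h
    assume *: "a \<in> Obj ?C" "b \<in> Obj ?C" "c \<in> Obj ?C" "d \<in> Obj ?C"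
      "f \<in> Arr ?C a b" "g \<in> Arr ?C b c" "h \<in> Arr ?C c d"
    have sub: "k \<subseteq> carrier G" if "k \<in> Arr ?C u v" "v \<in> Obj ?C" for k u v
      using that r_coset_subset_G[OF subgroup.subset] unfolding arr obj by blast
    show "Cmp ?C h (Cmp ?C g f) = Cmp ?C (Cmp ?C h g) f"
      using sub[OF *(5,2)] sub[OF *(6,3)] sub[OF *(7,4)]
      by (simp add: orbit_category_def set_mult_assoc)
  qed
qed

section \<open>The functors \<open>\<Lambda>\<close>\<close>

locale ZG_module =
  group G + M: comm_group M
  for G :: "('g, 'b) monoid_scheme" (structure) and M :: "'m monoid"
    and act :: "'g \<Rightarrow> 'm \<Rightarrow> 'm" +
  assumes act_hom: "g \<in> carrier G \<Longrightarrow> act g \<in> hom M M"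
    and act_one: "x \<in> carrier M \<Longrightarrow> act \<one> x = x"
    and act_mult: "\<lbrakk>g \<in> carrier G; h \<in> carrier G; x \<in> carrier M\<rbrakk>
          \<Longrightarrow> act (g \<otimes> h) x = act g (act h x)"

text \<open>The arrows from the trivial subgroup to itself are the singletons \<open>{g}\<close>.\<close>

definition F_functor ::
  "('g, 'b) monoid_scheme \<Rightarrow> 'm monoid \<Rightarrow> ('g \<Rightarrow> 'm \<Rightarrow> 'm) \<Rightarrow> ('g set, 'g set, 'm) presheaf" where
  "F_functor G M act = \<lparr>
     Val = (\<lambda>P. if P = {\<one>\<^bsub>G\<^esub>} then M else M\<lparr>carrier := {\<one>\<^bsub>M\<^esub>}\<rparr>),
     Res = (\<lambda>P Q a m. if P = {\<one>\<^bsub>G\<^esub>} \<and> Q = {\<one>\<^bsub>G\<^esub>} then act (inv\<^bsub>G\<^esub> (the_elem a)) m else \<one>\<^bsub>M\<^esub>)\<rparr>"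

lemma cat_module_F_functor:
  fixes G (structure)
  assumes "ZG_module G M act"
  shows "cat_module (orbit_category_p p G) (F_functor G M act)"
proof -
  interpret ZG_module G M act by fact
  let ?C = "orbit_category_p p G"
  have sub: "subgroup c G" if "c \<in> Obj ?C" for c
    using that by (simp add: orbit_category_p_def full_subcategory_def orbit_category_def)
  have arr: "f \<in> Arr ?C H K \<longleftrightarrow>
      (\<exists>g. f = K #> g \<and> g \<in> carrier G \<and> (\<forall>h\<in>H. g \<otimes> h \<otimes> inv g \<in> K))" for f H K
    by (auto simp add: orbit_category_p_def full_subcategory_def orbit_category_def)
  have arr1: "\<exists>g\<in>carrier G. f = {g}" if "f \<in> Arr ?C H {\<one>}" for f H
    using that unfolding arr by (auto simp: r_coset_def)
  have into1: "H = {\<one>}" if "f \<in> Arr ?C H {\<one>}" "subgroup H G" for f H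
  proof -
    from that(1) obtain g where g: "g \<in> carrier G" "\<forall>h\<in>H. g \<otimes> h \<otimes> inv g = \<one>"
      unfolding arr by auto
    have "h = \<one>" if "h \<in> H" for h
    proof -
      have hc: "h \<in> carrier G" using that subgroup.mem_carrier[OF \<open>subgroup H G\<close>] by blast
      have "g \<otimes> h = (g \<otimes> h \<otimes> inv g) \<otimes> g" using g(1) hc by (simp add: m_assoc)
      also have "\<dots> = g" using g that by simp
      finally have "g \<otimes> h = g" .
      then show ?thesis using g(1) hc by simp
    qed
    then show ?thesis using subgroup.one_closed[OF that(2)] by blast
  qed
  have cmp: "Cmp ?C {x} {y} = {x \<otimes> y}" for x y
    by (simp add: orbit_category_p_def full_subcategory_def orbit_category_def set_mult_def)
  have idn1: "Idn ?C {\<one>} = {\<one>}"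
    by (simp add: orbit_category_p_def full_subcategory_def orbit_category_def r_coset_def)
  have triv: "comm_group (M\<lparr>carrier := {\<one>\<^bsub>M\<^esub>}\<rparr>)"
    by (rule comm_groupI) simp_all
  show ?thesis
  proof (rule cat_module.intro)
    fix c assume "c \<in> Obj ?C" then show "comm_group (Val (F_functor G M act) c)"
      using triv M.comm_group_axioms by (simp add: F_functor_def)
  next
    fix c d f assume *: "c \<in> Obj ?C" "d \<in> Obj ?C" "f \<in> Arr ?C c d"
    show "Res (F_functor G M act) c d f \<in> hom (Val (F_functor G M act) d) (Val (F_functor G M act) c)"
    proof (cases "d = {\<one>}")
      case True
      then have c: "c = {\<one>}" using into1 * sub by blast
      obtain v where v: "v \<in> carrier G" "f = {v}" using arr1[of f c] *(3) True by auto
      have "Res (F_functor G M act) c d f = act (inv v)"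
        using True c v by (simp add: F_functor_def fun_eq_iff)
      then show ?thesis using True c act_hom[of "inv v"] v by (simp add: F_functor_def)
    next
      case False
      then show ?thesis by (simp add: F_functor_def hom_def)
    qed
  next
    fix c x assume "c \<in> Obj ?C" "x \<in> carrier (Val (F_functor G M act) c)"
    then show "Res (F_functor G M act) c c (Idn ?C c) x = x"
      by (cases "c = {\<one>}") (simp_all add: idn1 F_functor_def act_one)
  next
    fix b c d f g x
    assume *: "b \<in> Obj ?C" "c \<in> Obj ?C" "d \<in> Obj ?C" "f \<in> Arr ?C b c" "g \<in> Arr ?C c d"
      "x \<in> carrier (Val (F_functor G M act) d)"
    show "Res (F_functor G M act) b d (Cmp ?C g f) x
       = Res (F_functor G M act) b c f (Res (F_functor G M act) c d g x)"
    proof (cases "d = {\<one>}")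
      case True
      then have c: "c = {\<one>}" using into1 * sub by blast
      then have b: "b = {\<one>}" using into1 * sub by blast
      obtain u where u: "u \<in> carrier G" "f = {u}" using arr1[of f b] *(4) c by auto
      obtain v where v: "v \<in> carrier G" "g = {v}" using arr1[of g c] *(5) True by auto
      note uv = u v
      have x: "x \<in> carrier M" using *(6) True by (simp add: F_functor_def)
      show ?thesis using x uv True b c
        by (simp add: F_functor_def cmp inv_mult_group act_mult)
    next
      case False
      have a1: "act k \<one>\<^bsub>M\<^esub> = \<one>\<^bsub>M\<^esub>" if "k \<in> carrier G" for k
        by (rule hom_one[OF act_hom[OF that] M.group_axioms M.group_axioms])
      show ?thesis
      proof (cases "c = {\<one>}")
        case True
        then have b: "b = {\<one>}" using into1 * sub by blast
        obtain v where v: "v \<in> carrier G" "f = {v}" using arr1[of f b] *(4) True by auto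
        show ?thesis using False True b v a1 by (simp add: F_functor_def)
      next
        case c: False
        show ?thesis using False c by (simp add: F_functor_def)
      qed
    qed
  qed
qed

definition Lambda ::
  "nat \<Rightarrow> nat \<Rightarrow> ('g, 'b) monoid_scheme \<Rightarrow> 'm monoid \<Rightarrow> ('g \<Rightarrow> 'm \<Rightarrow> 'm)
   \<Rightarrow> ('g set \<Rightarrow> ('g set \<times> 'g set, 'm) univ) set monoid" where
  "Lambda p i G M act = higher_lim (orbit_category_p p G) (F_functor G M act) i"

definition Lambda_f ::
  "nat \<Rightarrow> nat \<Rightarrow> ('g, 'b) monoid_scheme \<Rightarrow> 'm monoid \<Rightarrow> ('g \<Rightarrow> 'm \<Rightarrow> 'm)
   \<Rightarrow> ('g set \<Rightarrow> ('g set \<times> 'g set, 'm) univ) set monoid" where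
  "Lambda_f p i G M act = higher_lim (orbit_category_pf p G) (F_functor G M act) i"

end

theory Submission
  imports Defs
begin

text \<open>Let \<open>I\<close> be an injective resolution of \<open>F\<^sub>M\<close> over \<open>\<O>\<^sub>p(G)\<close>. The finite subgroups form a sieve, so extension
  by zero is an exact left adjoint of restriction, and \<open>I\<close> restricts to an injective resolution over
  \<open>\<O>\<^sub>p\<^sup>f(G)\<close>. The map from the limit of \<open>I\<close> to the limit of its restriction is onto, and its kernel is
  the limit of the complex \<open>J\<close> of sections of \<open>I\<close> that vanish on all finite subgroups. On infinite
  subgroups \<open>J\<close> consists of injective modules, so its limit is exact as soon as \<open>J\<close> is exact at each
  infinite \<open>P\<close>. There, \<open>Arr c P\<close> is for finite \<open>c\<close> the filtered colimit of the sets \<open>Arr c Q\<close> over the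
  poset \<open>S\<close> of nontrivial finite subgroups \<open>Q\<close> of \<open>P\<close>, which is directed because \<open>P\<close> is locally finite.
  Hence coinduced modules are acyclic on \<open>S\<close>; and since \<open>F\<^sub>M\<close> vanishes on \<open>S\<close> and at \<open>P\<close>, dimension
  shifting shows that the limit of \<open>I\<close> over \<open>S\<close>, and then \<open>J\<close> at \<open>P\<close>, is exact.\<close>

section \<open>Divisible abelian groups\<close>

text \<open>Vanishing of \<open>F\<^sub>M\<close> at an infinite \<open>P\<close> decides nothing by
  itself: \<open>F\<^sub>M\<close> also vanishes at nontrivial finite subgroups, and these do
  contribute. The trivial subgroup is kept out of \<open>S\<close> because \<open>F\<^sub>M\<close>
  has the value \<open>M\<close> there, while dimension shifting needs a complex over
  \<open>S\<close> that is exact from degree 0 on. Nothing is lost: an infinite \<open>P\<close> has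
  a nontrivial element, which can be adjoined to any finite subset. Higher limits are defined by an
  arbitrary choice of resolution, but the argument needs coinduced ones: their sections are
  functions on arrows, so that a statement about the sets \<open>Arr c Q\<close> becomes one about
  cochains, and sections over a sieve visibly extend. The comparison theorem leads back to the
  chosen resolutions. Over \<open>S\<close> explicit chains take the place of injective modules,
  which reduces acyclicity to coning off a cycle and extending a homomorphism to a divisible group.
  Injectivity is tested on modules with values in one fixed type of codes, so quotients, hulls and
  images are all formed inside that type.\<close>

definition divisible_group :: "('a, 'b) monoid_scheme \<Rightarrow> bool" where
  "divisible_group D \<longleftrightarrow> comm_group D \<and>
     (\<forall>n::nat. \<forall>x\<in>carrier D. n > 0 \<longrightarrow> (\<exists>y\<in>carrier D. y [^]\<^bsub>D\<^esub> n = x))"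

text \<open>Homomorphisms from subgroups of \<open>B\<close> to \<open>D\<close> are represented by their graphs, which are subgroups of \<open>B \<times>\<times> D\<close>,
  so that Zorn's lemma applies to a set of subgroups ordered by inclusion.\<close>

lemma divisible_step:
  assumes B: "comm_group B" and D: "divisible_group D"
    and R: "subgroup R (B \<times>\<times> D)" and fn: "\<forall>y. (\<one>\<^bsub>B\<^esub>, y) \<in> R \<longrightarrow> y = \<one>\<^bsub>D\<^esub>"
    and b: "b \<in> carrier B"
  shows "\<exists>R'. subgroup R' (B \<times>\<times> D) \<and> (\<forall>y. (\<one>\<^bsub>B\<^esub>, y) \<in> R' \<longrightarrow> y = \<one>\<^bsub>D\<^esub>) \<and> R \<subseteq> R' \<and> b \<in> Domain R'"
proof -
  interpret B: comm_group B by fact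
  interpret D: comm_group D using D by (simp add: divisible_group_def)
  interpret BD: group "B \<times>\<times> D" using B.group_axioms D.group_axioms by (rule DirProd_group)
  have RB: "(x, y) \<in> R \<Longrightarrow> x \<in> carrier B \<and> y \<in> carrier D" for x y
    using subgroup.subset[OF R] by (auto simp: DirProd_def)
  have Rm: "(x, y) \<in> R \<Longrightarrow> (x', y') \<in> R \<Longrightarrow> (x \<otimes>\<^bsub>B\<^esub> x', y \<otimes>\<^bsub>D\<^esub> y') \<in> R" for x y x' y'
    using subgroup.m_closed[OF R, of "(x,y)" "(x',y')"] by (simp add: DirProd_def)
  have R1: "(\<one>\<^bsub>B\<^esub>, \<one>\<^bsub>D\<^esub>) \<in> R"
    using subgroup.one_closed[OF R] by (simp add: DirProd_def)
  have Ri: "(inv\<^bsub>B\<^esub> x, inv\<^bsub>D\<^esub> y) \<in> R" if "(x, y) \<in> R" for x y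
    using subgroup.m_inv_closed[OF R that] RB[OF that]
    by (simp add: inv_DirProd[OF B.group_axioms D.group_axioms])
  have Rp: "(x [^]\<^bsub>B\<^esub> k, y [^]\<^bsub>D\<^esub> k) \<in> R" if "(x, y) \<in> R" for x y and k :: nat
    by (induction k) (use R1 Rm that in auto)
  have Rz: "(x [^]\<^bsub>B\<^esub> k, y [^]\<^bsub>D\<^esub> k) \<in> R" if "(x, y) \<in> R" for x y and k :: int
  proof (cases "k < 0")
    case True
    show ?thesis using Ri[OF Rp[OF that, of "nat (- k)"]] True by (simp only: int_pow_def2 if_True)
  next
    case False
    show ?thesis using Rp[OF that, of "nat k"] False by (simp only: int_pow_def2 if_False)
  qed
  have uniq: "y = y'" if "(x, y) \<in> R" "(x, y') \<in> R" for x y y'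
  proof -
    have "(x \<otimes>\<^bsub>B\<^esub> inv\<^bsub>B\<^esub> x, y \<otimes>\<^bsub>D\<^esub> inv\<^bsub>D\<^esub> y') \<in> R" using Rm Ri that by blast
    then have "y \<otimes>\<^bsub>D\<^esub> inv\<^bsub>D\<^esub> y' = \<one>\<^bsub>D\<^esub>" using fn RB that by auto
    then show ?thesis using RB that by (metis D.inv_equality D.inv_inv D.inv_closed)
  qed
  \<comment> \<open>\<open>d\<close> is to become the value at \<open>b\<close>; it must agree with
    \<open>R\<close> on every power of \<open>b\<close> that already lies in
    \<open>Domain R\<close>.\<close>
  obtain d where d: "d \<in> carrier D" and dk: "\<And>(k::int) y. (b [^]\<^bsub>B\<^esub> k, y) \<in> R \<Longrightarrow> y = d [^]\<^bsub>D\<^esub> k"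
  proof (cases "\<exists>m>0::nat. b [^]\<^bsub>B\<^esub> m \<in> Domain R")
    case False
    have "y = \<one>\<^bsub>D\<^esub> [^]\<^bsub>D\<^esub> k" if "(b [^]\<^bsub>B\<^esub> k, y) \<in> R" for k :: int and y
    proof (cases "k = 0")
      case True then show ?thesis using that fn by simp
    next
      case k: False
      have "(b [^]\<^bsub>B\<^esub> nat \<bar>k\<bar>) \<in> Domain R"
      proof (cases "k < 0")
        case True
        have "(inv\<^bsub>B\<^esub> (b [^]\<^bsub>B\<^esub> k), inv\<^bsub>D\<^esub> y) \<in> R" using Ri[OF that] .
        then show ?thesis using True b by (simp only: int_pow_def2 if_True) auto
      next
        case f: False then show ?thesis using that by (simp only: int_pow_def2 if_False) auto
      qed
      moreover have "nat \<bar>k\<bar> > 0" using k by simp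
      ultimately show ?thesis using False by blast
    qed
    then show ?thesis using that by blast
  next
    case True
    \<comment> \<open>\<open>m\<close> generates the exponents of these powers, so \<open>d\<close>
      has to satisfy a single condition: its power with exponent \<open>m\<close> is
      \<open>e\<close>. Divisibility solves it.\<close>
    define m where "m = (LEAST m::nat. m > 0 \<and> b [^]\<^bsub>B\<^esub> m \<in> Domain R)"
    have m: "m > 0" "b [^]\<^bsub>B\<^esub> m \<in> Domain R"
      using LeastI_ex[of "\<lambda>m. m > 0 \<and> b [^]\<^bsub>B\<^esub> m \<in> Domain R"] True unfolding m_def by blast+
    have mmin: "r = 0" if "r < m" "b [^]\<^bsub>B\<^esub> r \<in> Domain R" for r
      using not_less_Least[of r "\<lambda>m. m > 0 \<and> b [^]\<^bsub>B\<^esub> m \<in> Domain R"] that unfolding m_def by auto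
    obtain e where e: "(b [^]\<^bsub>B\<^esub> m, e) \<in> R" using m by blast
    obtain d where d: "d \<in> carrier D" "d [^]\<^bsub>D\<^esub> m = e"
      using D m RB[OF e] unfolding divisible_group_def by blast
    have "y = d [^]\<^bsub>D\<^esub> k" if y: "(b [^]\<^bsub>B\<^esub> k, y) \<in> R" for k :: int and y
    proof -
      \<comment> \<open>Division with remainder: the power of \<open>b\<close> with exponent
        \<open>r < m\<close> lies in \<open>Domain R\<close>, so minimality of \<open>m\<close>
        forces \<open>r = 0\<close>.\<close>
      define q r where "q = k div int m" and "r = nat (k mod int m)"
      have k: "k = int m * q + int r" and r: "r < m"
        using m(1) by (auto simp: q_def r_def nat_less_iff)
      have mq: "(b [^]\<^bsub>B\<^esub> (int m * q), d [^]\<^bsub>D\<^esub> (int m * q)) \<in> R"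
        using Rz[OF e, of q] B.int_pow_pow[OF b, of "int m" q] D.int_pow_pow[OF d(1), of "int m" q] d(2)
        by (simp add: int_pow_int)
      have "(b [^]\<^bsub>B\<^esub> k \<otimes>\<^bsub>B\<^esub> inv\<^bsub>B\<^esub> (b [^]\<^bsub>B\<^esub> (int m * q)), y \<otimes>\<^bsub>D\<^esub> inv\<^bsub>D\<^esub> (d [^]\<^bsub>D\<^esub> (int m * q))) \<in> R"
        using Rm[OF y Ri[OF mq]] .
      moreover have "b [^]\<^bsub>B\<^esub> k \<otimes>\<^bsub>B\<^esub> inv\<^bsub>B\<^esub> (b [^]\<^bsub>B\<^esub> (int m * q)) = b [^]\<^bsub>B\<^esub> r"
        using B.int_pow_diff[OF b, of k "int m * q"] k by (simp add: int_pow_int)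
      ultimately have "b [^]\<^bsub>B\<^esub> r \<in> Domain R" by auto
      then have "r = 0" using mmin r by blast
      then show ?thesis using uniq[OF y] mq k by simp
    qed
    then show ?thesis using that d by blast
  qed
  define R' where "R' = {(x \<otimes>\<^bsub>B\<^esub> b [^]\<^bsub>B\<^esub> k, y \<otimes>\<^bsub>D\<^esub> d [^]\<^bsub>D\<^esub> k) | x y (k::int). (x, y) \<in> R}"
  have R'I: "(x \<otimes>\<^bsub>B\<^esub> b [^]\<^bsub>B\<^esub> k, y \<otimes>\<^bsub>D\<^esub> d [^]\<^bsub>D\<^esub> k) \<in> R'" if "(x, y) \<in> R" for x y and k :: int
    using that unfolding R'_def by blast
  have "subgroup R' (B \<times>\<times> D)"
  proof (rule BD.subgroupI)
    show "R' \<subseteq> carrier (B \<times>\<times> D)" unfolding R'_def using RB b d by (auto simp: DirProd_def)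
    show "R' \<noteq> {}" using R'I[OF R1] by blast
  next
    fix a assume "a \<in> R'"
    then obtain x y and k :: int where a: "(x, y) \<in> R" "a = (x \<otimes>\<^bsub>B\<^esub> b [^]\<^bsub>B\<^esub> k, y \<otimes>\<^bsub>D\<^esub> d [^]\<^bsub>D\<^esub> k)"
      unfolding R'_def by blast
    have "inv\<^bsub>B \<times>\<times> D\<^esub> a = (inv\<^bsub>B\<^esub> x \<otimes>\<^bsub>B\<^esub> b [^]\<^bsub>B\<^esub> (-k), inv\<^bsub>D\<^esub> y \<otimes>\<^bsub>D\<^esub> d [^]\<^bsub>D\<^esub> (-k))"
      unfolding a(2) using RB[OF a(1)] b d
      by (subst inv_DirProd[OF B.group_axioms D.group_axioms])
         (auto simp: B.inv_mult D.inv_mult B.int_pow_neg D.int_pow_neg)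
    then show "inv\<^bsub>B \<times>\<times> D\<^esub> a \<in> R'" using R'I[OF Ri[OF a(1)], of "-k"] by simp
  next
    fix a a' assume "a \<in> R'" "a' \<in> R'"
    then obtain x y x' y' and k k' :: int where a: "(x, y) \<in> R" "a = (x \<otimes>\<^bsub>B\<^esub> b [^]\<^bsub>B\<^esub> k, y \<otimes>\<^bsub>D\<^esub> d [^]\<^bsub>D\<^esub> k)"
      and a': "(x', y') \<in> R" "a' = (x' \<otimes>\<^bsub>B\<^esub> b [^]\<^bsub>B\<^esub> k', y' \<otimes>\<^bsub>D\<^esub> d [^]\<^bsub>D\<^esub> k')"
      unfolding R'_def by blast
    have "a \<otimes>\<^bsub>B \<times>\<times> D\<^esub> a' = ((x \<otimes>\<^bsub>B\<^esub> x') \<otimes>\<^bsub>B\<^esub> b [^]\<^bsub>B\<^esub> (k + k'), (y \<otimes>\<^bsub>D\<^esub> y') \<otimes>\<^bsub>D\<^esub> d [^]\<^bsub>D\<^esub> (k + k'))"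
      using RB[OF a(1)] RB[OF a'(1)] b d unfolding a(2) a'(2)
      by (simp add: B.int_pow_mult D.int_pow_mult B.m_ac D.m_ac)
    then show "a \<otimes>\<^bsub>B \<times>\<times> D\<^esub> a' \<in> R'" using R'I[OF Rm[OF a(1) a'(1)]] by simp
  qed
  \<comment> \<open>A relation between \<open>x\<close> and a power of \<open>b\<close> puts that
    power into \<open>Domain R\<close>, where \<open>dk\<close> fixes its value; this keeps
    \<open>R'\<close> the graph of a function.\<close>
  moreover have "y = \<one>\<^bsub>D\<^esub>" if y: "(\<one>\<^bsub>B\<^esub>, y) \<in> R'" for y
  proof -
    obtain x z and k :: int where x: "(x, z) \<in> R"
        and eq: "(\<one>\<^bsub>B\<^esub>, y) = (x \<otimes>\<^bsub>B\<^esub> b [^]\<^bsub>B\<^esub> k, z \<otimes>\<^bsub>D\<^esub> d [^]\<^bsub>D\<^esub> k)"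
      using y unfolding R'_def by blast
    have xz: "(x, z) \<in> R" "\<one>\<^bsub>B\<^esub> = x \<otimes>\<^bsub>B\<^esub> b [^]\<^bsub>B\<^esub> k" "y = z \<otimes>\<^bsub>D\<^esub> d [^]\<^bsub>D\<^esub> k"
      using x eq by auto
    have "inv\<^bsub>B\<^esub> (b [^]\<^bsub>B\<^esub> k) = x"
      by (rule B.inv_equality[OF xz(2)[symmetric]]) (use b RB[OF xz(1)] in auto)
    then have "b [^]\<^bsub>B\<^esub> k = inv\<^bsub>B\<^esub> x" using b by auto
    then have "(b [^]\<^bsub>B\<^esub> k, inv\<^bsub>D\<^esub> z) \<in> R" using Ri[OF xz(1)] by simp
    then have "inv\<^bsub>D\<^esub> z = d [^]\<^bsub>D\<^esub> k" by (rule dk)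
    then show ?thesis using xz(3) RB[OF xz(1)] D.r_inv[of z] by simp
  qed
  moreover have "R \<subseteq> R'"
  proof
    fix a assume "a \<in> R"
    then show "a \<in> R'" using R'I[of "fst a" "snd a" 0] RB[of "fst a" "snd a"] by simp
  qed
  moreover have "b \<in> Domain R'"
    using R'I[OF R1, of 1] b d by (auto simp: B.int_pow_1)
  ultimately show ?thesis by blast
qed

text \<open>Baer's argument for abelian groups: a maximal graph has all of \<open>B\<close> as its
  domain, because \<open>divisible_step\<close> would otherwise enlarge it.\<close>

lemma divisible_extension:
  assumes B: "comm_group B" and D: "divisible_group D"
    and A: "subgroup A B" and \<phi>: "\<phi> \<in> hom (B\<lparr>carrier := A\<rparr>) D"
  shows "\<exists>\<psi> \<in> hom B D. \<forall>x\<in>A. \<psi> x = \<phi> x"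
proof -
  interpret B: comm_group B by fact
  interpret D: comm_group D using D by (simp add: divisible_group_def)
  interpret BD: group "B \<times>\<times> D" using B.group_axioms D.group_axioms by (rule DirProd_group)
  interpret A: group "B\<lparr>carrier := A\<rparr>" using A by (rule B.subgroup_imp_group)
  interpret phi: group_hom "B\<lparr>carrier := A\<rparr>" D \<phi>
    using A.group_axioms D.group_axioms \<phi> by (simp add: group_hom_def group_hom_axioms_def)
  have Ac: "x \<in> A \<Longrightarrow> x \<in> carrier B" for x using subgroup.mem_carrier[OF A] .
  have phic: "x \<in> A \<Longrightarrow> \<phi> x \<in> carrier D" for x using phi.hom_closed by simp
  define R0 where "R0 = (\<lambda>x. (x, \<phi> x)) ` A"
  have R0: "subgroup R0 (B \<times>\<times> D)"
  proof (rule BD.subgroupI)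
    show "R0 \<subseteq> carrier (B \<times>\<times> D)" using Ac phic by (auto simp: R0_def)
    show "R0 \<noteq> {}" using subgroup.one_closed[OF A] by (auto simp: R0_def)
  next
    fix a assume "a \<in> R0"
    then obtain x where x: "x \<in> A" "a = (x, \<phi> x)" by (auto simp: R0_def)
    have "inv\<^bsub>B \<times>\<times> D\<^esub> a = (inv\<^bsub>B\<^esub> x, \<phi> (inv\<^bsub>B\<^esub> x))"
      using phi.hom_inv[of x] x Ac phic B.m_inv_consistent[OF A x(1)]
      by (simp add: inv_DirProd[OF B.group_axioms D.group_axioms])
    then show "inv\<^bsub>B \<times>\<times> D\<^esub> a \<in> R0" using subgroup.m_inv_closed[OF A x(1)] by (auto simp: R0_def)
  next
    fix a b assume "a \<in> R0" "b \<in> R0"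
    then obtain x y where xy: "x \<in> A" "a = (x, \<phi> x)" "y \<in> A" "b = (y, \<phi> y)" by (auto simp: R0_def)
    then have "a \<otimes>\<^bsub>B \<times>\<times> D\<^esub> b = (x \<otimes>\<^bsub>B\<^esub> y, \<phi> (x \<otimes>\<^bsub>B\<^esub> y))" using phi.hom_mult[of x y] by simp
    then show "a \<otimes>\<^bsub>B \<times>\<times> D\<^esub> b \<in> R0"
      using subgroup.m_closed[OF A xy(1,3)] by (auto simp: R0_def)
  qed
  define \<F> where "\<F> = {R. subgroup R (B \<times>\<times> D) \<and> (\<forall>y. (\<one>\<^bsub>B\<^esub>, y) \<in> R \<longrightarrow> y = \<one>\<^bsub>D\<^esub>) \<and> R0 \<subseteq> R}"
  have "R0 \<in> \<F>" using R0 phi.hom_one by (auto simp: \<F>_def R0_def)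
  have "\<exists>M\<in>\<F>. \<forall>W\<in>\<F>. M \<subseteq> W \<longrightarrow> W = M"
  proof (rule subset_Zorn_nonempty)
    show "\<F> \<noteq> {}" using \<open>R0 \<in> \<F>\<close> by blast
  next
    fix \<C> assume C: "\<C> \<noteq> {}" "subset.chain \<F> \<C>"
    have CF: "W \<in> \<C> \<Longrightarrow> W \<in> \<F>" for W using C(2) by (auto simp: subset.chain_def)
    have Csub: "W \<in> \<C> \<Longrightarrow> subgroup W (B \<times>\<times> D)" for W using CF by (auto simp: \<F>_def)
    have lin: "W \<in> \<C> \<Longrightarrow> Y \<in> \<C> \<Longrightarrow> W \<subseteq> Y \<or> Y \<subseteq> W" for W Y
      using C(2) by (auto simp: subset.chain_def)
    have "subgroup (\<Union>\<C>) (B \<times>\<times> D)"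
    proof (rule BD.subgroupI)
      show "\<Union>\<C> \<subseteq> carrier (B \<times>\<times> D)" using subgroup.subset[OF Csub] by blast
      show "\<Union>\<C> \<noteq> {}" using C(1) subgroup.one_closed[OF Csub] by blast
      show "inv\<^bsub>B \<times>\<times> D\<^esub> a \<in> \<Union>\<C>" if "a \<in> \<Union>\<C>" for a
        using that subgroup.m_inv_closed[OF Csub] by blast
      show "a \<otimes>\<^bsub>B \<times>\<times> D\<^esub> b \<in> \<Union>\<C>" if ab: "a \<in> \<Union>\<C>" "b \<in> \<Union>\<C>" for a b
      proof -
        obtain W Y where XY: "a \<in> W" "W \<in> \<C>" "b \<in> Y" "Y \<in> \<C>" using ab by blast
        then obtain Z where Z: "Z \<in> \<C>" "a \<in> Z" "b \<in> Z" using lin[of W Y] by blast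
        then show ?thesis using subgroup.m_closed[OF Csub[OF Z(1)] Z(2,3)] by blast
      qed
    qed
    then show "\<Union>\<C> \<in> \<F>" using CF C(1) unfolding \<F>_def by blast
  qed
  then obtain M where M: "M \<in> \<F>" and max: "\<And>W. W \<in> \<F> \<Longrightarrow> M \<subseteq> W \<Longrightarrow> W = M" by blast
  have Ms: "subgroup M (B \<times>\<times> D)" and M1: "\<forall>y. (\<one>\<^bsub>B\<^esub>, y) \<in> M \<longrightarrow> y = \<one>\<^bsub>D\<^esub>" and MR: "R0 \<subseteq> M"
    using M by (auto simp: \<F>_def)
  have MB: "(x, y) \<in> M \<Longrightarrow> x \<in> carrier B \<and> y \<in> carrier D" for x y
    using subgroup.subset[OF Ms] by auto
  have dom: "b \<in> Domain M" if b: "b \<in> carrier B" for b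
  proof -
    obtain R' where R': "subgroup R' (B \<times>\<times> D)" "\<forall>y. (\<one>\<^bsub>B\<^esub>, y) \<in> R' \<longrightarrow> y = \<one>\<^bsub>D\<^esub>" "M \<subseteq> R'" "b \<in> Domain R'"
      using divisible_step[OF B D Ms M1 b] by blast
    then have "R' \<in> \<F>" using MR by (auto simp: \<F>_def)
    then have "R' = M" using max R'(3) by blast
    then show ?thesis using R'(4) by simp
  qed
  have uniq: "y = y'" if "(x, y) \<in> M" "(x, y') \<in> M" for x y y'
  proof -
    have "(inv\<^bsub>B\<^esub> x, inv\<^bsub>D\<^esub> y') \<in> M"
      using subgroup.m_inv_closed[OF Ms that(2)] MB[OF that(2)]
      by (simp add: inv_DirProd[OF B.group_axioms D.group_axioms])
    from subgroup.m_closed[OF Ms that(1) this] have "y \<otimes>\<^bsub>D\<^esub> inv\<^bsub>D\<^esub> y' = \<one>\<^bsub>D\<^esub>"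
      using M1 MB[OF that(1)] by simp
    then show ?thesis using MB that by (metis D.inv_equality D.inv_inv D.inv_closed)
  qed
  define \<psi> where "\<psi> x = (THE y. (x, y) \<in> M)" for x
  have psi: "(x, \<psi> x) \<in> M" if x: "x \<in> carrier B" for x
  proof -
    obtain y where "(x, y) \<in> M" using dom[OF x] by blast
    then show ?thesis unfolding \<psi>_def by (rule theI) (use uniq \<open>(x, y) \<in> M\<close> in blast)
  qed
  have "\<psi> \<in> hom B D"
  proof (rule homI)
    show "\<psi> x \<in> carrier D" if "x \<in> carrier B" for x using psi[OF that] MB by blast
    show "\<psi> (x \<otimes>\<^bsub>B\<^esub> y) = \<psi> x \<otimes>\<^bsub>D\<^esub> \<psi> y" if "x \<in> carrier B" "y \<in> carrier B" for x y
      using subgroup.m_closed[OF Ms psi[OF that(1)] psi[OF that(2)]] psi[of "x \<otimes>\<^bsub>B\<^esub> y"] that uniq by simp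
  qed
  moreover have "\<psi> x = \<phi> x" if "x \<in> A" for x
    using psi[OF Ac[OF that]] MR that uniq unfolding R0_def by blast
  ultimately show ?thesis by blast
qed

section \<open>Homomorphisms that factor through an image, isomorphisms of quotients\<close>

lemma group_hom_of_comm:
  assumes "comm_group A" "comm_group B" "f \<in> hom A B" shows "group_hom A B f"
  using assms by (simp add: group_hom_def group_hom_axioms_def comm_group.axioms(2))

lemma factor_through_image:
  assumes A: "comm_group A" and B: "comm_group B" and D: "comm_group D"
    and f: "f \<in> hom A B" and \<alpha>: "\<alpha> \<in> hom A D"
    and ker: "\<And>x. x \<in> carrier A \<Longrightarrow> f x = \<one>\<^bsub>B\<^esub> \<Longrightarrow> \<alpha> x = \<one>\<^bsub>D\<^esub>"
  shows "\<exists>\<phi> \<in> hom (B\<lparr>carrier := f ` carrier A\<rparr>) D. \<forall>x\<in>carrier A. \<phi> (f x) = \<alpha> x"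
proof -
  interpret A: comm_group A by fact
  interpret B: comm_group B by fact
  interpret D: comm_group D by fact
  interpret f: group_hom A B f using A B f by (rule group_hom_of_comm)
  interpret \<alpha>: group_hom A D \<alpha> using A D \<alpha> by (rule group_hom_of_comm)
  have eq: "\<alpha> x = \<alpha> y" if "x \<in> carrier A" "y \<in> carrier A" "f x = f y" for x y
  proof -
    have "f (x \<otimes>\<^bsub>A\<^esub> inv\<^bsub>A\<^esub> y) = \<one>\<^bsub>B\<^esub>" using that by simp
    then have "\<alpha> x \<otimes>\<^bsub>D\<^esub> inv\<^bsub>D\<^esub> \<alpha> y = \<one>\<^bsub>D\<^esub>" using ker[of "x \<otimes>\<^bsub>A\<^esub> inv\<^bsub>A\<^esub> y"] that by simp
    then show ?thesis using that D.inv_equality[of "\<alpha> x" "inv\<^bsub>D\<^esub> \<alpha> y"] by simp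
  qed
  define \<phi> where "\<phi> = (\<lambda>y. \<alpha> (SOME x. x \<in> carrier A \<and> f x = y))"
  have \<phi>f: "\<phi> (f x) = \<alpha> x" if "x \<in> carrier A" for x
    unfolding \<phi>_def by (rule someI2[of _ x]) (use that eq in blast)+
  have "\<phi> \<in> hom (B\<lparr>carrier := f ` carrier A\<rparr>) D"
  proof (rule homI)
    show "\<phi> x \<in> carrier D" if "x \<in> carrier (B\<lparr>carrier := f ` carrier A\<rparr>)" for x
      using that \<phi>f by auto
    fix x y assume "x \<in> carrier (B\<lparr>carrier := f ` carrier A\<rparr>)" "y \<in> carrier (B\<lparr>carrier := f ` carrier A\<rparr>)"
    then obtain a b where ab: "a \<in> carrier A" "x = f a" "b \<in> carrier A" "y = f b" by auto
    have "\<phi> (f (a \<otimes>\<^bsub>A\<^esub> b)) = \<alpha> a \<otimes>\<^bsub>D\<^esub> \<alpha> b" using ab \<phi>f[of "a \<otimes>\<^bsub>A\<^esub> b"] by simp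
    then show "\<phi> (x \<otimes>\<^bsub>B\<lparr>carrier := f ` carrier A\<rparr>\<^esub> y) = \<phi> x \<otimes>\<^bsub>D\<^esub> \<phi> y"
      using ab \<phi>f by simp
  qed
  then show ?thesis using \<phi>f by (intro bexI[of _ \<phi>]) simp_all
qed

text \<open>Injectivity of \<open>D\<close> in the form used later: \<open>f\<close> need not be
  injective, only its kernel must die under \<alpha>. Boundary maps satisfy this whenever exactness
  identifies their kernel.\<close>

lemma divisible_factor:
  assumes A: "comm_group A" and B: "comm_group B" and D: "divisible_group D"
    and f: "f \<in> hom A B" and \<alpha>: "\<alpha> \<in> hom A D"
    and ker: "\<And>x. x \<in> carrier A \<Longrightarrow> f x = \<one>\<^bsub>B\<^esub> \<Longrightarrow> \<alpha> x = \<one>\<^bsub>D\<^esub>"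
  shows "\<exists>\<beta> \<in> hom B D. \<forall>x\<in>carrier A. \<beta> (f x) = \<alpha> x"
proof -
  have Dc: "comm_group D" using D by (simp add: divisible_group_def)
  obtain \<phi> where \<phi>: "\<phi> \<in> hom (B\<lparr>carrier := f ` carrier A\<rparr>) D" "\<forall>x\<in>carrier A. \<phi> (f x) = \<alpha> x"
    using factor_through_image[OF A B Dc f \<alpha> ker] by blast
  have "subgroup (f ` carrier A) B"
    by (rule group_hom.img_is_subgroup[OF group_hom_of_comm[OF A B f]])
  from divisible_extension[OF B D this \<phi>(1)]
  obtain \<beta> where \<beta>: "\<beta> \<in> hom B D" "\<forall>y\<in>f ` carrier A. \<beta> y = \<phi> y" by blast
  show ?thesis by (rule bexI[OF _ \<beta>(1)]) (simp add: \<beta>(2) \<phi>(2))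
qed

text \<open>First isomorphism theorem for the map that sends \<open>x\<close> to the coset of
  \<open>h x\<close>. Surjectivity is asked only modulo \<open>K\<close>, since a comparison map of
  complexes reaches cocycles only up to coboundaries.\<close>

lemma FactGroup_iso_of_hom:
  assumes G: "comm_group G" and H: "comm_group H" and N: "subgroup N G" and K: "subgroup K H"
    and h: "h \<in> hom G H"
    and ker: "\<And>x. x \<in> carrier G \<Longrightarrow> h x \<in> K \<longleftrightarrow> x \<in> N"
    and surj: "\<And>y. y \<in> carrier H \<Longrightarrow> \<exists>x\<in>carrier G. \<exists>k\<in>K. y = k \<otimes>\<^bsub>H\<^esub> h x"
  shows "G Mod N \<cong> H Mod K"
proof -
  interpret G: comm_group G by fact
  interpret H: comm_group H by fact
  interpret h: group_hom G H h using G H h by (rule group_hom_of_comm)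
  interpret K: normal K H using K by (rule H.subgroup_imp_normal)
  define q where "q = (\<lambda>x. K #>\<^bsub>H\<^esub> h x)"
  have "q \<in> hom G (H Mod K)"
    unfolding q_def using hom_compose[OF h K.r_coset_hom_Mod] by (simp add: o_def)
  then interpret q: group_hom G "H Mod K" q
    using G.group_axioms K.factorgroup_is_group by (simp add: group_hom_def group_hom_axioms_def)
  have "K #>\<^bsub>H\<^esub> h x = K \<longleftrightarrow> x \<in> N" if "x \<in> carrier G" for x
    using H.coset_join1[of K "h x"] H.coset_join2[of "h x" K] K ker[OF that] that by auto
  then have "kernel G (H Mod K) q = N"
    using subgroup.mem_carrier[OF N] by (auto simp: kernel_def q_def)
  moreover have "q ` carrier G = carrier (H Mod K)"
  proof
    show "carrier (H Mod K) \<subseteq> q ` carrier G"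
    proof
      fix W assume "W \<in> carrier (H Mod K)"
      then obtain y where y: "y \<in> carrier H" "W = K #>\<^bsub>H\<^esub> y" by (auto simp: carrier_FactGroup)
      then obtain x k where x: "x \<in> carrier G" "k \<in> K" "y = k \<otimes>\<^bsub>H\<^esub> h x" using surj by blast
      have "K #>\<^bsub>H\<^esub> h x = W"
        unfolding y(2) by (rule H.repr_independence) (use x K in \<open>auto simp: r_coset_def\<close>)
      then show "W \<in> q ` carrier G" using x by (auto simp: q_def)
    qed
  qed (use q.hom_closed in auto)
  ultimately show ?thesis using q.FactGroup_iso by simp
qed

section \<open>Quotients and divisible hulls inside the type of codes\<close>

text \<open>A coset is represented by the code of a chosen element, so that a quotient does not leave the type of the codes.\<close>

lemma quotient_code:
  fixes e :: "'a \<Rightarrow> 'b"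
  assumes G: "comm_group G" and N: "subgroup N G" and e: "inj_on e (carrier G)"
  shows "\<exists>(Q :: 'b monoid) \<pi>. comm_group Q \<and> \<pi> \<in> hom G Q \<and> \<pi> ` carrier G = carrier Q \<and>
     (\<forall>x\<in>carrier G. \<pi> x = \<one>\<^bsub>Q\<^esub> \<longleftrightarrow> x \<in> N)"
proof -
  interpret G: comm_group G by fact
  interpret N: normal N G using N by (rule G.subgroup_imp_normal)
  interpret GN: comm_group "G Mod N" using N by (rule G.abelian_FactGroup)
  define r where "r = (\<lambda>W. SOME x. x \<in> carrier G \<and> W = N #>\<^bsub>G\<^esub> x)"
  have r: "r W \<in> carrier G \<and> W = N #>\<^bsub>G\<^esub> r W" if "W \<in> carrier (G Mod N)" for W
    unfolding r_def by (rule someI_ex) (use that in \<open>auto simp: carrier_FactGroup\<close>)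
  have inj: "inj_on (e \<circ> r) (carrier (G Mod N))"
    using r e by (intro inj_onI) (metis comp_apply inj_onD)
  define Q where "Q = image_group (e \<circ> r) (G Mod N)"
  have iso: "e \<circ> r \<in> iso (G Mod N) Q" unfolding Q_def using inj by (rule inj_imp_image_group_iso)
  have "group Q" unfolding Q_def using inj by (rule GN.inj_imp_image_group_is_group)
  then have Q: "comm_group Q"
    using GN.iso_imp_comm_group[of Q] iso by (auto simp: is_iso_def group.is_monoid)
  interpret Q: comm_group Q by (fact Q)
  interpret er: group_hom "G Mod N" Q "e \<circ> r"
    using iso by unfold_locales (simp add: iso_def)
  define \<pi> where "\<pi> = (e \<circ> r) \<circ> (\<lambda>x. N #>\<^bsub>G\<^esub> x)"
  have "\<pi> \<in> hom G Q"
    unfolding \<pi>_def using N.r_coset_hom_Mod er.homh by (rule hom_compose)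
  moreover have "\<pi> ` carrier G = carrier Q"
    unfolding \<pi>_def using iso by (simp add: iso_def bij_betw_def carrier_FactGroup image_comp o_def)
  moreover have "\<pi> x = \<one>\<^bsub>Q\<^esub> \<longleftrightarrow> x \<in> N" if x: "x \<in> carrier G" for x
  proof -
    have "N #>\<^bsub>G\<^esub> x \<in> carrier (G Mod N)" using x by (auto simp: carrier_FactGroup)
    then have "\<pi> x = \<one>\<^bsub>Q\<^esub> \<longleftrightarrow> N #>\<^bsub>G\<^esub> x = N"
      using er.hom_one inj GN.one_closed unfolding \<pi>_def
      by (metis comp_apply inj_onD one_FactGroup)
    also have "\<dots> \<longleftrightarrow> x \<in> N"
      using G.coset_join1[of N x] G.coset_join2[of x N] N x by auto
    finally show ?thesis .
  qed
  ultimately show ?thesis using Q by blast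
qed

text \<open>Embeds the free abelian group in the rational vector space on the same basis.\<close>

definition ratfrag :: "('y \<Rightarrow>\<^sub>0 int) \<Rightarrow> ('y \<Rightarrow>\<^sub>0 rat)" where
  "ratfrag = Poly_Mapping.mapp (\<lambda>_. rat_of_int)"

lemma lookup_ratfrag: "Poly_Mapping.lookup (ratfrag f) k = rat_of_int (Poly_Mapping.lookup f k)"
  by (auto simp: ratfrag_def lookup_mapp when_def in_keys_iff)

lemma ratfrag_add: "ratfrag (f + g) = ratfrag f + ratfrag g"
  by (rule poly_mapping_eqI) (simp add: lookup_ratfrag lookup_add)

lemma keys_ratfrag: "Poly_Mapping.keys (ratfrag f) = Poly_Mapping.keys f"
  by (auto simp: in_keys_iff lookup_ratfrag)

lemma ratfrag_inj: "ratfrag f = ratfrag g \<Longrightarrow> f = g"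
  by (rule poly_mapping_eqI) (metis lookup_ratfrag of_int_eq_iff)

text \<open>The support is listed in an order picked by \<open>SOME\<close>; decoding looks only at
  the set of entries, so neither the order nor repetitions in the list matter.\<close>

definition ratvec_code :: "('y \<Rightarrow> ('i, 'm) univ) \<Rightarrow> ('y \<Rightarrow>\<^sub>0 rat) \<Rightarrow> ('i, 'm) univ" where
  "ratvec_code c g = Seq (map (\<lambda>a. Seq [c a, Num (Poly_Mapping.lookup g a)])
      (SOME xs. set xs = Poly_Mapping.keys g))"

lemma ratvec_code_inj:
  assumes c: "inj_on c A" and g: "Poly_Mapping.keys g \<subseteq> A" and h: "Poly_Mapping.keys h \<subseteq> A"
    and eq: "ratvec_code c g = ratvec_code c h"
  shows "g = h"
proof -
  have "set (SOME xs. set xs = Poly_Mapping.keys g) = Poly_Mapping.keys g" for g :: "'a \<Rightarrow>\<^sub>0 rat"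
    by (rule someI_ex) (simp add: finite_list)
  note s = this[of g] this[of h]
  have "(\<lambda>a. Seq [c a, Num (Poly_Mapping.lookup g a)]) ` Poly_Mapping.keys g
      = (\<lambda>a. Seq [c a, Num (Poly_Mapping.lookup h a)]) ` Poly_Mapping.keys h"
    using arg_cong[OF eq[unfolded ratvec_code_def univ.inject], of set] by (simp add: s)
  note img = this
  have 1: "a \<in> Poly_Mapping.keys h \<and> Poly_Mapping.lookup g a = Poly_Mapping.lookup h a" if "a \<in> Poly_Mapping.keys g" for a
  proof -
    have "Seq [c a, Num (Poly_Mapping.lookup g a)] \<in> (\<lambda>a. Seq [c a, Num (Poly_Mapping.lookup h a)]) ` Poly_Mapping.keys h"
      unfolding img[symmetric] using that by (rule imageI)
    then show ?thesis using c that g h by (auto dest: inj_onD)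
  qed
  have 2: "a \<in> Poly_Mapping.keys g" if "a \<in> Poly_Mapping.keys h" for a
  proof -
    have "Seq [c a, Num (Poly_Mapping.lookup h a)] \<in> (\<lambda>a. Seq [c a, Num (Poly_Mapping.lookup g a)]) ` Poly_Mapping.keys g"
      unfolding img using that by (rule imageI)
    then show ?thesis using c that g h by (auto dest: inj_onD)
  qed
  show ?thesis
    by (rule poly_mapping_eqI) (metis 1 2 in_keys_iff)
qed

text \<open>The hull is the rational vector space on \<open>carrier A\<close> modulo the relations of \<open>A\<close>.\<close>

lemma divisible_hull:
  fixes A :: "'y monoid" and c :: "'y \<Rightarrow> ('i, 'm) univ"
  assumes A: "comm_group A" and c: "inj_on c (carrier A)"
  shows "\<exists>(D :: ('i, 'm) univ monoid) j. divisible_group D \<and> j \<in> hom A D \<and> inj_on j (carrier A)"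
proof -
  interpret A: comm_group A by fact
  let ?F = "free_Abelian_group (carrier A)"
  interpret F: comm_group ?F by (rule abelian_free_Abelian_group)
  obtain h where h: "h \<in> hom ?F A" and hof: "\<And>x. x \<in> carrier A \<Longrightarrow> h (frag_of x) = x"
    using A.free_Abelian_group_universal[of "\<lambda>x. x" "carrier A"] by auto
  interpret h: group_hom ?F A h using F.comm_group_axioms A h by (rule group_hom_of_comm)
  define V :: "('y \<Rightarrow>\<^sub>0 rat) monoid" where
    "V = \<lparr>carrier = {g. Poly_Mapping.keys g \<subseteq> carrier A}, monoid.mult = (+), one = 0\<rparr>"
  have V: "comm_group V"
  proof (rule comm_groupI)
    show "\<exists>y\<in>carrier V. y \<otimes>\<^bsub>V\<^esub> x = \<one>\<^bsub>V\<^esub>" if "x \<in> carrier V" for x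
      by (rule bexI[of _ "- x"]) (use that in \<open>auto simp: V_def in_keys_iff\<close>)
  qed (use keys_add in \<open>fastforce simp: V_def ac_simps\<close>)+
  interpret V: comm_group V by (fact V)
  \<comment> \<open>The relations of \<open>A\<close>, that is, the kernel of the map
    \<open>h\<close> that sends each generator to the element it names, seen inside
    \<open>V\<close>.\<close>
  define K where "K = ratfrag ` {f. Poly_Mapping.keys f \<subseteq> carrier A \<and> h f = \<one>\<^bsub>A\<^esub>}"
  have rat: "ratfrag \<in> hom ?F V"
    by (rule homI) (auto simp: V_def keys_ratfrag ratfrag_add)
  interpret rat: group_hom ?F V ratfrag using F.comm_group_axioms V rat by (rule group_hom_of_comm)
  have K_eq: "K = ratfrag ` kernel ?F A h" by (auto simp: K_def kernel_def)
  have K: "subgroup K V"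
    unfolding K_eq by (rule rat.subgroup_img_is_subgroup[OF h.subgroup_kernel])
  have vc: "inj_on (ratvec_code c) (carrier V)"
    using ratvec_code_inj[OF c] by (intro inj_onI) (auto simp: V_def)
  obtain D :: "('i, 'm) univ monoid" and \<pi> where D: "comm_group D" and \<pi>: "\<pi> \<in> hom V D"
    and \<pi>s: "\<pi> ` carrier V = carrier D" and \<pi>k: "\<And>x. x \<in> carrier V \<Longrightarrow> \<pi> x = \<one>\<^bsub>D\<^esub> \<longleftrightarrow> x \<in> K"
    using quotient_code[OF V K vc] by blast
  interpret D: comm_group D by (fact D)
  interpret \<pi>: group_hom V D \<pi> using V D \<pi> by (rule group_hom_of_comm)
  define j where "j = \<pi> \<circ> ratfrag \<circ> frag_of"
  have frat: "ratfrag f \<in> carrier V" if "f \<in> carrier ?F" for f using rat.hom_closed that .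
  \<comment> \<open>An integral vector lies in \<open>K\<close> only if it is a relation of
    \<open>A\<close>, because \<open>ratfrag\<close> is injective; this is what makes
    \<open>j\<close> injective.\<close>
  have hK: "ratfrag f \<in> K \<longleftrightarrow> h f = \<one>\<^bsub>A\<^esub>" if "f \<in> carrier ?F" for f
    using that ratfrag_inj by (fastforce simp: K_def)
  have jeq: "\<pi> (ratfrag f) = \<pi> (ratfrag g)" if "f \<in> carrier ?F" "g \<in> carrier ?F" "h f = h g" for f g
  proof -
    have "h (f \<otimes>\<^bsub>?F\<^esub> inv\<^bsub>?F\<^esub> g) = \<one>\<^bsub>A\<^esub>" using that h.hom_mult h.hom_inv by (metis A.r_inv F.inv_closed h.hom_closed)
    then have "\<pi> (ratfrag (f \<otimes>\<^bsub>?F\<^esub> inv\<^bsub>?F\<^esub> g)) = \<one>\<^bsub>D\<^esub>"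
      using \<pi>k hK that frat by (meson F.inv_closed F.m_closed)
    then have "\<pi> (ratfrag f) \<otimes>\<^bsub>D\<^esub> inv\<^bsub>D\<^esub> \<pi> (ratfrag g) = \<one>\<^bsub>D\<^esub>"
      using that frat rat.hom_mult rat.hom_inv \<pi>.hom_mult \<pi>.hom_inv by (metis F.inv_closed)
    then show ?thesis using that frat D.inv_equality[of "\<pi> (ratfrag f)" "inv\<^bsub>D\<^esub> \<pi> (ratfrag g)"] by simp
  qed
  have "j \<in> hom A D"
  proof (rule homI)
    show "j x \<in> carrier D" if "x \<in> carrier A" for x using that frat[of "frag_of x"] by (simp add: j_def)
    fix x y assume xy: "x \<in> carrier A" "y \<in> carrier A"
    have "\<pi> (ratfrag (frag_of (x \<otimes>\<^bsub>A\<^esub> y))) = \<pi> (ratfrag (frag_of x \<otimes>\<^bsub>?F\<^esub> frag_of y))"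
      by (rule jeq) (use xy h.hom_mult[of "frag_of x" "frag_of y"] F.m_closed[of "frag_of x" "frag_of y"] hof in auto)
    then show "j (x \<otimes>\<^bsub>A\<^esub> y) = j x \<otimes>\<^bsub>D\<^esub> j y"
      using xy rat.hom_mult[of "frag_of x" "frag_of y"] \<pi>.hom_mult[of "ratfrag (frag_of x)" "ratfrag (frag_of y)"]
        frat[of "frag_of x"] frat[of "frag_of y"] by (simp add: j_def)
  qed
  moreover have "inj_on j (carrier A)"
  proof -
    interpret j: group_hom A D j using A D \<open>j \<in> hom A D\<close> by (rule group_hom_of_comm)
    have "x = \<one>\<^bsub>A\<^esub>" if "x \<in> carrier A" "j x = \<one>\<^bsub>D\<^esub>" for x
      using that \<pi>k[OF frat[of "frag_of x"]] hK[of "frag_of x"] hof by (simp add: j_def)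
    then show ?thesis by (simp add: j.inj_on_one_iff)
  qed
  moreover have "divisible_group D"
    unfolding divisible_group_def
  proof (intro conjI allI ballI impI)
    fix n :: nat and x assume x: "x \<in> carrier D" "0 < n"
    obtain g where g: "g \<in> carrier V" "x = \<pi> g" using x \<pi>s by blast
    \<comment> \<open>Roots are taken in the vector space \<open>V\<close> and then projected to
      \<open>D\<close>.\<close>
    define g' where "g' = Poly_Mapping.mapp (\<lambda>_ q. q / of_nat n) g"
    have lg': "Poly_Mapping.lookup g' k = Poly_Mapping.lookup g k / of_nat n" for k
      by (auto simp: g'_def lookup_mapp when_def in_keys_iff)
    have g': "g' \<in> carrier V" using g(1) keys_mapp_subset[of _ g] by (auto simp: V_def g'_def)
    have pow: "Poly_Mapping.lookup (v [^]\<^bsub>V\<^esub> m) k = of_nat m * Poly_Mapping.lookup v k" for v m k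
      by (induction m) (simp_all add: V_def lookup_add algebra_simps nat_pow_def)
    have "g' [^]\<^bsub>V\<^esub> n = g"
      by (rule poly_mapping_eqI) (use x in \<open>simp add: pow lg'\<close>)
    then have "\<pi> g' [^]\<^bsub>D\<^esub> n = x" using \<pi>.hom_nat_pow[OF g', of n] g by simp
    then show "\<exists>y\<in>carrier D. y [^]\<^bsub>D\<^esub> n = x" using \<pi>.hom_closed[OF g'] by blast
  qed (fact D)
  ultimately show ?thesis by blast
qed

section \<open>Coinduced modules and injective resolutions\<close>

lemma module_homD:
  assumes "\<eta> \<in> module_hom C \<Phi> \<Psi>" "c \<in> Obj C"
  shows "\<eta> c \<in> hom (Val \<Phi> c) (Val \<Psi> c)"
  using assms by (simp add: module_hom_def)

lemma module_hom_closed: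
  assumes "\<eta> \<in> module_hom C \<Phi> \<Psi>" "c \<in> Obj C" "x \<in> carrier (Val \<Phi> c)"
  shows "\<eta> c x \<in> carrier (Val \<Psi> c)"
  using hom_in_carrier[OF module_homD[OF assms(1,2)] assms(3)] .

lemma module_hom_natural:
  assumes "\<eta> \<in> module_hom C \<Phi> \<Psi>" "c \<in> Obj C" "d \<in> Obj C" "f \<in> Arr C c d" "x \<in> carrier (Val \<Phi> d)"
  shows "\<eta> c (Res \<Phi> c d f x) = Res \<Psi> c d f (\<eta> d x)"
  using assms by (simp add: module_hom_def)

lemma module_hom_group_hom:
  assumes "cat_module C \<Phi>" "cat_module C \<Psi>" "\<eta> \<in> module_hom C \<Phi> \<Psi>" "c \<in> Obj C"
  shows "group_hom (Val \<Phi> c) (Val \<Psi> c) (\<eta> c)"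
  by (rule group_hom_of_comm[OF cat_module.Val_comm_group[OF assms(1,4)]
        cat_module.Val_comm_group[OF assms(2,4)] module_homD[OF assms(3,4)]])

lemma module_homI:
  assumes "\<And>c. c \<in> Obj C \<Longrightarrow> \<eta> c \<in> hom (Val \<Phi> c) (Val \<Psi> c)"
    and "\<And>c d f x. c \<in> Obj C \<Longrightarrow> d \<in> Obj C \<Longrightarrow> f \<in> Arr C c d \<Longrightarrow> x \<in> carrier (Val \<Phi> d) \<Longrightarrow>
        \<eta> c (Res \<Phi> c d f x) = Res \<Psi> c d f (\<eta> d x)"
  shows "\<eta> \<in> module_hom C \<Phi> \<Psi>"
  using assms by (simp add: module_hom_def)

lemma Res_closed:
  assumes "cat_module C \<Phi>" "c \<in> Obj C" "d \<in> Obj C" "f \<in> Arr C c d" "x \<in> carrier (Val \<Phi> d)"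
  shows "Res \<Phi> c d f x \<in> carrier (Val \<Phi> c)"
  using hom_in_carrier[OF cat_module.Res_hom[OF assms(1-4)] assms(5)] .

lemma Res_group_hom:
  assumes "cat_module C \<Phi>" "c \<in> Obj C" "d \<in> Obj C" "f \<in> Arr C c d"
  shows "group_hom (Val \<Phi> d) (Val \<Phi> c) (Res \<Phi> c d f)"
  by (rule group_hom_of_comm[OF cat_module.Val_comm_group[OF assms(1,3)]
        cat_module.Val_comm_group[OF assms(1,2)] cat_module.Res_hom[OF assms]])

lemma module_hom_compose:
  assumes "\<eta> \<in> module_hom C \<Phi> \<Psi>" "\<theta> \<in> module_hom C \<Psi> \<Theta>"
  shows "(\<lambda>c x. \<theta> c (\<eta> c x)) \<in> module_hom C \<Phi> \<Theta>"
proof (rule module_homI)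
  fix c assume "c \<in> Obj C"
  then show "(\<lambda>x. \<theta> c (\<eta> c x)) \<in> hom (Val \<Phi> c) (Val \<Theta> c)"
    using hom_compose[OF module_homD[OF assms(1)] module_homD[OF assms(2)]] by (simp add: o_def)
qed (use assms in \<open>simp add: module_hom_natural module_hom_closed\<close>)

definition unFam :: "('i, 'm) univ \<Rightarrow> 'i \<Rightarrow> ('i, 'm) univ" where
  "unFam u = (case u of Fam h \<Rightarrow> h | _ \<Rightarrow> undefined)"

lemma unFam_Fam [simp]: "unFam (Fam h) = h"
  by (simp add: unFam_def)

definition arrows_to :: "('o, 'a) cat \<Rightarrow> 'o \<Rightarrow> ('o \<times> 'a) set" where
  "arrows_to C x = {(c, f). c \<in> Obj C \<and> f \<in> Arr C c x}"

lemma arrows_to_iff [simp]: "(c, f) \<in> arrows_to C x \<longleftrightarrow> c \<in> Obj C \<and> f \<in> Arr C c x"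
  by (simp add: arrows_to_def)

text \<open>The product over \<open>c\<close> of the right adjoints, applied to \<open>D c\<close>, of the evaluations at \<open>c\<close>.\<close>

definition coind ::
  "('o, 'a) cat \<Rightarrow> ('o \<Rightarrow> ('o \<times> 'a, 'm) univ monoid) \<Rightarrow> ('o, 'a, ('o \<times> 'a, 'm) univ) presheaf" where
  "coind C D = \<lparr>
     Val = (\<lambda>x. \<lparr>carrier = Fam ` (\<Pi>\<^sub>E i\<in>arrows_to C x. carrier (D (fst i))),
                 monoid.mult = (\<lambda>a b. Fam (\<lambda>i\<in>arrows_to C x. unFam a i \<otimes>\<^bsub>D (fst i)\<^esub> unFam b i)),
                 one = Fam (\<lambda>i\<in>arrows_to C x. \<one>\<^bsub>D (fst i)\<^esub>)\<rparr>),
     Res = (\<lambda>x y f a. Fam (\<lambda>i\<in>arrows_to C x. unFam a (fst i, Cmp C f (snd i))))\<rparr>"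

lemma coind_carrierI:
  assumes "\<And>c f. c \<in> Obj C \<Longrightarrow> f \<in> Arr C c x \<Longrightarrow> h (c, f) \<in> carrier (D c)"
  shows "Fam (\<lambda>i\<in>arrows_to C x. h i) \<in> carrier (Val (coind C D) x)"
  unfolding coind_def using assms by (auto intro!: imageI)

lemma coind_component:
  assumes "a \<in> carrier (Val (coind C D) x)" "c \<in> Obj C" "f \<in> Arr C c x"
  shows "unFam a (c, f) \<in> carrier (D c)"
proof -
  obtain h where h: "a = Fam h" "h \<in> (\<Pi>\<^sub>E i\<in>arrows_to C x. carrier (D (fst i)))"
    using assms(1) unfolding coind_def by auto
  show ?thesis using PiE_mem[OF h(2), of "(c, f)"] assms(2,3) h(1) by simp
qed

lemma coind_ext:
  assumes "a \<in> carrier (Val (coind C D) x)" "b \<in> carrier (Val (coind C D) x)"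
    and "\<And>c f. c \<in> Obj C \<Longrightarrow> f \<in> Arr C c x \<Longrightarrow> unFam a (c, f) = unFam b (c, f)"
  shows "a = b"
proof -
  obtain h k where "a = Fam h" "h \<in> (\<Pi>\<^sub>E i\<in>arrows_to C x. carrier (D (fst i)))"
    "b = Fam k" "k \<in> (\<Pi>\<^sub>E i\<in>arrows_to C x. carrier (D (fst i)))"
    using assms(1,2) unfolding coind_def by auto
  moreover have "h i = k i" if "i \<in> arrows_to C x" for i
    using assms(3)[of "fst i" "snd i"] that \<open>a = Fam h\<close> \<open>b = Fam k\<close> by (cases i) simp
  ultimately have "h = k" by (intro PiE_ext) auto
  then show ?thesis using \<open>a = Fam h\<close> \<open>b = Fam k\<close> by simp
qed

lemma coind_mult:
  "c \<in> Obj C \<Longrightarrow> f \<in> Arr C c x \<Longrightarrow>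
   unFam (a \<otimes>\<^bsub>Val (coind C D) x\<^esub> b) (c, f) = unFam a (c, f) \<otimes>\<^bsub>D c\<^esub> unFam b (c, f)"
  by (simp add: coind_def)

lemma coind_mult_eq:
  "a \<otimes>\<^bsub>Val (coind C D) x\<^esub> b = Fam (\<lambda>i\<in>arrows_to C x. unFam a i \<otimes>\<^bsub>D (fst i)\<^esub> unFam b i)"
  by (simp add: coind_def)

lemma coind_one:
  "c \<in> Obj C \<Longrightarrow> f \<in> Arr C c x \<Longrightarrow> unFam \<one>\<^bsub>Val (coind C D) x\<^esub> (c, f) = \<one>\<^bsub>D c\<^esub>"
  by (simp add: coind_def)

lemma coind_one_eq: "\<one>\<^bsub>Val (coind C D) x\<^esub> = Fam (\<lambda>i\<in>arrows_to C x. \<one>\<^bsub>D (fst i)\<^esub>)"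
  by (simp add: coind_def)

lemma coind_Res:
  "c \<in> Obj C \<Longrightarrow> g \<in> Arr C c x \<Longrightarrow> unFam (Res (coind C D) x y f a) (c, g) = unFam a (c, Cmp C f g)"
  by (simp add: coind_def)

lemma coind_Res_eq:
  "Res (coind C D) x y f a = Fam (\<lambda>i\<in>arrows_to C x. unFam a (fst i, Cmp C f (snd i)))"
  by (simp add: coind_def)

lemma coind_cat_module:
  assumes "small_category C" and D: "\<And>c. c \<in> Obj C \<Longrightarrow> comm_group (D c)"
  shows "cat_module C (coind C D)"
proof -
  interpret small_category C by fact
  let ?I = "coind C D"
  have mc: "a \<otimes>\<^bsub>Val ?I x\<^esub> b \<in> carrier (Val ?I x)"
    if "a \<in> carrier (Val ?I x)" "b \<in> carrier (Val ?I x)" for a b x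
    unfolding coind_mult_eq
    by (rule coind_carrierI) (use that D in \<open>simp add: coind_component comm_group.axioms monoid.m_closed comm_monoid.axioms\<close>)
  have oc: "\<one>\<^bsub>Val ?I x\<^esub> \<in> carrier (Val ?I x)" for x
    unfolding coind_one_eq
    by (rule coind_carrierI) (use D in \<open>simp add: comm_group.axioms monoid.one_closed comm_monoid.axioms\<close>)
  have rc: "Res ?I x y f a \<in> carrier (Val ?I x)"
    if "x \<in> Obj C" "y \<in> Obj C" "f \<in> Arr C x y" "a \<in> carrier (Val ?I y)" for x y f a
    unfolding coind_Res_eq
    by (rule coind_carrierI) (use that Cmp_in_Arr in \<open>simp add: coind_component\<close>)
  have Dg: "monoid (D c)" "comm_monoid (D c)" "group (D c)" if "c \<in> Obj C" for c
    using D[OF that] by (simp_all add: comm_group.axioms comm_monoid.axioms)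
  show ?thesis
  proof (rule cat_module.intro)
    fix x assume x: "x \<in> Obj C"
    show "comm_group (Val ?I x)"
    proof (rule comm_groupI)
      fix a b c assume abc: "a \<in> carrier (Val ?I x)" "b \<in> carrier (Val ?I x)" "c \<in> carrier (Val ?I x)"
      show "a \<otimes>\<^bsub>Val ?I x\<^esub> b \<otimes>\<^bsub>Val ?I x\<^esub> c = a \<otimes>\<^bsub>Val ?I x\<^esub> (b \<otimes>\<^bsub>Val ?I x\<^esub> c)"
        by (rule coind_ext[of _ C D x])
          (use abc mc in \<open>simp_all add: coind_mult monoid.m_assoc[OF Dg(1)] coind_component\<close>)
    next
      fix a b assume abc: "a \<in> carrier (Val ?I x)" "b \<in> carrier (Val ?I x)"
      show "a \<otimes>\<^bsub>Val ?I x\<^esub> b = b \<otimes>\<^bsub>Val ?I x\<^esub> a"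
        by (rule coind_ext[of _ C D x])
          (use abc mc comm_monoid.m_comm[OF Dg(2)] in \<open>simp_all add: coind_mult coind_component\<close>)
    next
      fix a assume a: "a \<in> carrier (Val ?I x)"
      show "\<one>\<^bsub>Val ?I x\<^esub> \<otimes>\<^bsub>Val ?I x\<^esub> a = a"
        by (rule coind_ext[of _ C D x])
          (use a mc oc in \<open>simp_all add: coind_mult coind_one monoid.l_one[OF Dg(1)] coind_component\<close>)
      let ?b = "Fam (\<lambda>i\<in>arrows_to C x. inv\<^bsub>D (fst i)\<^esub> unFam a i)"
      have b: "?b \<in> carrier (Val ?I x)"
        by (rule coind_carrierI) (use a in \<open>simp add: group.inv_closed[OF Dg(3)] coind_component\<close>)
      have "?b \<otimes>\<^bsub>Val ?I x\<^esub> a = \<one>\<^bsub>Val ?I x\<^esub>"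
        by (rule coind_ext[of _ C D x])
          (use a b mc oc in \<open>simp_all add: coind_mult coind_one group.l_inv[OF Dg(3)] coind_component\<close>)
      then show "\<exists>b\<in>carrier (Val ?I x). b \<otimes>\<^bsub>Val ?I x\<^esub> a = \<one>\<^bsub>Val ?I x\<^esub>" using b by blast
    qed (use mc oc in auto)
  next
    fix x y f assume xy: "x \<in> Obj C" "y \<in> Obj C" "f \<in> Arr C x y"
    show "Res ?I x y f \<in> hom (Val ?I y) (Val ?I x)"
    proof (rule homI)
      fix a b assume ab: "a \<in> carrier (Val ?I y)" "b \<in> carrier (Val ?I y)"
      show "Res ?I x y f (a \<otimes>\<^bsub>Val ?I y\<^esub> b) = Res ?I x y f a \<otimes>\<^bsub>Val ?I x\<^esub> Res ?I x y f b"
        by (rule coind_ext[of _ C D x])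
          (use xy ab mc rc Cmp_in_Arr in \<open>simp_all add: coind_mult coind_Res\<close>)
    qed (use rc xy in blast)
  next
    fix x a assume xa: "x \<in> Obj C" "a \<in> carrier (Val ?I x)"
    show "Res ?I x x (Idn C x) a = a"
      by (rule coind_ext[of _ C D x])
        (use xa rc Idn_in_Arr in \<open>simp_all add: coind_Res Cmp_Idn_left\<close>)
  next
    fix b c d f g x
    assume *: "b \<in> Obj C" "c \<in> Obj C" "d \<in> Obj C" "f \<in> Arr C b c" "g \<in> Arr C c d" "x \<in> carrier (Val ?I d)"
    have gf: "Cmp C g f \<in> Arr C b d" using * Cmp_in_Arr by blast
    show "Res ?I b d (Cmp C g f) x = Res ?I b c f (Res ?I c d g x)"
    proof (rule coind_ext[of _ C D b])
      fix a h assume ah: "a \<in> Obj C" "h \<in> Arr C a b"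
      then have "Cmp C f h \<in> Arr C a c" using * Cmp_in_Arr by blast
      then show "unFam (Res ?I b d (Cmp C g f) x) (a, h) = unFam (Res ?I b c f (Res ?I c d g x)) (a, h)"
        using ah * Cmp_assoc[of a b c d h f g] by (simp add: coind_Res)
    qed (use * rc gf in auto)
  qed
qed

text \<open>The transpose of the family \<open>j\<close> under the adjunction between evaluation at
  the objects and coinduction: the component at an arrow is \<open>j\<close> after restriction along
  that arrow.\<close>

definition coind_lift ::
  "('o, 'a) cat \<Rightarrow> ('o, 'a, 'y) presheaf \<Rightarrow> ('o \<Rightarrow> 'y \<Rightarrow> ('o \<times> 'a, 'm) univ)
   \<Rightarrow> 'o \<Rightarrow> 'y \<Rightarrow> ('o \<times> 'a, 'm) univ" where
  "coind_lift C \<Phi> j = (\<lambda>x b. Fam (\<lambda>i\<in>arrows_to C x. j (fst i) (Res \<Phi> (fst i) x (snd i) b)))"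

lemma coind_lift_hom:
  assumes "small_category C" and D: "\<And>c. c \<in> Obj C \<Longrightarrow> comm_group (D c)"
    and \<Phi>: "cat_module C \<Phi>" and j: "\<And>c. c \<in> Obj C \<Longrightarrow> j c \<in> hom (Val \<Phi> c) (D c)"
  shows "coind_lift C \<Phi> j \<in> module_hom C \<Phi> (coind C D)"
proof -
  interpret small_category C by fact
  interpret I: cat_module C "coind C D" using assms(1) D by (rule coind_cat_module)
  have cl: "coind_lift C \<Phi> j x a \<in> carrier (Val (coind C D) x)"
    if "x \<in> Obj C" "a \<in> carrier (Val \<Phi> x)" for x a
    unfolding coind_lift_def
    by (rule coind_carrierI) (use that in \<open>simp add: hom_in_carrier[OF j] Res_closed[OF \<Phi>]\<close>)
  show ?thesis
  proof (rule module_homI)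
    fix x assume x: "x \<in> Obj C"
    show "coind_lift C \<Phi> j x \<in> hom (Val \<Phi> x) (Val (coind C D) x)"
    proof (rule homI)
      fix a b assume ab: "a \<in> carrier (Val \<Phi> x)" "b \<in> carrier (Val \<Phi> x)"
      interpret \<Phi>x: comm_group "Val \<Phi> x" using \<Phi> x by (rule cat_module.Val_comm_group)
      interpret Ix: comm_group "Val (coind C D) x" using x by (rule I.Val_comm_group)
      show "coind_lift C \<Phi> j x (a \<otimes>\<^bsub>Val \<Phi> x\<^esub> b) =
          coind_lift C \<Phi> j x a \<otimes>\<^bsub>Val (coind C D) x\<^esub> coind_lift C \<Phi> j x b"
      proof (rule coind_ext[of _ C D x])
        fix c f assume cf: "c \<in> Obj C" "f \<in> Arr C c x"
        show "unFam (coind_lift C \<Phi> j x (a \<otimes>\<^bsub>Val \<Phi> x\<^esub> b)) (c, f) =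
          unFam (coind_lift C \<Phi> j x a \<otimes>\<^bsub>Val (coind C D) x\<^esub> coind_lift C \<Phi> j x b) (c, f)"
          using cf ab x Res_closed[OF \<Phi>] hom_mult[OF cat_module.Res_hom[OF \<Phi>]] hom_mult[OF j]
          by (simp add: coind_lift_def coind_mult)
      qed (use cl x ab in auto)
    qed (use cl x in auto)
  next
    fix x y f a assume *: "x \<in> Obj C" "y \<in> Obj C" "f \<in> Arr C x y" "a \<in> carrier (Val \<Phi> y)"
    show "coind_lift C \<Phi> j x (Res \<Phi> x y f a) = Res (coind C D) x y f (coind_lift C \<Phi> j y a)"
    proof (rule coind_ext[of _ C D x])
      fix c g assume cf: "c \<in> Obj C" "g \<in> Arr C c x"
      show "unFam (coind_lift C \<Phi> j x (Res \<Phi> x y f a)) (c, g) =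
          unFam (Res (coind C D) x y f (coind_lift C \<Phi> j y a)) (c, g)"
        using cf * cat_module.Res_Cmp[OF \<Phi>, of c x y g f a] Cmp_in_Arr[of c x y g f]
        by (simp add: coind_lift_def coind_Res)
    qed (use * cl Res_closed[OF \<Phi>] Res_closed[OF I.cat_module_axioms] in auto)
  qed
qed

text \<open>A morphism to a coinduced module is determined by its components at the identities. The
  extension problem thus splits into one problem of abelian groups for each object, which
  divisibility solves, and transposing the solutions takes care of naturality.\<close>

lemma coind_factor:
  assumes C: "small_category C" and D: "\<And>c. c \<in> Obj C \<Longrightarrow> divisible_group (D c)"
    and A: "cat_module C A" and B: "cat_module C B"
    and f: "f \<in> module_hom C A B" and \<alpha>: "\<alpha> \<in> module_hom C A (coind C D)"
    and ker: "\<And>c x. c \<in> Obj C \<Longrightarrow> x \<in> carrier (Val A c) \<Longrightarrow> f c x = \<one>\<^bsub>Val B c\<^esub>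
        \<Longrightarrow> \<alpha> c x = \<one>\<^bsub>Val (coind C D) c\<^esub>"
  shows "\<exists>\<beta>\<in>module_hom C B (coind C D). \<forall>c\<in>Obj C. \<forall>x\<in>carrier (Val A c). \<beta> c (f c x) = \<alpha> c x"
proof -
  interpret small_category C by fact
  have Dc: "\<And>c. c \<in> Obj C \<Longrightarrow> comm_group (D c)" using D by (simp add: divisible_group_def)
  interpret I: cat_module C "coind C D" using C Dc by (rule coind_cat_module)
  have "\<exists>j\<in>hom (Val B c) (D c). \<forall>x\<in>carrier (Val A c). j (f c x) = unFam (\<alpha> c x) (c, Idn C c)"
    if c: "c \<in> Obj C" for c
  proof (rule divisible_factor[OF cat_module.Val_comm_group[OF A c] cat_module.Val_comm_group[OF B c] D[OF c] module_homD[OF f c]])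
    show "(\<lambda>x. unFam (\<alpha> c x) (c, Idn C c)) \<in> hom (Val A c) (D c)"
    proof (rule homI)
      fix x y assume xy: "x \<in> carrier (Val A c)" "y \<in> carrier (Val A c)"
      then show "unFam (\<alpha> c (x \<otimes>\<^bsub>Val A c\<^esub> y)) (c, Idn C c) =
          unFam (\<alpha> c x) (c, Idn C c) \<otimes>\<^bsub>D c\<^esub> unFam (\<alpha> c y) (c, Idn C c)"
        using c Idn_in_Arr[OF c] hom_mult[OF module_homD[OF \<alpha> c]] by (simp add: coind_mult)
    qed (rule coind_component[OF module_hom_closed[OF \<alpha> c] c Idn_in_Arr[OF c]])
    show "unFam (\<alpha> c x) (c, Idn C c) = \<one>\<^bsub>D c\<^esub>" if "x \<in> carrier (Val A c)" "f c x = \<one>\<^bsub>Val B c\<^esub>" for x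
      using ker[OF c that] c Idn_in_Arr[OF c] by (simp add: coind_one)
  qed
  then obtain j where j: "\<And>c. c \<in> Obj C \<Longrightarrow> j c \<in> hom (Val B c) (D c)"
    and jf: "\<And>c x. c \<in> Obj C \<Longrightarrow> x \<in> carrier (Val A c) \<Longrightarrow> j c (f c x) = unFam (\<alpha> c x) (c, Idn C c)"
    by metis
  have \<beta>: "coind_lift C B j \<in> module_hom C B (coind C D)" using C Dc B j by (rule coind_lift_hom)
  moreover have "coind_lift C B j x (f x a) = \<alpha> x a" if x: "x \<in> Obj C" and a: "a \<in> carrier (Val A x)" for x a
  proof (rule coind_ext[of _ C D x])
    fix c g assume cg: "c \<in> Obj C" "g \<in> Arr C c x"
    have "unFam (coind_lift C B j x (f x a)) (c, g) = j c (f c (Res A c x g a))"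
      using cg x a module_hom_natural[OF f] by (simp add: coind_lift_def)
    \<comment> \<open>The other components of \<alpha> are recovered from those at identities by
      naturality.\<close>
    also have "\<dots> = unFam (\<alpha> c (Res A c x g a)) (c, Idn C c)"
      using jf cg x a Res_closed[OF A] by simp
    also have "\<dots> = unFam (\<alpha> x a) (c, g)"
      using cg x a Idn_in_Arr Cmp_Idn_right[of c x g] by (simp add: module_hom_natural[OF \<alpha>] coind_Res)
    finally show "unFam (coind_lift C B j x (f x a)) (c, g) = unFam (\<alpha> x a) (c, g)" .
  qed (rule module_hom_closed[OF \<beta> x module_hom_closed[OF f x a]] module_hom_closed[OF \<alpha> x a])+
  ultimately show ?thesis by (intro bexI[of _ "coind_lift C B j"]) simp_all
qed

text \<open>\<open>coind_factor\<close> applied to a monomorphism, for which the kernel condition is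
  automatic.\<close>

lemma coind_injective:
  assumes C: "small_category C" and D: "\<And>c. c \<in> Obj C \<Longrightarrow> divisible_group (D c)"
  shows "injective_module C (coind C D)"
  unfolding injective_module_def
proof (intro conjI allI impI; (elim conjE)?)
  show "cat_module C (coind C D)"
    using C D by (intro coind_cat_module) (auto simp: divisible_group_def)
  then interpret I: cat_module C "coind C D" .
  fix A B :: "('a, 'b, ('a \<times> 'b, 'c) univ) presheaf" and \<iota> \<alpha>
  assume A: "cat_module C A" and B: "cat_module C B" and \<iota>: "\<iota> \<in> module_mono C A B"
    and \<alpha>: "\<alpha> \<in> module_hom C A (coind C D)"
  have \<iota>h: "\<iota> \<in> module_hom C A B" using \<iota> by (simp add: module_mono_def)
  show "\<exists>\<beta>\<in>module_hom C B (coind C D). \<forall>c\<in>Obj C. \<forall>x\<in>carrier (Val A c). \<beta> c (\<iota> c x) = \<alpha> c x"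
  proof (rule coind_factor[OF C D A B \<iota>h \<alpha>])
    fix c x assume c: "c \<in> Obj C" and x: "x \<in> carrier (Val A c)" "\<iota> c x = \<one>\<^bsub>Val B c\<^esub>"
    interpret i: group_hom "Val A c" "Val B c" "\<iota> c" using A B \<iota>h c by (rule module_hom_group_hom)
    interpret a: group_hom "Val A c" "Val (coind C D) c" "\<alpha> c"
      using A I.cat_module_axioms \<alpha> c by (rule module_hom_group_hom)
    have "x = \<one>\<^bsub>Val A c\<^esub>" using \<iota> c x i.inj_on_one_iff by (auto simp: module_mono_def)
    then show "\<alpha> c x = \<one>\<^bsub>Val (coind C D) c\<^esub>" by simp
  qed
qed

text \<open>The component of the lift at an identity is the embedding of \<open>Val \<Phi> c\<close>
  in its hull, hence injective. The code \<open>e\<close> admits both a module with foreign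
  elements, coded by \<open>Elem\<close>, and one whose elements are codes already.\<close>

lemma enough_injectives:
  fixes \<Phi> :: "('o, 'a, 'y) presheaf" and e :: "'y \<Rightarrow> ('o \<times> 'a, 'm) univ"
  assumes C: "small_category C" and \<Phi>: "cat_module C \<Phi>"
    and e: "inj e"
  shows "\<exists>(D :: 'o \<Rightarrow> ('o \<times> 'a, 'm) univ monoid) \<eta>.
     (\<forall>c\<in>Obj C. divisible_group (D c)) \<and> \<eta> \<in> module_mono C \<Phi> (coind C D)"
proof -
  interpret small_category C by fact
  have "\<exists>(D :: ('o \<times> 'a, 'm) univ monoid) j. divisible_group D \<and> j \<in> hom (Val \<Phi> c) D \<and> inj_on j (carrier (Val \<Phi> c))"
    if "c \<in> Obj C" for c
    using divisible_hull[OF cat_module.Val_comm_group[OF \<Phi> that] inj_on_subset[OF e]] by blast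
  then obtain D :: "'o \<Rightarrow> ('o \<times> 'a, 'm) univ monoid" and j where
    D: "\<And>c. c \<in> Obj C \<Longrightarrow> divisible_group (D c)" and
    j: "\<And>c. c \<in> Obj C \<Longrightarrow> j c \<in> hom (Val \<Phi> c) (D c)" "\<And>c. c \<in> Obj C \<Longrightarrow> inj_on (j c) (carrier (Val \<Phi> c))"
    by metis
  have "coind_lift C \<Phi> j \<in> module_hom C \<Phi> (coind C D)"
    using C _ \<Phi> j(1) by (rule coind_lift_hom) (use D in \<open>simp add: divisible_group_def\<close>)
  moreover have "inj_on (coind_lift C \<Phi> j c) (carrier (Val \<Phi> c))" if c: "c \<in> Obj C" for c
  proof (rule inj_onI)
    fix a b assume ab: "a \<in> carrier (Val \<Phi> c)" "b \<in> carrier (Val \<Phi> c)"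
      and eq: "coind_lift C \<Phi> j c a = coind_lift C \<Phi> j c b"
    have "j c a = unFam (coind_lift C \<Phi> j c a) (c, Idn C c)" if "a \<in> carrier (Val \<Phi> c)" for a
      using that c Idn_in_Arr[OF c] cat_module.Res_Idn[OF \<Phi> c that] by (simp add: coind_lift_def)
    then have "j c a = j c b" using ab eq by metis
    then show "a = b" using j(2)[OF c] ab by (auto dest: inj_onD)
  qed
  ultimately show ?thesis using D by (auto simp: module_mono_def)
qed

section \<open>Cokernels and resolutions by coinduced modules\<close>

lemma (in group_hom) eq_iff_diff:
  assumes "x \<in> carrier G" "y \<in> carrier G"
  shows "h x = h y \<longleftrightarrow> h (x \<otimes> inv y) = \<one>\<^bsub>H\<^esub>"
proof
  assume "h x = h y" then show "h (x \<otimes> inv y) = \<one>\<^bsub>H\<^esub>" using assms by simp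
next
  assume "h (x \<otimes> inv y) = \<one>\<^bsub>H\<^esub>"
  then have "h x \<otimes>\<^bsub>H\<^esub> inv\<^bsub>H\<^esub> h y = \<one>\<^bsub>H\<^esub>" using assms by simp
  then show "h x = h y" using H.inv_equality[of "h x" "inv\<^bsub>H\<^esub> h y"] assms by simp
qed

text \<open>The cokernel is formed objectwise, and its restriction maps are defined through chosen
  representatives, so that its elements stay in the type \<open>'x\<close>.\<close>

lemma quotient_module:
  fixes B :: "('o, 'a, 'x) presheaf"
  assumes C: "small_category C" and A: "cat_module C A" and B: "cat_module C B"
    and f: "f \<in> module_hom C A B"
  shows "\<exists>(Q :: ('o, 'a, 'x) presheaf) \<pi>. cat_module C Q \<and> \<pi> \<in> module_hom C B Q \<and>
     (\<forall>c\<in>Obj C. \<pi> c ` carrier (Val B c) = carrier (Val Q c)) \<and>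
     (\<forall>c\<in>Obj C. \<forall>x\<in>carrier (Val B c). \<pi> c x = \<one>\<^bsub>Val Q c\<^esub> \<longleftrightarrow> x \<in> f c ` carrier (Val A c))"
proof -
  interpret small_category C by fact
  have "\<exists>(Q :: 'x monoid) \<pi>. comm_group Q \<and> \<pi> \<in> hom (Val B c) Q \<and> \<pi> ` carrier (Val B c) = carrier Q \<and>
     (\<forall>x\<in>carrier (Val B c). \<pi> x = \<one>\<^bsub>Q\<^esub> \<longleftrightarrow> x \<in> f c ` carrier (Val A c))" if c: "c \<in> Obj C" for c
    using quotient_code[OF cat_module.Val_comm_group[OF B c]
        group_hom.img_is_subgroup[OF module_hom_group_hom[OF A B f c]] inj_on_id] .
  then obtain Q :: "'o \<Rightarrow> 'x monoid" and \<pi> where Q: "\<And>c. c \<in> Obj C \<Longrightarrow> comm_group (Q c)"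
    and \<pi>: "\<And>c. c \<in> Obj C \<Longrightarrow> \<pi> c \<in> hom (Val B c) (Q c)"
    and \<pi>s: "\<And>c. c \<in> Obj C \<Longrightarrow> \<pi> c ` carrier (Val B c) = carrier (Q c)"
    and \<pi>k: "\<And>c x. c \<in> Obj C \<Longrightarrow> x \<in> carrier (Val B c) \<Longrightarrow> \<pi> c x = \<one>\<^bsub>Q c\<^esub> \<longleftrightarrow> x \<in> f c ` carrier (Val A c)"
    by metis
  have \<pi>g: "group_hom (Val B c) (Q c) (\<pi> c)" if "c \<in> Obj C" for c
    using cat_module.Val_comm_group[OF B that] Q[OF that] \<pi>[OF that] by (rule group_hom_of_comm)
  define r where "r = (\<lambda>d q. SOME b. b \<in> carrier (Val B d) \<and> \<pi> d b = q)"
  have r: "r d q \<in> carrier (Val B d)" "\<pi> d (r d q) = q" if "d \<in> Obj C" "q \<in> carrier (Q d)" for d q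
  proof -
    have "\<exists>b. b \<in> carrier (Val B d) \<and> \<pi> d b = q" using \<pi>s[OF that(1)] that(2) by (metis imageE)
    from someI_ex[OF this] show "r d q \<in> carrier (Val B d)" "\<pi> d (r d q) = q" unfolding r_def by auto
  qed
  define QQ where "QQ = \<lparr>Val = Q, Res = (\<lambda>c d g q. \<pi> c (Res B c d g (r d q)))\<rparr>"
  \<comment> \<open>Independence of the representative: two of them differ by an element of the
    image of \<open>f d\<close>, which restriction carries into the image of \<open>f c\<close> by
    naturality.\<close>
  have RQ: "Res QQ c d g (\<pi> d x) = \<pi> c (Res B c d g x)"
    if cdg: "c \<in> Obj C" "d \<in> Obj C" "g \<in> Arr C c d" "x \<in> carrier (Val B d)" for c d g x
  proof -
    interpret \<pi>c: group_hom "Val B c" "Q c" "\<pi> c" using \<pi>g cdg by blast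
    interpret \<pi>d: group_hom "Val B d" "Q d" "\<pi> d" using \<pi>g cdg by blast
    interpret R: group_hom "Val B d" "Val B c" "Res B c d g" using Res_group_hom[OF B] cdg by blast
    define y where "y = r d (\<pi> d x)"
    have y: "y \<in> carrier (Val B d)" "\<pi> d y = \<pi> d x" using r cdg by (auto simp: y_def)
    then have "\<pi> d (y \<otimes>\<^bsub>Val B d\<^esub> inv\<^bsub>Val B d\<^esub> x) = \<one>\<^bsub>Q d\<^esub>" using cdg(4) by simp
    then have "y \<otimes>\<^bsub>Val B d\<^esub> inv\<^bsub>Val B d\<^esub> x \<in> f d ` carrier (Val A d)"
      using \<pi>k[OF cdg(2), of "y \<otimes>\<^bsub>Val B d\<^esub> inv\<^bsub>Val B d\<^esub> x"] y cdg \<pi>d.G.m_closed \<pi>d.G.inv_closed by simp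
    then obtain a where a: "a \<in> carrier (Val A d)" "y \<otimes>\<^bsub>Val B d\<^esub> inv\<^bsub>Val B d\<^esub> x = f d a"
      by blast
    have "Res B c d g (y \<otimes>\<^bsub>Val B d\<^esub> inv\<^bsub>Val B d\<^esub> x) \<in> f c ` carrier (Val A c)"
      unfolding a(2) using module_hom_natural[OF f cdg(1-3) a(1), symmetric] Res_closed[OF A cdg(1-3) a(1)] by auto
    then have "\<pi> c (Res B c d g (y \<otimes>\<^bsub>Val B d\<^esub> inv\<^bsub>Val B d\<^esub> x)) = \<one>\<^bsub>Q c\<^esub>"
      by (rule iffD2[OF \<pi>k[OF cdg(1) R.hom_closed], rotated]) (use y cdg(4) in simp)
    then have "\<pi> c (Res B c d g y \<otimes>\<^bsub>Val B c\<^esub> inv\<^bsub>Val B c\<^esub> Res B c d g x) = \<one>\<^bsub>Q c\<^esub>"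
      using y cdg(4) by simp
    then show ?thesis
      using \<pi>c.eq_iff_diff[of "Res B c d g y" "Res B c d g x"] y cdg(4) by (simp add: QQ_def y_def)
  qed
  have img: "\<exists>x\<in>carrier (Val B c). q = \<pi> c x" if "c \<in> Obj C" "q \<in> carrier (Q c)" for c q
    using \<pi>s that by blast
  have "cat_module C QQ"
  proof (rule cat_module.intro)
    show "comm_group (Val QQ c)" if "c \<in> Obj C" for c using Q that by (simp add: QQ_def)
  next
    fix c d g assume *: "c \<in> Obj C" "d \<in> Obj C" "g \<in> Arr C c d"
    interpret \<pi>c: group_hom "Val B c" "Q c" "\<pi> c" using \<pi>g * by blast
    interpret \<pi>d: group_hom "Val B d" "Q d" "\<pi> d" using \<pi>g * by blast
    interpret R: group_hom "Val B d" "Val B c" "Res B c d g" using Res_group_hom[OF B] * by blast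
    show "Res QQ c d g \<in> hom (Val QQ d) (Val QQ c)"
    proof (rule homI)
      fix p q assume "p \<in> carrier (Val QQ d)" "q \<in> carrier (Val QQ d)"
      then obtain x y where xy: "x \<in> carrier (Val B d)" "p = \<pi> d x" "y \<in> carrier (Val B d)" "q = \<pi> d y"
        using img[OF *(2)] unfolding QQ_def by (metis presheaf.select_convs(1))
      have "Res QQ c d g (\<pi> d (x \<otimes>\<^bsub>Val B d\<^esub> y)) = Res QQ c d g p \<otimes>\<^bsub>Q c\<^esub> Res QQ c d g q"
        using xy by (simp add: RQ[OF *] del: \<pi>d.hom_mult)
      then show "Res QQ c d g (p \<otimes>\<^bsub>Val QQ d\<^esub> q) = Res QQ c d g p \<otimes>\<^bsub>Val QQ c\<^esub> Res QQ c d g q"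
        using xy by (simp add: QQ_def)
    next
      fix q assume "q \<in> carrier (Val QQ d)"
      then show "Res QQ c d g q \<in> carrier (Val QQ c)" using r[OF *(2)] by (simp add: QQ_def)
    qed
  next
    fix c q assume c: "c \<in> Obj C" "q \<in> carrier (Val QQ c)"
    then obtain x where "x \<in> carrier (Val B c)" "q = \<pi> c x" using img[of c q] by (auto simp: QQ_def)
    then show "Res QQ c c (Idn C c) q = q"
      using RQ[OF c(1) c(1) Idn_in_Arr[OF c(1)]] cat_module.Res_Idn[OF B c(1)] by simp
  next
    fix b c d g h q assume *: "b \<in> Obj C" "c \<in> Obj C" "d \<in> Obj C" "g \<in> Arr C b c" "h \<in> Arr C c d" "q \<in> carrier (Val QQ d)"
    then obtain x where x: "x \<in> carrier (Val B d)" "q = \<pi> d x" using img[of d q] by (auto simp: QQ_def)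
    show "Res QQ b d (Cmp C h g) q = Res QQ b c g (Res QQ c d h q)"
      using x * by (simp add: RQ Cmp_in_Arr[of b c d] Res_closed[OF B] cat_module.Res_Cmp[OF B, of b c d])
  qed
  moreover have "\<pi> \<in> module_hom C B QQ"
    by (rule module_homI) (use \<pi> in \<open>simp_all add: QQ_def RQ[unfolded QQ_def, simplified]\<close>)
  ultimately show ?thesis using \<pi>s \<pi>k by (intro exI[of _ QQ] exI[of _ \<pi>]) (simp add: QQ_def)
qed

text \<open>The usual splicing: embed, pass to the cokernel, embed again. \<open>\<delta> n\<close>
  is the quotient map of stage \<open>n\<close> followed by the embedding of that cokernel at the
  next stage.\<close>

lemma coind_resolution_exists:
  fixes \<Phi> :: "('o, 'a, 'm) presheaf"
  assumes C: "small_category C" and \<Phi>: "cat_module C \<Phi>"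
  shows "\<exists>\<epsilon> (D :: nat \<Rightarrow> 'o \<Rightarrow> ('o \<times> 'a, 'm) univ monoid) \<delta>.
     (\<forall>n. \<forall>c\<in>Obj C. divisible_group (D n c)) \<and>
     injective_resolution C \<Phi> \<epsilon> (\<lambda>n. coind C (D n)) \<delta>"
proof -
  interpret small_category C by fact
  \<comment> \<open>A stage consists of the groups \<open>D\<close>, the cokernel \<open>Q\<close>,
    its quotient map \<pi> and the embedding \<eta> of the previous cokernel, here
    \<open>F\<close>.\<close>
  define step where "step = (\<lambda>(F :: ('o, 'a, ('o \<times> 'a, 'm) univ) presheaf)
    (D :: 'o \<Rightarrow> ('o \<times> 'a, 'm) univ monoid, Q :: ('o, 'a, ('o \<times> 'a, 'm) univ) presheaf,
       \<pi> :: 'o \<Rightarrow> ('o \<times> 'a, 'm) univ \<Rightarrow> ('o \<times> 'a, 'm) univ, \<eta>). \<eta> \<in> module_mono C F (coind C D) \<and>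
       (\<forall>c\<in>Obj C. \<forall>x\<in>carrier (Val (coind C D) c). \<pi> c x = \<one>\<^bsub>Val Q c\<^esub> \<longleftrightarrow> x \<in> \<eta> c ` carrier (Val F c)))"
  define good where "good = (\<lambda>(D :: 'o \<Rightarrow> ('o \<times> 'a, 'm) univ monoid,
       Q :: ('o, 'a, ('o \<times> 'a, 'm) univ) presheaf, \<pi>, \<eta> :: 'o \<Rightarrow> ('o \<times> 'a, 'm) univ \<Rightarrow> ('o \<times> 'a, 'm) univ).
       (\<forall>c\<in>Obj C. divisible_group (D c)) \<and> cat_module C Q \<and>
       \<pi> \<in> module_hom C (coind C D) Q \<and> (\<forall>c\<in>Obj C. \<pi> c ` carrier (Val (coind C D) c) = carrier (Val Q c)))"
  have cm: "cat_module C (coind C D)" if "\<forall>c\<in>Obj C. divisible_group (D c)"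
    for D :: "'o \<Rightarrow> ('o \<times> 'a, 'm) univ monoid"
    using C that by (intro coind_cat_module) (auto simp: divisible_group_def)
  have ex: "\<exists>s. good s \<and> step F s" if F: "cat_module C F" for F
  proof -
    obtain D :: "'o \<Rightarrow> ('o \<times> 'a, 'm) univ monoid" and \<eta> where D: "\<forall>c\<in>Obj C. divisible_group (D c)"
      and \<eta>: "\<eta> \<in> module_mono C F (coind C D)"
      using enough_injectives[OF C F inj_on_id] by blast
    have \<eta>h: "\<eta> \<in> module_hom C F (coind C D)" using \<eta> by (simp add: module_mono_def)
    show ?thesis
      using quotient_module[OF C F cm[OF D] \<eta>h] D \<eta> unfolding good_def step_def by fastforce
  qed
  obtain D0 :: "'o \<Rightarrow> ('o \<times> 'a, 'm) univ monoid" and \<epsilon> where D0: "\<forall>c\<in>Obj C. divisible_group (D0 c)"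
    and \<epsilon>: "\<epsilon> \<in> module_mono C \<Phi> (coind C D0)"
    using enough_injectives[OF C \<Phi>, of Elem] by (metis injI univ.inject(1))
  have \<epsilon>h: "\<epsilon> \<in> module_hom C \<Phi> (coind C D0)" using \<epsilon> by (simp add: module_mono_def)
  obtain Q0 :: "('o, 'a, ('o \<times> 'a, 'm) univ) presheaf" and \<pi>0 where Q0: "cat_module C Q0" "\<pi>0 \<in> module_hom C (coind C D0) Q0"
     "\<forall>c\<in>Obj C. \<pi>0 c ` carrier (Val (coind C D0) c) = carrier (Val Q0 c)"
     "\<forall>c\<in>Obj C. \<forall>x\<in>carrier (Val (coind C D0) c). \<pi>0 c x = \<one>\<^bsub>Val Q0 c\<^esub> \<longleftrightarrow> x \<in> \<epsilon> c ` carrier (Val \<Phi> c)"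
    using quotient_module[OF C \<Phi> cm[OF D0] \<epsilon>h] by blast
  \<comment> \<open>Stage 0 is prescribed: \<Phi> has elements of another type, so its embedding
    \<epsilon> cannot be stored as \<eta>, whose place holds a dummy there.\<close>
  have "\<exists>s :: nat \<Rightarrow> _. \<forall>n. (good (s n) \<and> (n = 0 \<longrightarrow> s n = (D0, Q0, \<pi>0, \<lambda>_ _. undefined))) \<and>
      step (fst (snd (s n))) (s (Suc n))"
  proof (rule dependent_nat_choice[where P = "\<lambda>n s. good s \<and> (n = 0 \<longrightarrow> s = (D0, Q0, \<pi>0, \<lambda>_ _. undefined))"
        and Q = "\<lambda>n s t. step (fst (snd s)) t"])
    show "\<exists>s. good s \<and> ((0::nat) = 0 \<longrightarrow> s = (D0, Q0, \<pi>0, \<lambda>_ _. undefined))"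
      using D0 Q0 by (auto simp: good_def)
    fix s and n :: nat assume s: "good s \<and> (n = 0 \<longrightarrow> s = (D0, Q0, \<pi>0, \<lambda>_ _. undefined))"
    then have "cat_module C (fst (snd s))" by (auto simp: good_def split: prod.splits)
    from ex[OF this] show "\<exists>t. (good t \<and> (Suc n = 0 \<longrightarrow> t = (D0, Q0, \<pi>0, \<lambda>_ _. undefined))) \<and> step (fst (snd s)) t"
      by auto
  qed
  then obtain s where s: "\<And>n. good (s n)" "s 0 = (D0, Q0, \<pi>0, \<lambda>_ _. undefined)"
    "\<And>n. step (fst (snd (s n))) (s (Suc n))" by metis
  define D where "D n = fst (s n)" for n
  define Q where "Q n = fst (snd (s n))" for n
  define \<pi> where "\<pi> n = fst (snd (snd (s n)))" for n
  define \<eta> where "\<eta> n = snd (snd (snd (s n)))" for n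
  note defs = D_def Q_def \<pi>_def \<eta>_def
  have D: "\<forall>c\<in>Obj C. divisible_group (D n c)" and Q: "cat_module C (Q n)"
    and \<pi>: "\<pi> n \<in> module_hom C (coind C (D n)) (Q n)"
    and \<pi>s: "\<And>c. c \<in> Obj C \<Longrightarrow> \<pi> n c ` carrier (Val (coind C (D n)) c) = carrier (Val (Q n) c)" for n
    using s(1)[of n] by (auto simp: good_def defs split: prod.splits)
  have \<eta>: "\<eta> (Suc n) \<in> module_mono C (Q n) (coind C (D (Suc n)))"
    and \<pi>k: "\<And>c x. c \<in> Obj C \<Longrightarrow> x \<in> carrier (Val (coind C (D (Suc n))) c) \<Longrightarrow>
        \<pi> (Suc n) c x = \<one>\<^bsub>Val (Q (Suc n)) c\<^esub> \<longleftrightarrow> x \<in> \<eta> (Suc n) c ` carrier (Val (Q n) c)" for n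
    using s(3)[of n] by (auto simp: step_def defs split: prod.splits)
  have \<eta>h: "\<eta> (Suc n) \<in> module_hom C (Q n) (coind C (D (Suc n)))" for n
    using \<eta> by (simp add: module_mono_def)
  have zero: "D 0 = D0" "Q 0 = Q0" "\<pi> 0 = \<pi>0" using s(2) by (simp_all add: defs)
  define \<delta> where "\<delta> = (\<lambda>n c x. \<eta> (Suc n) c (\<pi> n c x))"
  let ?I = "\<lambda>n. coind C (D n)"
  have \<delta>: "\<delta> n \<in> module_hom C (?I n) (?I (Suc n))" for n
    unfolding \<delta>_def using \<pi> \<eta>h by (rule module_hom_compose)
  have \<delta>1: "\<delta> n c x = \<one>\<^bsub>Val (?I (Suc n)) c\<^esub> \<longleftrightarrow> \<pi> n c x = \<one>\<^bsub>Val (Q n) c\<^esub>"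
    if c: "c \<in> Obj C" and x: "x \<in> carrier (Val (?I n) c)" for n c x
  proof -
    interpret e: group_hom "Val (Q n) c" "Val (?I (Suc n)) c" "\<eta> (Suc n) c"
      using Q cm[OF D] \<eta>h c by (rule module_hom_group_hom)
    have "inj_on (\<eta> (Suc n) c) (carrier (Val (Q n) c))" using \<eta> c by (simp add: module_mono_def)
    then show ?thesis using module_hom_closed[OF \<pi> c x] e.inj_on_one_iff e.hom_one unfolding \<delta>_def by metis
  qed
  have \<delta>img: "\<delta> n c ` carrier (Val (?I n) c) = \<eta> (Suc n) c ` carrier (Val (Q n) c)" if "c \<in> Obj C" for n c
    using \<pi>s[OF that, of n] unfolding \<delta>_def by (metis image_image)
  have "injective_resolution C \<Phi> \<epsilon> ?I \<delta>"
    unfolding injective_resolution_def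
  proof (intro conjI allI ballI)
    show "injective_module C (?I n)" for n using C D by (intro coind_injective) auto
    show "\<epsilon> \<in> module_mono C \<Phi> (?I 0)" using \<epsilon> zero by simp
    show "\<delta> n \<in> module_hom C (?I n) (?I (Suc n))" for n by (rule \<delta>)
    show "\<epsilon> c ` carrier (Val \<Phi> c) = kernel (Val (?I 0) c) (Val (?I 1) c) (\<delta> 0 c)" if c: "c \<in> Obj C" for c
      using Q0(4) c module_hom_closed[OF \<epsilon>h c] \<delta>1[OF c, of _ 0] zero by (auto simp: kernel_def)
    show "\<delta> n c ` carrier (Val (?I n) c) = kernel (Val (?I (Suc n)) c) (Val (?I (Suc (Suc n))) c) (\<delta> (Suc n) c)"
      if c: "c \<in> Obj C" for n c
      using \<delta>img[OF c] \<pi>k[OF c] \<delta>1[OF c, of _ "Suc n"] module_hom_closed[OF \<eta>h c] by (auto simp: kernel_def)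
  qed
  then show ?thesis using D by blast
qed

section \<open>Comparison of injective resolutions\<close>

lemma injective_cat_module: "injective_module C I \<Longrightarrow> cat_module C I"
  by (simp add: injective_module_def)

lemma comm_group_subgroup:
  assumes "comm_group G" "subgroup H G" shows "comm_group (G\<lparr>carrier := H\<rparr>)"
proof -
  interpret comm_group G by fact
  show ?thesis
    by (rule group.group_comm_groupI[OF subgroup_imp_group[OF assms(2)]])
       (use subgroup.mem_carrier[OF assms(2)] m_comm in simp)
qed

lemma submodule:
  assumes B: "cat_module C B"
    and N: "\<And>c. c \<in> Obj C \<Longrightarrow> subgroup (N c) (Val B c)"
    and R: "\<And>c d f x. c \<in> Obj C \<Longrightarrow> d \<in> Obj C \<Longrightarrow> f \<in> Arr C c d \<Longrightarrow> x \<in> N d \<Longrightarrow> Res B c d f x \<in> N c"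
  shows "cat_module C \<lparr>Val = (\<lambda>c. (Val B c)\<lparr>carrier := N c\<rparr>), Res = Res B\<rparr>"
proof -
  have NB: "x \<in> carrier (Val B c)" if "x \<in> N c" "c \<in> Obj C" for x c
    using subgroup.mem_carrier[OF N] that by blast
  show ?thesis
  proof (rule cat_module.intro; simp)
    show "comm_group ((Val B c)\<lparr>carrier := N c\<rparr>)" if "c \<in> Obj C" for c
      using comm_group_subgroup[OF cat_module.Val_comm_group[OF B that] N[OF that]] .
    show "Res B c d f \<in> hom ((Val B d)\<lparr>carrier := N d\<rparr>) ((Val B c)\<lparr>carrier := N c\<rparr>)"
      if "c \<in> Obj C" "d \<in> Obj C" "f \<in> Arr C c d" for c d f
      by (rule homI) (use that R NB hom_mult[OF cat_module.Res_hom[OF B that]] in auto)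
  qed (use NB cat_module.Res_Idn[OF B] cat_module.Res_Cmp[OF B] in auto)
qed

text \<open>Injectivity speaks of monomorphisms between modules with elements in \<open>'x\<close>.
  Here \<open>A\<close> may have elements of another type and \<open>f\<close> may have a kernel, so
  \<open>A\<close> is replaced by its image in \<open>B\<close>, on which \<alpha> is still well
  defined.\<close>

lemma injective_extend:
  fixes I B :: "('o, 'a, 'x) presheaf" and A :: "('o, 'a, 'y) presheaf"
  assumes I: "injective_module C I" and A: "cat_module C A" and B: "cat_module C B"
    and f: "f \<in> module_hom C A B" and \<alpha>: "\<alpha> \<in> module_hom C A I"
    and ker: "\<And>c x. c \<in> Obj C \<Longrightarrow> x \<in> carrier (Val A c) \<Longrightarrow> f c x = \<one>\<^bsub>Val B c\<^esub> \<Longrightarrow> \<alpha> c x = \<one>\<^bsub>Val I c\<^esub>"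
  shows "\<exists>\<beta>\<in>module_hom C B I. \<forall>c\<in>Obj C. \<forall>x\<in>carrier (Val A c). \<beta> c (f c x) = \<alpha> c x"
proof -
  have Ic: "cat_module C I" using I by (rule injective_cat_module)
  let ?N = "\<lambda>c. f c ` carrier (Val A c)"
  define A' where "A' = \<lparr>Val = (\<lambda>c. (Val B c)\<lparr>carrier := ?N c\<rparr>), Res = Res B\<rparr>"
  have A': "cat_module C A'"
    unfolding A'_def
  proof (rule submodule[OF B])
    show "subgroup (?N c) (Val B c)" if "c \<in> Obj C" for c
      using group_hom.img_is_subgroup[OF module_hom_group_hom[OF A B f that]] .
    show "Res B c d g x \<in> ?N c" if cd: "c \<in> Obj C" "d \<in> Obj C" "g \<in> Arr C c d" "x \<in> ?N d" for c d g x
    proof -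
      obtain a where a: "a \<in> carrier (Val A d)" "x = f d a" using cd(4) by blast
      show ?thesis
        unfolding a(2) module_hom_natural[OF f cd(1-3) a(1), symmetric]
        by (rule imageI) (rule Res_closed[OF A cd(1-3) a(1)])
    qed
  qed
  have \<iota>: "(\<lambda>c x. x) \<in> module_mono C A' B"
    using module_hom_closed[OF f] by (auto simp: module_mono_def module_hom_def A'_def hom_def)
  have "\<exists>\<phi>\<in>hom (Val A' c) (Val I c). \<forall>x\<in>carrier (Val A c). \<phi> (f c x) = \<alpha> c x" if c: "c \<in> Obj C" for c
    unfolding A'_def
    using factor_through_image[OF cat_module.Val_comm_group[OF A c] cat_module.Val_comm_group[OF B c]
        cat_module.Val_comm_group[OF Ic c] module_homD[OF f c] module_homD[OF \<alpha> c] ker[OF c]] by simp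
  then obtain \<phi> where \<phi>: "\<And>c. c \<in> Obj C \<Longrightarrow> \<phi> c \<in> hom (Val A' c) (Val I c)"
    and \<phi>f: "\<And>c x. c \<in> Obj C \<Longrightarrow> x \<in> carrier (Val A c) \<Longrightarrow> \<phi> c (f c x) = \<alpha> c x" by metis
  have "\<phi> \<in> module_hom C A' I"
  proof (rule module_homI)
    fix c d g x assume cd: "c \<in> Obj C" "d \<in> Obj C" "g \<in> Arr C c d" "x \<in> carrier (Val A' d)"
    then obtain a where a: "a \<in> carrier (Val A d)" "x = f d a" by (auto simp: A'_def)
    have "Res A' c d g x = f c (Res A c d g a)"
      using module_hom_natural[OF f cd(1-3) a(1)] a by (simp add: A'_def)
    then show "\<phi> c (Res A' c d g x) = Res I c d g (\<phi> d x)"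
      using \<phi>f[OF cd(1) Res_closed[OF A cd(1-3) a(1)]] module_hom_natural[OF \<alpha> cd(1-3) a(1)] \<phi>f[OF cd(2) a(1)] a by simp
  qed (fact \<phi>)
  then obtain \<beta> where \<beta>: "\<beta> \<in> module_hom C B I"
    and \<beta>\<phi>: "\<forall>c\<in>Obj C. \<forall>x\<in>carrier (Val A' c). \<beta> c x = \<phi> c x"
    using I A' B \<iota> unfolding injective_module_def by blast
  show ?thesis
    by (rule bexI[OF _ \<beta>]) (use \<beta>\<phi> \<phi>f in \<open>auto simp: A'_def\<close>)
qed

lemma module_hom_diff:
  assumes A: "cat_module C A" and B: "cat_module C B"
    and f: "f \<in> module_hom C A B" and g: "g \<in> module_hom C A B"
  shows "(\<lambda>c x. f c x \<otimes>\<^bsub>Val B c\<^esub> inv\<^bsub>Val B c\<^esub> g c x) \<in> module_hom C A B"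
proof (rule module_homI)
  fix c assume c: "c \<in> Obj C"
  interpret Bc: comm_group "Val B c" using cat_module.Val_comm_group[OF B c] .
  interpret f: group_hom "Val A c" "Val B c" "f c" using module_hom_group_hom[OF A B f c] .
  interpret g: group_hom "Val A c" "Val B c" "g c" using module_hom_group_hom[OF A B g c] .
  show "(\<lambda>x. f c x \<otimes>\<^bsub>Val B c\<^esub> inv\<^bsub>Val B c\<^esub> g c x) \<in> hom (Val A c) (Val B c)"
    by (rule homI) (auto simp: Bc.inv_mult Bc.m_ac)
next
  fix c d k x assume cd: "c \<in> Obj C" "d \<in> Obj C" "k \<in> Arr C c d" "x \<in> carrier (Val A d)"
  interpret R: group_hom "Val B d" "Val B c" "Res B c d k" using Res_group_hom[OF B cd(1-3)] .
  show "f c (Res A c d k x) \<otimes>\<^bsub>Val B c\<^esub> inv\<^bsub>Val B c\<^esub> g c (Res A c d k x) =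
      Res B c d k (f d x \<otimes>\<^bsub>Val B d\<^esub> inv\<^bsub>Val B d\<^esub> g d x)"
    using module_hom_natural[OF f cd] module_hom_natural[OF g cd]
      module_hom_closed[OF f cd(2,4)] module_hom_closed[OF g cd(2,4)] by simp
qed

section \<open>Chain maps and homotopies\<close>

locale resolution =
  fixes C :: "('o, 'a) cat" and \<Phi> :: "('o, 'a, 'y) presheaf"
    and \<epsilon> and I :: "nat \<Rightarrow> ('o, 'a, 'x) presheaf" and \<delta>
  assumes mod: "cat_module C \<Phi>" and res: "injective_resolution C \<Phi> \<epsilon> I \<delta>"
begin

lemma injective: "injective_module C (I n)"
  and \<epsilon>_hom: "\<epsilon> \<in> module_hom C \<Phi> (I 0)"
  and \<epsilon>_inj: "c \<in> Obj C \<Longrightarrow> inj_on (\<epsilon> c) (carrier (Val \<Phi> c))"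
  and \<delta>_hom: "\<delta> n \<in> module_hom C (I n) (I (Suc n))"
  using res by (auto simp: injective_resolution_def module_mono_def)

lemma modI: "cat_module C (I n)"
  using injective by (rule injective_cat_module)

lemma exact0: "c \<in> Obj C \<Longrightarrow> \<epsilon> c ` carrier (Val \<Phi> c) = kernel (Val (I 0) c) (Val (I 1) c) (\<delta> 0 c)"
  and exactS: "c \<in> Obj C \<Longrightarrow> \<delta> n c ` carrier (Val (I n) c) =
        kernel (Val (I (Suc n)) c) (Val (I (Suc (Suc n))) c) (\<delta> (Suc n) c)"
  using res by (auto simp: injective_resolution_def)

lemma ker0: "\<lbrakk>c \<in> Obj C; x \<in> carrier (Val (I 0) c); \<delta> 0 c x = \<one>\<^bsub>Val (I (Suc 0)) c\<^esub>\<rbrakk>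
    \<Longrightarrow> \<exists>a\<in>carrier (Val \<Phi> c). x = \<epsilon> c a"
  using exact0[of c] by (auto simp: kernel_def)

lemma kerS: "\<lbrakk>c \<in> Obj C; x \<in> carrier (Val (I (Suc n)) c); \<delta> (Suc n) c x = \<one>\<^bsub>Val (I (Suc (Suc n))) c\<^esub>\<rbrakk>
    \<Longrightarrow> \<exists>y\<in>carrier (Val (I n) c). x = \<delta> n c y"
  using exactS[of c n] by (auto simp: kernel_def)

lemma \<delta>\<epsilon>: "\<lbrakk>c \<in> Obj C; a \<in> carrier (Val \<Phi> c)\<rbrakk> \<Longrightarrow> \<delta> 0 c (\<epsilon> c a) = \<one>\<^bsub>Val (I (Suc 0)) c\<^esub>"
  using exact0[of c] by (auto simp: kernel_def)

lemma \<delta>\<delta>: "\<lbrakk>c \<in> Obj C; x \<in> carrier (Val (I n) c)\<rbrakk> \<Longrightarrow> \<delta> (Suc n) c (\<delta> n c x) = \<one>\<^bsub>Val (I (Suc (Suc n))) c\<^esub>"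
  using exactS[of c n] by (auto simp: kernel_def)

end

text \<open>Extension along a differential requires that its kernel be killed. \<open>P\<close>
  therefore records that the map built so far sends cycles to cycles; exactness of \<open>I\<close>
  passes this on to the next degree.\<close>

lemma chain_map_exists:
  fixes I J :: "nat \<Rightarrow> ('o, 'a, 'x) presheaf"
  assumes "resolution C \<Phi> \<epsilon> I \<delta>" and "resolution C \<Phi> \<epsilon>' J \<delta>'"
  shows "\<exists>f. (\<forall>n. f n \<in> module_hom C (I n) (J n)) \<and>
     (\<forall>c\<in>Obj C. \<forall>a\<in>carrier (Val \<Phi> c). f 0 c (\<epsilon> c a) = \<epsilon>' c a) \<and>
     (\<forall>n. \<forall>c\<in>Obj C. \<forall>x\<in>carrier (Val (I n) c). f (Suc n) c (\<delta> n c x) = \<delta>' n c (f n c x))"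
proof -
  interpret R: resolution C \<Phi> \<epsilon> I \<delta> by fact
  interpret R': resolution C \<Phi> \<epsilon>' J \<delta>' by fact
  define P where "P = (\<lambda>n g. g \<in> module_hom C (I n) (J n) \<and>
     (n = 0 \<longrightarrow> (\<forall>c\<in>Obj C. \<forall>a\<in>carrier (Val \<Phi> c). g c (\<epsilon> c a) = \<epsilon>' c a)) \<and>
     (\<forall>c\<in>Obj C. \<forall>x\<in>carrier (Val (I n) c). \<delta> n c x = \<one>\<^bsub>Val (I (Suc n)) c\<^esub> \<longrightarrow> \<delta>' n c (g c x) = \<one>\<^bsub>Val (J (Suc n)) c\<^esub>))"
  define Q where "Q = (\<lambda>n g h. \<forall>c\<in>Obj C. \<forall>x\<in>carrier (Val (I n) c). h c (\<delta> n c x) = \<delta>' n c (g c x))"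
  have "\<exists>f. \<forall>n. P n (f n) \<and> Q n (f n) (f (Suc n))"
  proof (rule dependent_nat_choice)
    have "\<epsilon>' c x = \<one>\<^bsub>Val (J 0) c\<^esub>" if c: "c \<in> Obj C" and x: "x \<in> carrier (Val \<Phi> c)" "\<epsilon> c x = \<one>\<^bsub>Val (I 0) c\<^esub>" for c x
    proof -
      interpret e: group_hom "Val \<Phi> c" "Val (I 0) c" "\<epsilon> c" using module_hom_group_hom[OF R.mod R.modI R.\<epsilon>_hom c] .
      interpret e': group_hom "Val \<Phi> c" "Val (J 0) c" "\<epsilon>' c" using module_hom_group_hom[OF R.mod R'.modI R'.\<epsilon>_hom c] .
      show ?thesis using R.\<epsilon>_inj[OF c] x e.inj_on_one_iff by auto
    qed
    from injective_extend[OF R'.injective R.mod R.modI R.\<epsilon>_hom R'.\<epsilon>_hom this]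
    obtain g where g: "g \<in> module_hom C (I 0) (J 0)" "\<forall>c\<in>Obj C. \<forall>x\<in>carrier (Val \<Phi> c). g c (\<epsilon> c x) = \<epsilon>' c x" by blast
    have "P 0 g" unfolding P_def using g R.ker0 R'.\<delta>\<epsilon> by fastforce
    then show "\<exists>g. P 0 g" by blast
  next
    fix g n assume P: "P n g"
    then have g: "g \<in> module_hom C (I n) (J n)" by (simp add: P_def)
    have "\<exists>h\<in>module_hom C (I (Suc n)) (J (Suc n)). \<forall>c\<in>Obj C. \<forall>x\<in>carrier (Val (I n) c). h c (\<delta> n c x) = \<delta>' n c (g c x)"
      by (rule injective_extend[OF R'.injective R.modI R.modI R.\<delta>_hom module_hom_compose[OF g R'.\<delta>_hom]])
        (use P in \<open>simp add: P_def\<close>)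
    then obtain h where h: "h \<in> module_hom C (I (Suc n)) (J (Suc n))" and Q: "Q n g h" by (auto simp: Q_def)
    have "\<delta>' (Suc n) c (h c x) = \<one>\<^bsub>Val (J (Suc (Suc n))) c\<^esub>"
      if c: "c \<in> Obj C" and x: "x \<in> carrier (Val (I (Suc n)) c)" "\<delta> (Suc n) c x = \<one>\<^bsub>Val (I (Suc (Suc n))) c\<^esub>" for c x
    proof -
      obtain y where y: "y \<in> carrier (Val (I n) c)" "x = \<delta> n c y" using R.kerS[OF c x] by blast
      then have "h c x = \<delta>' n c (g c y)" using Q c by (simp add: Q_def)
      then show ?thesis using R'.\<delta>\<delta>[OF c module_hom_closed[OF g c y(1)]] by simp
    qed
    then have "P (Suc n) h" using h by (simp add: P_def)
    then show "\<exists>h. P (Suc n) h \<and> Q n g h" using Q by blast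
  qed
  then obtain f where f: "\<And>n. P n (f n)" "\<And>n. Q n (f n) (f (Suc n))" by blast
  show ?thesis
    using f(1) f(1)[of 0] f(2) unfolding P_def Q_def by (intro exI[of _ f]) simp
qed

text \<open>Each \<open>s (Suc n)\<close> extends, along the differential of \<open>I\<close>, the
  part of \<open>k (Suc n)\<close> not yet explained by \<open>\<delta>' n\<close> after
  \<open>s n\<close>. Stated for one map that vanishes on \<Phi> and not for a pair of homotopic
  maps, it covers the identity of an exact complex as well.\<close>

lemma homotopy_exists:
  fixes I J :: "nat \<Rightarrow> ('o, 'a, 'x) presheaf"
  assumes "resolution C \<Phi> \<epsilon> I \<delta>" and "resolution C \<Psi> \<epsilon>' J \<delta>'"
    and k: "\<And>n. k n \<in> module_hom C (I n) (J n)"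
    and k0: "\<And>c a. c \<in> Obj C \<Longrightarrow> a \<in> carrier (Val \<Phi> c) \<Longrightarrow> k 0 c (\<epsilon> c a) = \<one>\<^bsub>Val (J 0) c\<^esub>"
    and kS: "\<And>n c x. c \<in> Obj C \<Longrightarrow> x \<in> carrier (Val (I n) c) \<Longrightarrow> k (Suc n) c (\<delta> n c x) = \<delta>' n c (k n c x)"
  shows "\<exists>s. (\<forall>n. s n \<in> module_hom C (I (Suc n)) (J n)) \<and>
     (\<forall>c\<in>Obj C. \<forall>x\<in>carrier (Val (I 0) c). k 0 c x = s 0 c (\<delta> 0 c x)) \<and>
     (\<forall>n. \<forall>c\<in>Obj C. \<forall>x\<in>carrier (Val (I (Suc n)) c).
        k (Suc n) c x = s (Suc n) c (\<delta> (Suc n) c x) \<otimes>\<^bsub>Val (J (Suc n)) c\<^esub> \<delta>' n c (s n c x))"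
proof -
  interpret R: resolution C \<Phi> \<epsilon> I \<delta> by fact
  interpret R': resolution C \<Psi> \<epsilon>' J \<delta>' by fact
  define P where "P = (\<lambda>n g. g \<in> module_hom C (I (Suc n)) (J n) \<and>
     (n = 0 \<longrightarrow> (\<forall>c\<in>Obj C. \<forall>x\<in>carrier (Val (I 0) c). k 0 c x = g c (\<delta> 0 c x))) \<and>
     (\<forall>c\<in>Obj C. \<forall>x\<in>carrier (Val (I (Suc n)) c). \<delta> (Suc n) c x = \<one>\<^bsub>Val (I (Suc (Suc n))) c\<^esub> \<longrightarrow>
        k (Suc n) c x = \<delta>' n c (g c x)))"
  define Q where "Q = (\<lambda>n g h. \<forall>c\<in>Obj C. \<forall>x\<in>carrier (Val (I (Suc n)) c).
        k (Suc n) c x = h c (\<delta> (Suc n) c x) \<otimes>\<^bsub>Val (J (Suc n)) c\<^esub> \<delta>' n c (g c x))"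
  have "\<exists>s. \<forall>n. P n (s n) \<and> Q n (s n) (s (Suc n))"
  proof (rule dependent_nat_choice)
    have "\<exists>g\<in>module_hom C (I (Suc 0)) (J 0). \<forall>c\<in>Obj C. \<forall>x\<in>carrier (Val (I 0) c). g c (\<delta> 0 c x) = k 0 c x"
      by (rule injective_extend[OF R'.injective R.modI R.modI R.\<delta>_hom k])
        (use R.ker0 k0 in blast)
    then obtain g where g: "g \<in> module_hom C (I (Suc 0)) (J 0)"
       "\<forall>c\<in>Obj C. \<forall>x\<in>carrier (Val (I 0) c). g c (\<delta> 0 c x) = k 0 c x" by blast
    have "P 0 g" unfolding P_def using g R.kerS[of _ _ 0] kS[of _ _ 0] by fastforce
    then show "\<exists>g. P 0 g" by blast
  next
    fix g n assume P: "P n g"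
    then have g: "g \<in> module_hom C (I (Suc n)) (J n)" by (simp add: P_def)
    have \<delta>g: "(\<lambda>c x. \<delta>' n c (g c x)) \<in> module_hom C (I (Suc n)) (J (Suc n))"
      using g R'.\<delta>_hom by (rule module_hom_compose)
    let ?\<alpha> = "\<lambda>c x. k (Suc n) c x \<otimes>\<^bsub>Val (J (Suc n)) c\<^esub> inv\<^bsub>Val (J (Suc n)) c\<^esub> \<delta>' n c (g c x)"
    have Jg: "comm_group (Val (J m) c)" if "c \<in> Obj C" for m c
      using cat_module.Val_comm_group[OF R'.modI that] .
    have "\<exists>h\<in>module_hom C (I (Suc (Suc n))) (J (Suc n)).
        \<forall>c\<in>Obj C. \<forall>x\<in>carrier (Val (I (Suc n)) c). h c (\<delta> (Suc n) c x) = ?\<alpha> c x"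
    proof (rule injective_extend[OF R'.injective R.modI R.modI R.\<delta>_hom module_hom_diff[OF R.modI R'.modI k \<delta>g]])
      fix c x assume c: "c \<in> Obj C" and x: "x \<in> carrier (Val (I (Suc n)) c)" "\<delta> (Suc n) c x = \<one>\<^bsub>Val (I (Suc (Suc n))) c\<^esub>"
      interpret Jc: comm_group "Val (J (Suc n)) c" using Jg c .
      show "?\<alpha> c x = \<one>\<^bsub>Val (J (Suc n)) c\<^esub>"
        using P c x module_hom_closed[OF \<delta>g c x(1)] by (simp add: P_def)
    qed
    then obtain h where h: "h \<in> module_hom C (I (Suc (Suc n))) (J (Suc n))"
      and h\<alpha>: "\<forall>c\<in>Obj C. \<forall>x\<in>carrier (Val (I (Suc n)) c). h c (\<delta> (Suc n) c x) = ?\<alpha> c x" by blast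
    have Q: "Q n g h"
      unfolding Q_def
    proof (intro ballI)
      fix c x assume c: "c \<in> Obj C" and x: "x \<in> carrier (Val (I (Suc n)) c)"
      interpret Jc: comm_group "Val (J (Suc n)) c" using Jg c .
      show "k (Suc n) c x = h c (\<delta> (Suc n) c x) \<otimes>\<^bsub>Val (J (Suc n)) c\<^esub> \<delta>' n c (g c x)"
        using h\<alpha> c x module_hom_closed[OF \<delta>g c x] module_hom_closed[OF k c x] by (simp add: Jc.m_assoc)
    qed
    have "k (Suc (Suc n)) c x = \<delta>' (Suc n) c (h c x)"
      if c: "c \<in> Obj C" and x: "x \<in> carrier (Val (I (Suc (Suc n))) c)" "\<delta> (Suc (Suc n)) c x = \<one>\<^bsub>Val (I (Suc (Suc (Suc n)))) c\<^esub>" for c x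
    proof -
      obtain y where y: "y \<in> carrier (Val (I (Suc n)) c)" "x = \<delta> (Suc n) c y" using R.kerS[OF c x] by blast
      interpret d: group_hom "Val (J (Suc n)) c" "Val (J (Suc (Suc n))) c" "\<delta>' (Suc n) c"
        using module_hom_group_hom[OF R'.modI R'.modI R'.\<delta>_hom c] .
      have "k (Suc (Suc n)) c x = \<delta>' (Suc n) c (h c x \<otimes>\<^bsub>Val (J (Suc n)) c\<^esub> \<delta>' n c (g c y))"
        using kS[OF c y(1)] Q c y by (simp add: Q_def)
      then show ?thesis
        using module_hom_closed[OF h c x(1)] module_hom_closed[OF \<delta>g c y(1)] R'.\<delta>\<delta>[OF c module_hom_closed[OF g c y(1)]] by simp
    qed
    then have "P (Suc n) h" using h by (simp add: P_def)
    then show "\<exists>h. P (Suc n) h \<and> Q n g h" using Q by blast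
  qed
  then obtain s where s: "\<And>n. P n (s n)" "\<And>n. Q n (s n) (s (Suc n))" by blast
  show ?thesis
    using s(1) s(1)[of 0] s(2) unfolding P_def Q_def by (intro exI[of _ s]) simp
qed

section \<open>Inverse limits and the cohomology of their complexes\<close>

lemma inv_lim_iff:
  "t \<in> carrier (inv_lim C \<Phi>) \<longleftrightarrow> t \<in> (\<Pi>\<^sub>E c\<in>Obj C. carrier (Val \<Phi> c)) \<and>
     (\<forall>c\<in>Obj C. \<forall>d\<in>Obj C. \<forall>f\<in>Arr C c d. Res \<Phi> c d f (t d) = t c)"
  by (simp add: inv_lim_def)

lemma inv_lim_component: "t \<in> carrier (inv_lim C \<Phi>) \<Longrightarrow> c \<in> Obj C \<Longrightarrow> t c \<in> carrier (Val \<Phi> c)"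
  by (auto simp: inv_lim_iff)

lemma inv_lim_Res:
  "t \<in> carrier (inv_lim C \<Phi>) \<Longrightarrow> c \<in> Obj C \<Longrightarrow> d \<in> Obj C \<Longrightarrow> f \<in> Arr C c d \<Longrightarrow> Res \<Phi> c d f (t d) = t c"
  by (auto simp: inv_lim_iff)

lemma inv_lim_ext:
  "t \<in> carrier (inv_lim C \<Phi>) \<Longrightarrow> s \<in> carrier (inv_lim C \<Phi>) \<Longrightarrow> (\<And>c. c \<in> Obj C \<Longrightarrow> t c = s c) \<Longrightarrow> t = s"
  unfolding inv_lim_iff by (rule PiE_ext) auto

lemma inv_lim_mult: "c \<in> Obj C \<Longrightarrow> (t \<otimes>\<^bsub>inv_lim C \<Phi>\<^esub> s) c = t c \<otimes>\<^bsub>Val \<Phi> c\<^esub> s c"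
  by (simp add: inv_lim_def)

lemma inv_lim_one: "c \<in> Obj C \<Longrightarrow> \<one>\<^bsub>inv_lim C \<Phi>\<^esub> c = \<one>\<^bsub>Val \<Phi> c\<^esub>"
  by (simp add: inv_lim_def)

lemma inv_lim_comm_group:
  assumes "cat_module C \<Phi>" shows "comm_group (inv_lim C \<Phi>)"
proof -
  let ?P = "product_group (Obj C) (Val \<Phi>)"
  have g: "group (Val \<Phi> c)" "comm_group (Val \<Phi> c)" if "c \<in> Obj C" for c
    using cat_module.Val_comm_group[OF assms that] by (simp_all add: comm_group.axioms)
  have P: "comm_group ?P"
    by (rule group.group_comm_groupI[OF product_group[OF g(1)]])
       (auto intro!: restrict_ext comm_monoid.m_comm[OF comm_group.axioms(1)[OF g(2)]])
  interpret P: comm_group ?P by (rule P)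
  have "subgroup (carrier (inv_lim C \<Phi>)) ?P"
  proof (rule P.subgroupI)
    show "carrier (inv_lim C \<Phi>) \<subseteq> carrier ?P" by (auto simp: inv_lim_def)
    have "\<one>\<^bsub>?P\<^esub> \<in> carrier (inv_lim C \<Phi>)"
      unfolding inv_lim_iff using P.one_closed group_hom.hom_one[OF Res_group_hom[OF assms]] by simp
    then show "carrier (inv_lim C \<Phi>) \<noteq> {}" by blast
  next
    fix t assume t: "t \<in> carrier (inv_lim C \<Phi>)"
    then have tP: "t \<in> carrier ?P" by (simp add: inv_lim_iff)
    show "inv\<^bsub>?P\<^esub> t \<in> carrier (inv_lim C \<Phi>)"
      unfolding inv_lim_iff
      using P.inv_closed[OF tP] tP g group_hom.hom_inv[OF Res_group_hom[OF assms]]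
        inv_lim_component[OF t] inv_lim_Res[OF t] by simp
  next
    fix t s assume t: "t \<in> carrier (inv_lim C \<Phi>)" and s: "s \<in> carrier (inv_lim C \<Phi>)"
    then have tP: "t \<in> carrier ?P" "s \<in> carrier ?P" by (simp_all add: inv_lim_iff)
    show "t \<otimes>\<^bsub>?P\<^esub> s \<in> carrier (inv_lim C \<Phi>)"
      unfolding inv_lim_iff
      using P.m_closed[OF tP] group_hom.hom_mult[OF Res_group_hom[OF assms]]
        inv_lim_component[OF t] inv_lim_Res[OF t] inv_lim_component[OF s] inv_lim_Res[OF s] by simp
  qed
  from comm_group_subgroup[OF P this] show ?thesis by (simp add: inv_lim_def)
qed

lemma inv_lim_map_closed:
  assumes "\<eta> \<in> module_hom C \<Phi> \<Psi>" "t \<in> carrier (inv_lim C \<Phi>)"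
  shows "inv_lim_map C \<eta> t \<in> carrier (inv_lim C \<Psi>)"
  unfolding inv_lim_iff
proof (intro conjI ballI)
  show "inv_lim_map C \<eta> t \<in> (\<Pi>\<^sub>E c\<in>Obj C. carrier (Val \<Psi> c))"
    using module_hom_closed[OF assms(1)] inv_lim_component[OF assms(2)] by (auto simp: inv_lim_map_def)
  fix c d f assume cd: "c \<in> Obj C" "d \<in> Obj C" "f \<in> Arr C c d"
  show "Res \<Psi> c d f (inv_lim_map C \<eta> t d) = inv_lim_map C \<eta> t c"
    using module_hom_natural[OF assms(1) cd inv_lim_component[OF assms(2) cd(2)]] inv_lim_Res[OF assms(2) cd] cd
    by (simp add: inv_lim_map_def)
qed

lemma inv_lim_map_apply: "c \<in> Obj C \<Longrightarrow> inv_lim_map C \<eta> t c = \<eta> c (t c)"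
  by (simp add: inv_lim_map_def)

lemma inv_lim_map_hom:
  assumes "cat_module C \<Phi>" "cat_module C \<Psi>" "\<eta> \<in> module_hom C \<Phi> \<Psi>"
  shows "inv_lim_map C \<eta> \<in> hom (inv_lim C \<Phi>) (inv_lim C \<Psi>)"
proof (rule homI)
  interpret A: comm_group "inv_lim C \<Phi>" using assms(1) by (rule inv_lim_comm_group)
  interpret B: comm_group "inv_lim C \<Psi>" using assms(2) by (rule inv_lim_comm_group)
  fix t s assume ts: "t \<in> carrier (inv_lim C \<Phi>)" "s \<in> carrier (inv_lim C \<Phi>)"
  show "inv_lim_map C \<eta> (t \<otimes>\<^bsub>inv_lim C \<Phi>\<^esub> s) = inv_lim_map C \<eta> t \<otimes>\<^bsub>inv_lim C \<Psi>\<^esub> inv_lim_map C \<eta> s"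
  proof (rule inv_lim_ext)
    show "inv_lim_map C \<eta> (t \<otimes>\<^bsub>inv_lim C \<Phi>\<^esub> s) c = (inv_lim_map C \<eta> t \<otimes>\<^bsub>inv_lim C \<Psi>\<^esub> inv_lim_map C \<eta> s) c"
      if c: "c \<in> Obj C" for c
      using c hom_mult[OF module_homD[OF assms(3) c]] inv_lim_component[OF ts(1) c] inv_lim_component[OF ts(2) c]
      by (simp add: inv_lim_map_apply inv_lim_mult)
  qed (use ts inv_lim_map_closed[OF assms(3)] in auto)
qed (rule inv_lim_map_closed[OF assms(3)])

text \<open>Neither exactness nor injectivity is demanded, so that the sections supported outside a
  sieve are covered too.\<close>

locale module_complex =
  fixes C :: "('o, 'a) cat" and I :: "nat \<Rightarrow> ('o, 'a, 'x) presheaf" and \<delta>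
  assumes module: "cat_module C (I n)"
    and diff_hom: "\<delta> n \<in> module_hom C (I n) (I (Suc n))"
    and diff_diff: "\<lbrakk>c \<in> Obj C; x \<in> carrier (Val (I n) c)\<rbrakk> \<Longrightarrow> \<delta> (Suc n) c (\<delta> n c x) = \<one>\<^bsub>Val (I (Suc (Suc n))) c\<^esub>"
begin

lemma lim_comm_group: "comm_group (inv_lim C (I n))"
  using module by (rule inv_lim_comm_group)

lemma lim_map_group_hom: "group_hom (inv_lim C (I n)) (inv_lim C (I (Suc n))) (inv_lim_map C (\<delta> n))"
  using lim_comm_group lim_comm_group inv_lim_map_hom[OF module module diff_hom] by (rule group_hom_of_comm)

lemma cocycles_iff:
  "t \<in> lim_cocycles C I \<delta> n \<longleftrightarrow> t \<in> carrier (inv_lim C (I n)) \<and> (\<forall>c\<in>Obj C. \<delta> n c (t c) = \<one>\<^bsub>Val (I (Suc n)) c\<^esub>)"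
proof -
  interpret g: comm_group "inv_lim C (I (Suc n))" by (rule lim_comm_group)
  have "inv_lim_map C (\<delta> n) t = \<one>\<^bsub>inv_lim C (I (Suc n))\<^esub> \<longleftrightarrow> (\<forall>c\<in>Obj C. \<delta> n c (t c) = \<one>\<^bsub>Val (I (Suc n)) c\<^esub>)"
    if t: "t \<in> carrier (inv_lim C (I n))"
    using inv_lim_ext[OF inv_lim_map_closed[OF diff_hom t] g.one_closed]
    by (metis inv_lim_map_apply inv_lim_one)
  then show ?thesis by (auto simp: lim_cocycles_def kernel_def)
qed

lemma cocycles_subgroup: "subgroup (lim_cocycles C I \<delta> n) (inv_lim C (I n))"
  unfolding lim_cocycles_def by (rule group_hom.subgroup_kernel[OF lim_map_group_hom])

lemma coboundaries_subgroup: "subgroup (lim_coboundaries C I \<delta> n) (inv_lim C (I n))"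
proof (cases n)
  case 0
  interpret g: comm_group "inv_lim C (I 0)" by (rule lim_comm_group)
  show ?thesis using 0 g.triv_subgroup by simp
next
  case (Suc m)
  then show ?thesis using group_hom.img_is_subgroup[OF lim_map_group_hom] by simp
qed

lemma coboundaries_cocycles: "lim_coboundaries C I \<delta> n \<subseteq> lim_cocycles C I \<delta> n"
proof (cases n)
  case 0
  then show ?thesis using subgroup.one_closed[OF cocycles_subgroup] by simp
next
  case (Suc m)
  have "inv_lim_map C (\<delta> m) t \<in> lim_cocycles C I \<delta> n" if t: "t \<in> carrier (inv_lim C (I m))" for t
    unfolding cocycles_iff Suc
    using inv_lim_map_closed[OF diff_hom t] diff_diff inv_lim_component[OF t] by (simp add: inv_lim_map_apply)
  then show ?thesis using Suc by auto
qed

end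

lemma (in resolution) complex: "module_complex C I \<delta>"
  using modI \<delta>_hom \<delta>\<delta> by (rule module_complex.intro)

lemma lim_cohomology_isoI:
  assumes "module_complex C I \<delta>" and "module_complex C' J \<delta>'"
    and h: "h \<in> hom (inv_lim C (I n)) (inv_lim C' (J n))"
    and cocycle: "\<And>t. t \<in> lim_cocycles C I \<delta> n \<Longrightarrow> h t \<in> lim_cocycles C' J \<delta>' n"
    and coboundary: "\<And>t. t \<in> lim_cocycles C I \<delta> n \<Longrightarrow> h t \<in> lim_coboundaries C' J \<delta>' n \<longleftrightarrow> t \<in> lim_coboundaries C I \<delta> n"
    and surj: "\<And>z. z \<in> lim_cocycles C' J \<delta>' n \<Longrightarrow>
        \<exists>t\<in>lim_cocycles C I \<delta> n. \<exists>b\<in>lim_coboundaries C' J \<delta>' n. z = b \<otimes>\<^bsub>inv_lim C' (J n)\<^esub> h t"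
  shows "lim_cohomology C I \<delta> n \<cong> lim_cohomology C' J \<delta>' n"
proof -
  interpret X: module_complex C I \<delta> by fact
  interpret Y: module_complex C' J \<delta>' by fact
  interpret XX: comm_group "inv_lim C (I n)" by (rule X.lim_comm_group)
  interpret YY: comm_group "inv_lim C' (J n)" by (rule Y.lim_comm_group)
  show ?thesis
    unfolding lim_cohomology_def
  proof (rule FactGroup_iso_of_hom)
    show "h \<in> hom (inv_lim C (I n)\<lparr>carrier := lim_cocycles C I \<delta> n\<rparr>) (inv_lim C' (J n)\<lparr>carrier := lim_cocycles C' J \<delta>' n\<rparr>)"
      by (rule homI) (use cocycle hom_mult[OF h] subgroup.mem_carrier[OF X.cocycles_subgroup] in auto)
    show "subgroup (lim_coboundaries C I \<delta> n) (inv_lim C (I n)\<lparr>carrier := lim_cocycles C I \<delta> n\<rparr>)"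
      by (rule XX.subgroup_incl[OF X.coboundaries_subgroup X.cocycles_subgroup X.coboundaries_cocycles])
    show "subgroup (lim_coboundaries C' J \<delta>' n) (inv_lim C' (J n)\<lparr>carrier := lim_cocycles C' J \<delta>' n\<rparr>)"
      by (rule YY.subgroup_incl[OF Y.coboundaries_subgroup Y.cocycles_subgroup Y.coboundaries_cocycles])
  qed (use comm_group_subgroup[OF X.lim_comm_group X.cocycles_subgroup]
         comm_group_subgroup[OF Y.lim_comm_group Y.cocycles_subgroup] coboundary surj in auto)
qed

text \<open>\<open>k\<close> is null homotopic by \<open>homotopy_exists\<close>. On a cocycle
  \<open>t\<close> the summand that starts with \<delta> disappears, which leaves the differential
  of the image of \<open>t\<close> under \<open>s\<close>. In degree 0 nothing is left, in
  accordance with the trivial group of coboundaries there.\<close>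

lemma lim_homotopy:
  fixes I :: "nat \<Rightarrow> ('o, 'a, 'x) presheaf"
  assumes "resolution C \<Phi> \<epsilon> I \<delta>"
    and k: "\<And>n. k n \<in> module_hom C (I n) (I n)"
    and k0: "\<And>c a. c \<in> Obj C \<Longrightarrow> a \<in> carrier (Val \<Phi> c) \<Longrightarrow> k 0 c (\<epsilon> c a) = \<one>\<^bsub>Val (I 0) c\<^esub>"
    and kS: "\<And>n c x. c \<in> Obj C \<Longrightarrow> x \<in> carrier (Val (I n) c) \<Longrightarrow> k (Suc n) c (\<delta> n c x) = \<delta> n c (k n c x)"
    and t: "t \<in> lim_cocycles C I \<delta> n"
  shows "inv_lim_map C (k n) t \<in> lim_coboundaries C I \<delta> n"
proof -
  interpret R: resolution C \<Phi> \<epsilon> I \<delta> by fact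
  interpret X: module_complex C I \<delta> by (rule R.complex)
  obtain s where s: "\<And>n. s n \<in> module_hom C (I (Suc n)) (I n)"
    and s0: "\<And>c x. c \<in> Obj C \<Longrightarrow> x \<in> carrier (Val (I 0) c) \<Longrightarrow> k 0 c x = s 0 c (\<delta> 0 c x)"
    and sS: "\<And>n c x. c \<in> Obj C \<Longrightarrow> x \<in> carrier (Val (I (Suc n)) c) \<Longrightarrow>
        k (Suc n) c x = s (Suc n) c (\<delta> (Suc n) c x) \<otimes>\<^bsub>Val (I (Suc n)) c\<^esub> \<delta> n c (s n c x)"
  proof -
    have "\<exists>s. (\<forall>n. s n \<in> module_hom C (I (Suc n)) (I n)) \<and>
     (\<forall>c\<in>Obj C. \<forall>x\<in>carrier (Val (I 0) c). k 0 c x = s 0 c (\<delta> 0 c x)) \<and>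
     (\<forall>n. \<forall>c\<in>Obj C. \<forall>x\<in>carrier (Val (I (Suc n)) c).
        k (Suc n) c x = s (Suc n) c (\<delta> (Suc n) c x) \<otimes>\<^bsub>Val (I (Suc n)) c\<^esub> \<delta> n c (s n c x))"
      using assms(1) assms(1) k k0 kS by (rule homotopy_exists)
    then show ?thesis using that by blast
  qed
  have tc: "t \<in> carrier (inv_lim C (I n))" and dt: "\<And>c. c \<in> Obj C \<Longrightarrow> \<delta> n c (t c) = \<one>\<^bsub>Val (I (Suc n)) c\<^esub>"
    using t unfolding X.cocycles_iff by auto
  have s1: "s n c \<one>\<^bsub>Val (I (Suc n)) c\<^esub> = \<one>\<^bsub>Val (I n) c\<^esub>" if "c \<in> Obj C" for n c
    using group_hom.hom_one[OF module_hom_group_hom[OF R.modI R.modI s that]] .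
  show ?thesis
  proof (cases n)
    case 0
    interpret g: comm_group "inv_lim C (I 0)" by (rule X.lim_comm_group)
    have "inv_lim_map C (k 0) t = \<one>\<^bsub>inv_lim C (I 0)\<^esub>"
    proof (rule inv_lim_ext[OF inv_lim_map_closed[OF k] g.one_closed])
      show "inv_lim_map C (k 0) t c = \<one>\<^bsub>inv_lim C (I 0)\<^esub> c" if c: "c \<in> Obj C" for c
        using c s0[OF c inv_lim_component[OF tc[unfolded 0] c]] dt[OF c, unfolded 0] s1[OF c]
        by (simp add: inv_lim_map_apply inv_lim_one)
    qed (use tc 0 in simp)
    then show ?thesis using 0 by simp
  next
    case (Suc m)
    let ?u = "inv_lim_map C (s m) t"
    have u: "?u \<in> carrier (inv_lim C (I m))" using inv_lim_map_closed[OF s] tc Suc by simp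
    have "inv_lim_map C (k n) t = inv_lim_map C (\<delta> m) ?u"
    proof (rule inv_lim_ext)
      show "inv_lim_map C (k n) t \<in> carrier (inv_lim C (I n))" by (rule inv_lim_map_closed[OF k tc])
      show "inv_lim_map C (\<delta> m) ?u \<in> carrier (inv_lim C (I n))"
        using inv_lim_map_closed[OF R.\<delta>_hom u] Suc by simp
      fix c assume c: "c \<in> Obj C"
      interpret g: comm_group "Val (I (Suc m)) c" using cat_module.Val_comm_group[OF R.modI c] .
      have "\<delta> m c (s m c (t c)) \<in> carrier (Val (I n) c)"
        using module_hom_closed[OF R.\<delta>_hom c module_hom_closed[OF s c]] inv_lim_component[OF tc c] Suc by simp
      then show "inv_lim_map C (k n) t c = inv_lim_map C (\<delta> m) ?u c"
        using c sS[OF c, of "t c" m] inv_lim_component[OF tc c] dt[OF c] s1[OF c, of "Suc m"] Suc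
        by (simp add: inv_lim_map_apply)
    qed
    then show ?thesis using u Suc by auto
  qed
qed

text \<open>The complex is an injective resolution of the zero module, so even its identity vanishes
  on the resolved module and \<open>lim_homotopy\<close> applies to it.\<close>

lemma lim_exact:
  fixes I :: "nat \<Rightarrow> ('o, 'a, 'x) presheaf"
  assumes inj: "\<And>n. injective_module C (I n)"
    and \<delta>: "\<And>n. \<delta> n \<in> module_hom C (I n) (I (Suc n))"
    and ex0: "\<And>c. c \<in> Obj C \<Longrightarrow> kernel (Val (I 0) c) (Val (I 1) c) (\<delta> 0 c) = {\<one>\<^bsub>Val (I 0) c\<^esub>}"
    and exS: "\<And>n c. c \<in> Obj C \<Longrightarrow> \<delta> n c ` carrier (Val (I n) c) =
        kernel (Val (I (Suc n)) c) (Val (I (Suc (Suc n))) c) (\<delta> (Suc n) c)"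
  shows "lim_cocycles C I \<delta> n \<subseteq> lim_coboundaries C I \<delta> n"
proof
  fix t assume t: "t \<in> lim_cocycles C I \<delta> n"
  have mod: "cat_module C (I n)" for n using inj by (rule injective_cat_module)
  define \<Phi> where "\<Phi> = \<lparr>Val = (\<lambda>c. (Val (I 0) c)\<lparr>carrier := {\<one>\<^bsub>Val (I 0) c\<^esub>}\<rparr>), Res = Res (I 0)\<rparr>"
  have \<Phi>: "cat_module C \<Phi>"
    unfolding \<Phi>_def
    by (rule submodule[OF mod])
       (use group.triv_subgroup[OF comm_group.axioms(2)[OF cat_module.Val_comm_group[OF mod]]]
          group_hom.hom_one[OF Res_group_hom[OF mod]] in auto)
  have one: "\<one>\<^bsub>Val (I 0) c\<^esub> \<in> carrier (Val (I 0) c)" "monoid (Val (I 0) c)" if "c \<in> Obj C" for c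
    using cat_module.Val_comm_group[OF mod that] group.is_monoid comm_group.axioms(2) monoid.one_closed by blast+
  have "(\<lambda>c x. x) \<in> module_mono C \<Phi> (I 0)"
    using one by (auto simp: module_mono_def module_hom_def \<Phi>_def hom_def monoid.l_one)
  moreover have "(\<lambda>x. x) ` carrier (Val \<Phi> c) = kernel (Val (I 0) c) (Val (I 1) c) (\<delta> 0 c)" if "c \<in> Obj C" for c
    using ex0[OF that] by (simp add: \<Phi>_def)
  ultimately have "injective_resolution C \<Phi> (\<lambda>c x. x) I \<delta>"
    using inj \<delta> exS unfolding injective_resolution_def by blast
  then have R: "resolution C \<Phi> (\<lambda>c x. x) I \<delta>"
    using \<Phi> by (intro resolution.intro)
  have "inv_lim_map C (\<lambda>c x. x) t \<in> lim_coboundaries C I \<delta> n"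
    by (rule lim_homotopy[OF R _ _ _ t])
       (auto simp: module_hom_def hom_def \<Phi>_def)
  moreover have "inv_lim_map C (\<lambda>c x. x) t = t"
    using t by (auto simp: inv_lim_map_def lim_cocycles_def kernel_def inv_lim_iff PiE_iff intro: extensionalityI[of _ "Obj C"])
  ultimately show "t \<in> lim_coboundaries C I \<delta> n" by simp
qed

lemma module_hom_id: "cat_module C \<Phi> \<Longrightarrow> (\<lambda>c x. x) \<in> module_hom C \<Phi> \<Phi>"
  by (simp add: module_hom_def hom_def)

lemma chain_map_cocycle:
  assumes "module_complex C I \<delta>" and "module_complex C J \<delta>'"
    and f: "\<And>n. f n \<in> module_hom C (I n) (J n)"
    and fS: "\<And>n c x. c \<in> Obj C \<Longrightarrow> x \<in> carrier (Val (I n) c) \<Longrightarrow> f (Suc n) c (\<delta> n c x) = \<delta>' n c (f n c x)"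
    and t: "t \<in> lim_cocycles C I \<delta> n"
  shows "inv_lim_map C (f n) t \<in> lim_cocycles C J \<delta>' n"
proof -
  interpret X: module_complex C I \<delta> by fact
  interpret Y: module_complex C J \<delta>' by fact
  have tc: "t \<in> carrier (inv_lim C (I n))" and dt: "\<And>c. c \<in> Obj C \<Longrightarrow> \<delta> n c (t c) = \<one>\<^bsub>Val (I (Suc n)) c\<^esub>"
    using t unfolding X.cocycles_iff by auto
  have "\<delta>' n c (f n c (t c)) = \<one>\<^bsub>Val (J (Suc n)) c\<^esub>" if c: "c \<in> Obj C" for c
    using fS[OF c inv_lim_component[OF tc c], symmetric] dt[OF c]
      group_hom.hom_one[OF module_hom_group_hom[OF X.module Y.module f c]] by simp
  then show ?thesis
    unfolding Y.cocycles_iff using inv_lim_map_closed[OF f tc] by (simp add: inv_lim_map_apply)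
qed

lemma chain_map_coboundary:
  assumes "module_complex C I \<delta>" and "module_complex C J \<delta>'"
    and f: "\<And>n. f n \<in> module_hom C (I n) (J n)"
    and fS: "\<And>n c x. c \<in> Obj C \<Longrightarrow> x \<in> carrier (Val (I n) c) \<Longrightarrow> f (Suc n) c (\<delta> n c x) = \<delta>' n c (f n c x)"
    and t: "t \<in> lim_coboundaries C I \<delta> n"
  shows "inv_lim_map C (f n) t \<in> lim_coboundaries C J \<delta>' n"
proof -
  interpret X: module_complex C I \<delta> by fact
  interpret Y: module_complex C J \<delta>' by fact
  interpret F: group_hom "inv_lim C (I n)" "inv_lim C (J n)" "inv_lim_map C (f n)"
    by (rule group_hom_of_comm[OF X.lim_comm_group Y.lim_comm_group inv_lim_map_hom[OF X.module Y.module f]])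
  show ?thesis
  proof (cases n)
    case 0
    then show ?thesis using t F.hom_one by simp
  next
    case (Suc m)
    then obtain u where u: "u \<in> carrier (inv_lim C (I m))" "t = inv_lim_map C (\<delta> m) u" using t by auto
    have fu: "inv_lim_map C (f m) u \<in> carrier (inv_lim C (J m))" by (rule inv_lim_map_closed[OF f u(1)])
    have "inv_lim_map C (f n) t = inv_lim_map C (\<delta>' m) (inv_lim_map C (f m) u)"
    proof (rule inv_lim_ext)
      show "inv_lim_map C (f n) t \<in> carrier (inv_lim C (J n))"
        unfolding u(2) Suc by (rule inv_lim_map_closed[OF f inv_lim_map_closed[OF X.diff_hom u(1)]])
      show "inv_lim_map C (\<delta>' m) (inv_lim_map C (f m) u) \<in> carrier (inv_lim C (J n))"
        unfolding Suc by (rule inv_lim_map_closed[OF Y.diff_hom fu])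
      show "inv_lim_map C (f n) t c = inv_lim_map C (\<delta>' m) (inv_lim_map C (f m) u) c" if c: "c \<in> Obj C" for c
        using c fS[OF c inv_lim_component[OF u(1) c]] by (simp add: inv_lim_map_apply u(2) Suc)
    qed
    then show ?thesis using fu Suc by auto
  qed
qed

text \<open>The difference of the identity and \<open>k\<close> vanishes on \<Phi>, so it sends
  \<open>t\<close> to a coboundary; that coboundary is \<open>b\<close>.\<close>

lemma resolution_self_map:
  assumes "resolution C \<Phi> \<epsilon> I \<delta>"
    and k: "\<And>n. k n \<in> module_hom C (I n) (I n)"
    and k0: "\<And>c a. c \<in> Obj C \<Longrightarrow> a \<in> carrier (Val \<Phi> c) \<Longrightarrow> k 0 c (\<epsilon> c a) = \<epsilon> c a"
    and kS: "\<And>n c x. c \<in> Obj C \<Longrightarrow> x \<in> carrier (Val (I n) c) \<Longrightarrow> k (Suc n) c (\<delta> n c x) = \<delta> n c (k n c x)"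
    and t: "t \<in> lim_cocycles C I \<delta> n"
  shows "\<exists>b\<in>lim_coboundaries C I \<delta> n. t = b \<otimes>\<^bsub>inv_lim C (I n)\<^esub> inv_lim_map C (k n) t"
proof -
  interpret R: resolution C \<Phi> \<epsilon> I \<delta> by fact
  interpret X: module_complex C I \<delta> by (rule R.complex)
  interpret L: comm_group "inv_lim C (I n)" by (rule X.lim_comm_group)
  have g: "comm_group (Val (I n) c)" if "c \<in> Obj C" for n c
    using cat_module.Val_comm_group[OF R.modI that] .
  let ?d = "\<lambda>n c x. x \<otimes>\<^bsub>Val (I n) c\<^esub> inv\<^bsub>Val (I n) c\<^esub> k n c x"
  have d: "?d n \<in> module_hom C (I n) (I n)" for n
    by (rule module_hom_diff[OF R.modI R.modI module_hom_id[OF R.modI] k])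
  have b: "inv_lim_map C (?d n) t \<in> lim_coboundaries C I \<delta> n"
  proof (rule lim_homotopy[OF assms(1) d _ _ t])
    fix c a assume c: "c \<in> Obj C" and a: "a \<in> carrier (Val \<Phi> c)"
    interpret G: comm_group "Val (I 0) c" using g c .
    show "\<epsilon> c a \<otimes>\<^bsub>Val (I 0) c\<^esub> inv\<^bsub>Val (I 0) c\<^esub> k 0 c (\<epsilon> c a) = \<one>\<^bsub>Val (I 0) c\<^esub>"
      using k0[OF c a] module_hom_closed[OF R.\<epsilon>_hom c a] by simp
  next
    fix n c x assume c: "c \<in> Obj C" and x: "x \<in> carrier (Val (I n) c)"
    interpret D: group_hom "Val (I n) c" "Val (I (Suc n)) c" "\<delta> n c"
      using module_hom_group_hom[OF R.modI R.modI R.\<delta>_hom c] .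
    show "\<delta> n c x \<otimes>\<^bsub>Val (I (Suc n)) c\<^esub> inv\<^bsub>Val (I (Suc n)) c\<^esub> k (Suc n) c (\<delta> n c x) =
        \<delta> n c (x \<otimes>\<^bsub>Val (I n) c\<^esub> inv\<^bsub>Val (I n) c\<^esub> k n c x)"
      using kS[OF c x] x module_hom_closed[OF k c x] by simp
  qed
  have tc: "t \<in> carrier (inv_lim C (I n))" using t unfolding X.cocycles_iff by auto
  have kt: "inv_lim_map C (k n) t \<in> carrier (inv_lim C (I n))" by (rule inv_lim_map_closed[OF k tc])
  have bt: "inv_lim_map C (?d n) t \<in> carrier (inv_lim C (I n))" by (rule inv_lim_map_closed[OF d tc])
  have "t = inv_lim_map C (?d n) t \<otimes>\<^bsub>inv_lim C (I n)\<^esub> inv_lim_map C (k n) t"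
  proof (rule inv_lim_ext[OF tc L.m_closed[OF bt kt]])
    fix c assume c: "c \<in> Obj C"
    interpret G: comm_group "Val (I n) c" using g c .
    show "t c = (inv_lim_map C (?d n) t \<otimes>\<^bsub>inv_lim C (I n)\<^esub> inv_lim_map C (k n) t) c"
      using c inv_lim_component[OF tc c] module_hom_closed[OF k c inv_lim_component[OF tc c]]
      by (simp add: inv_lim_mult inv_lim_map_apply G.m_assoc)
  qed
  then show ?thesis using b by blast
qed

text \<open>Chain maps exist in both directions, and both composites lift the identity of \<Phi>, so
  each of them changes a cocycle only by a coboundary.\<close>

theorem lim_cohomology_unique:
  fixes I J :: "nat \<Rightarrow> ('o, 'a, 'x) presheaf"
  assumes RI: "resolution C \<Phi> \<epsilon> I \<delta>" and RJ: "resolution C \<Phi> \<epsilon>' J \<delta>'"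
  shows "lim_cohomology C I \<delta> n \<cong> lim_cohomology C J \<delta>' n"
proof -
  interpret R: resolution C \<Phi> \<epsilon> I \<delta> by fact
  interpret R': resolution C \<Phi> \<epsilon>' J \<delta>' by fact
  interpret X: module_complex C I \<delta> by (rule R.complex)
  interpret Y: module_complex C J \<delta>' by (rule R'.complex)
  obtain f where f: "\<And>n. f n \<in> module_hom C (I n) (J n)"
    and f0: "\<And>c a. c \<in> Obj C \<Longrightarrow> a \<in> carrier (Val \<Phi> c) \<Longrightarrow> f 0 c (\<epsilon> c a) = \<epsilon>' c a"
    and fS: "\<And>n c x. c \<in> Obj C \<Longrightarrow> x \<in> carrier (Val (I n) c) \<Longrightarrow> f (Suc n) c (\<delta> n c x) = \<delta>' n c (f n c x)"
    using chain_map_exists[OF RI RJ] by blast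
  obtain g where g: "\<And>n. g n \<in> module_hom C (J n) (I n)"
    and g0: "\<And>c a. c \<in> Obj C \<Longrightarrow> a \<in> carrier (Val \<Phi> c) \<Longrightarrow> g 0 c (\<epsilon>' c a) = \<epsilon> c a"
    and gS: "\<And>n c x. c \<in> Obj C \<Longrightarrow> x \<in> carrier (Val (J n) c) \<Longrightarrow> g (Suc n) c (\<delta>' n c x) = \<delta> n c (g n c x)"
    using chain_map_exists[OF RJ RI] by blast
  have comp: "inv_lim_map C (\<lambda>c x. v c (u c x)) t = inv_lim_map C v (inv_lim_map C u t)"
    for u v :: "'o \<Rightarrow> 'x \<Rightarrow> 'x" and t by (auto simp: inv_lim_map_def)
  have gf: "\<exists>b\<in>lim_coboundaries C I \<delta> n. t = b \<otimes>\<^bsub>inv_lim C (I n)\<^esub> inv_lim_map C (g n) (inv_lim_map C (f n) t)"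
    if "t \<in> lim_cocycles C I \<delta> n" for t n
    unfolding comp[symmetric]
    by (rule resolution_self_map[where k = "\<lambda>n c x. g n c (f n c x)", OF RI module_hom_compose[OF f g] _ _ that])
       (simp_all add: f0 g0 fS gS module_hom_closed[OF f])
  have fg: "\<exists>b\<in>lim_coboundaries C J \<delta>' n. t = b \<otimes>\<^bsub>inv_lim C (J n)\<^esub> inv_lim_map C (f n) (inv_lim_map C (g n) t)"
    if "t \<in> lim_cocycles C J \<delta>' n" for t n
    unfolding comp[symmetric]
    by (rule resolution_self_map[where k = "\<lambda>n c x. f n c (g n c x)", OF RJ module_hom_compose[OF g f] _ _ that])
       (simp_all add: f0 g0 fS gS module_hom_closed[OF g])
  note fcocycle = chain_map_cocycle[OF X.module_complex_axioms Y.module_complex_axioms, of f, OF f fS]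
  note gcocycle = chain_map_cocycle[OF Y.module_complex_axioms X.module_complex_axioms, of g, OF g gS]
  note fcoboundary = chain_map_coboundary[OF X.module_complex_axioms Y.module_complex_axioms, of f, OF f fS]
  note gcoboundary = chain_map_coboundary[OF Y.module_complex_axioms X.module_complex_axioms, of g, OF g gS]
  show ?thesis
  proof (rule lim_cohomology_isoI[OF X.module_complex_axioms Y.module_complex_axioms
        inv_lim_map_hom[OF X.module Y.module f]])
    fix t assume t: "t \<in> lim_cocycles C I \<delta> n"
    show "inv_lim_map C (f n) t \<in> lim_cocycles C J \<delta>' n" by (rule fcocycle) (use t in auto)
    show "inv_lim_map C (f n) t \<in> lim_coboundaries C J \<delta>' n \<longleftrightarrow> t \<in> lim_coboundaries C I \<delta> n"
    proof
      \<comment> \<open>Coboundaries are detected by going back: \<open>t\<close> differs from its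
        image under \<open>g\<close> after \<open>f\<close> by a coboundary.\<close>
      assume "inv_lim_map C (f n) t \<in> lim_coboundaries C J \<delta>' n"
      then have "inv_lim_map C (g n) (inv_lim_map C (f n) t) \<in> lim_coboundaries C I \<delta> n"
        by (rule gcoboundary[rotated -1]) auto
      then show "t \<in> lim_coboundaries C I \<delta> n"
        using gf[OF t] subgroup.m_closed[OF X.coboundaries_subgroup] by metis
    next
      assume "t \<in> lim_coboundaries C I \<delta> n"
      then show "inv_lim_map C (f n) t \<in> lim_coboundaries C J \<delta>' n"
        by (rule fcoboundary[rotated -1]) auto
    qed
  next
    fix z assume z: "z \<in> lim_cocycles C J \<delta>' n"
    have "inv_lim_map C (g n) z \<in> lim_cocycles C I \<delta> n" by (rule gcocycle) (use z in auto)
    then show "\<exists>t\<in>lim_cocycles C I \<delta> n. \<exists>b\<in>lim_coboundaries C J \<delta>' n.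
        z = b \<otimes>\<^bsub>inv_lim C (J n)\<^esub> inv_lim_map C (f n) t" using fg[OF z] by blast
  qed
qed

text \<open>\<open>J\<close> has values in the type from which \<open>chosen_resolution\<close>
  chooses, so its existence guarantees that \<open>SOME\<close> yields a resolution; uniqueness does
  the rest.\<close>

theorem higher_lim_resolution:
  fixes \<Phi> :: "('o, 'a, 'm) presheaf" and J :: "nat \<Rightarrow> ('o, 'a, ('o \<times> 'a, 'm) univ) presheaf"
  assumes R: "resolution C \<Phi> \<epsilon> J \<delta>"
  shows "higher_lim C \<Phi> n \<cong> lim_cohomology C J \<delta> n"
    and "lim_cohomology C J \<delta> n \<cong> higher_lim C \<Phi> n"
proof -
  interpret R: resolution C \<Phi> \<epsilon> J \<delta> by fact
  obtain I \<delta>' where I: "chosen_resolution C \<Phi> = (I, \<delta>')" by fastforce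
  have "case chosen_resolution C \<Phi> of (I, \<delta>) \<Rightarrow> \<exists>\<epsilon>. injective_resolution C \<Phi> \<epsilon> I \<delta>"
    unfolding chosen_resolution_def by (rule someI[of _ "(J, \<delta>)"]) (use R.res in auto)
  then obtain \<epsilon>' where "injective_resolution C \<Phi> \<epsilon>' I \<delta>'" using I by auto
  then have "resolution C \<Phi> \<epsilon>' I \<delta>'" using R.mod by (intro resolution.intro)
  from lim_cohomology_unique[OF this R] lim_cohomology_unique[OF R this]
  show "higher_lim C \<Phi> n \<cong> lim_cohomology C J \<delta> n" "lim_cohomology C J \<delta> n \<cong> higher_lim C \<Phi> n"
    by (simp_all add: higher_lim_def I)
qed

section \<open>Sections supported on a convex subcategory\<close>

lemma full_subcategory_simps [simp]:
  "Obj (full_subcategory C V) = {c \<in> Obj C. V c}"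
  "Arr (full_subcategory C V) = Arr C"
  "Idn (full_subcategory C V) = Idn C"
  "Cmp (full_subcategory C V) = Cmp C"
  by (simp_all add: full_subcategory_def)

lemma cat_module_full_subcategory: "cat_module C \<Phi> \<Longrightarrow> cat_module (full_subcategory C V) \<Phi>"
  by (rule cat_module.intro) (auto dest: cat_module.Val_comm_group cat_module.Res_hom cat_module.Res_Idn cat_module.Res_Cmp)

lemma module_hom_full_subcategory: "\<eta> \<in> module_hom C \<Phi> \<Psi> \<Longrightarrow> \<eta> \<in> module_hom (full_subcategory C V) \<Phi> \<Psi>"
  by (simp add: module_hom_def)

text \<open>The right adjoint of the extension by zero from the full subcategory on \<open>V\<close>; all of \<open>\<Phi>\<close> on \<open>V\<close> if \<open>V\<close> is a sieve.\<close>

definition supported_part :: "('o, 'a) cat \<Rightarrow> ('o \<Rightarrow> bool) \<Rightarrow> ('o, 'a, 'x) presheaf \<Rightarrow> ('o, 'a, 'x) presheaf" where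
  "supported_part C V \<Phi> = \<lparr>Val = (\<lambda>d. (Val \<Phi> d)\<lparr>carrier := {x \<in> carrier (Val \<Phi> d).
     \<forall>c\<in>Obj C. \<not> V c \<longrightarrow> (\<forall>f\<in>Arr C c d. Res \<Phi> c d f x = \<one>\<^bsub>Val \<Phi> c\<^esub>)}\<rparr>), Res = Res \<Phi>\<rparr>"

lemma supported_part_carrier:
  "x \<in> carrier (Val (supported_part C V \<Phi>) d) \<longleftrightarrow> x \<in> carrier (Val \<Phi> d) \<and>
     (\<forall>c\<in>Obj C. \<not> V c \<longrightarrow> (\<forall>f\<in>Arr C c d. Res \<Phi> c d f x = \<one>\<^bsub>Val \<Phi> c\<^esub>))"
  by (simp add: supported_part_def)

lemma supported_part_simps [simp]:
  "x \<otimes>\<^bsub>Val (supported_part C V \<Phi>) d\<^esub> y = x \<otimes>\<^bsub>Val \<Phi> d\<^esub> y"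
  "\<one>\<^bsub>Val (supported_part C V \<Phi>) d\<^esub> = \<one>\<^bsub>Val \<Phi> d\<^esub>"
  "Res (supported_part C V \<Phi>) = Res \<Phi>"
  by (simp_all add: supported_part_def)

lemma cat_module_supported_part:
  assumes C: "small_category C" and \<Phi>: "cat_module C \<Phi>"
  shows "cat_module C (supported_part C V \<Phi>)"
  unfolding supported_part_def
proof (rule submodule[OF \<Phi>])
  interpret small_category C by fact
  fix d assume d: "d \<in> Obj C"
  interpret D: comm_group "Val \<Phi> d" using cat_module.Val_comm_group[OF \<Phi> d] .
  note R = Res_group_hom[OF \<Phi> _ d]
  have G: "comm_group (Val \<Phi> c)" if "c \<in> Obj C" for c using cat_module.Val_comm_group[OF \<Phi> that] .
  show "subgroup {x \<in> carrier (Val \<Phi> d). \<forall>c\<in>Obj C. \<not> V c \<longrightarrow> (\<forall>f\<in>Arr C c d. Res \<Phi> c d f x = \<one>\<^bsub>Val \<Phi> c\<^esub>)} (Val \<Phi> d)"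
  proof (rule D.subgroupI)
    have "\<one>\<^bsub>Val \<Phi> d\<^esub> \<in> {x \<in> carrier (Val \<Phi> d). \<forall>c\<in>Obj C. \<not> V c \<longrightarrow> (\<forall>f\<in>Arr C c d. Res \<Phi> c d f x = \<one>\<^bsub>Val \<Phi> c\<^esub>)}"
      using group_hom.hom_one[OF R] by simp
    then show "{x \<in> carrier (Val \<Phi> d). \<forall>c\<in>Obj C. \<not> V c \<longrightarrow> (\<forall>f\<in>Arr C c d. Res \<Phi> c d f x = \<one>\<^bsub>Val \<Phi> c\<^esub>)} \<noteq> {}" by blast
  qed (use group_hom.hom_inv[OF R] group_hom.hom_mult[OF R] G in
        \<open>auto simp: comm_group.axioms group.is_monoid monoid.inv_one monoid.l_one\<close>)
next
  interpret small_category C by fact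
  fix c d f x assume cd: "c \<in> Obj C" "d \<in> Obj C" "f \<in> Arr C c d"
    and x: "x \<in> {x \<in> carrier (Val \<Phi> d). \<forall>c\<in>Obj C. \<not> V c \<longrightarrow> (\<forall>f\<in>Arr C c d. Res \<Phi> c d f x = \<one>\<^bsub>Val \<Phi> c\<^esub>)}"
  have "Res \<Phi> e c g (Res \<Phi> c d f x) = \<one>\<^bsub>Val \<Phi> e\<^esub>" if e: "e \<in> Obj C" "\<not> V e" "g \<in> Arr C e c" for e g
    using cat_module.Res_Cmp[OF \<Phi> e(1) cd(1,2) e(3) cd(3), of x] Cmp_in_Arr[OF e(1) cd(1,2) e(3) cd(3)] x e by simp
  then show "Res \<Phi> c d f x \<in> {x \<in> carrier (Val \<Phi> c). \<forall>e\<in>Obj C. \<not> V e \<longrightarrow> (\<forall>f\<in>Arr C e c. Res \<Phi> e c f x = \<one>\<^bsub>Val \<Phi> e\<^esub>)}"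
    using Res_closed[OF \<Phi> cd] x by simp
qed

lemma supported_part_hom:
  assumes \<Phi>: "cat_module C \<Phi>" and \<Psi>: "cat_module C \<Psi>" and \<eta>: "\<eta> \<in> module_hom C \<Phi> \<Psi>"
  shows "\<eta> \<in> module_hom C (supported_part C V \<Phi>) (supported_part C V \<Psi>)"
proof (rule module_homI)
  fix d assume d: "d \<in> Obj C"
  have "\<eta> d x \<in> carrier (Val (supported_part C V \<Psi>) d)" if x: "x \<in> carrier (Val (supported_part C V \<Phi>) d)" for x
    unfolding supported_part_carrier
  proof (intro conjI ballI impI)
    show "\<eta> d x \<in> carrier (Val \<Psi> d)" using module_hom_closed[OF \<eta> d] x by (simp add: supported_part_carrier)
    fix c f assume c: "c \<in> Obj C" "\<not> V c" "f \<in> Arr C c d"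
    then have "Res \<Phi> c d f x = \<one>\<^bsub>Val \<Phi> c\<^esub>" using x by (simp add: supported_part_carrier)
    then show "Res \<Psi> c d f (\<eta> d x) = \<one>\<^bsub>Val \<Psi> c\<^esub>"
      using module_hom_natural[OF \<eta> c(1) d c(3), of x] x group_hom.hom_one[OF module_hom_group_hom[OF \<Phi> \<Psi> \<eta> c(1)]]
      by (simp add: supported_part_carrier)
  qed
  then show "\<eta> d \<in> hom (Val (supported_part C V \<Phi>) d) (Val (supported_part C V \<Psi>) d)"
    using hom_mult[OF module_homD[OF \<eta> d]] by (intro homI) (auto simp: supported_part_carrier)
qed (use module_hom_natural[OF \<eta>] in \<open>simp add: supported_part_carrier\<close>)

text \<open>This makes extension by zero functorial: a composite of arrows between objects of
  \<open>V\<close> must not pass through an object where the value is zero.\<close>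

definition convex_in :: "('o, 'a) cat \<Rightarrow> ('o \<Rightarrow> bool) \<Rightarrow> bool" where
  "convex_in C V \<longleftrightarrow> (\<forall>b\<in>Obj C. \<forall>c\<in>Obj C. \<forall>d\<in>Obj C. V b \<and> V d \<and> Arr C b c \<noteq> {} \<and> Arr C c d \<noteq> {} \<longrightarrow> V c)"

text \<open>Outside \<open>V\<close> the values of \<open>A\<close> need not be groups, hence a
  fixed one-element group on \<open>undefined\<close> in place of the trivial subgroup of
  \<open>Val A c\<close>.\<close>

definition extend_by_zero :: "('o \<Rightarrow> bool) \<Rightarrow> ('o, 'a, 'x) presheaf \<Rightarrow> ('o, 'a, 'x) presheaf" where
  "extend_by_zero V A = \<lparr>
     Val = (\<lambda>c. if V c then Val A c else \<lparr>carrier = {undefined}, monoid.mult = (\<lambda>_ _. undefined), one = undefined\<rparr>),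
     Res = (\<lambda>c d f x. if V c \<and> V d then Res A c d f x else if V c then \<one>\<^bsub>Val A c\<^esub> else undefined)\<rparr>"

lemma cat_module_extend_by_zero:
  fixes A :: "('o, 'a, 'x) presheaf"
  assumes A: "cat_module (full_subcategory C V) A" and V: "convex_in C V"
  shows "cat_module C (extend_by_zero V A)"
proof -
  have G: "comm_group (Val A c)" if "c \<in> Obj C" "V c" for c
    using cat_module.Val_comm_group[OF A] that by simp
  have T: "comm_group (\<lparr>carrier = {undefined}, monoid.mult = (\<lambda>_ _. undefined), one = undefined\<rparr> :: 'x monoid)"
    by (rule comm_groupI) simp_all
  have one: "\<one>\<^bsub>Val A c\<^esub> \<in> carrier (Val A c)" "\<one>\<^bsub>Val A c\<^esub> \<otimes>\<^bsub>Val A c\<^esub> \<one>\<^bsub>Val A c\<^esub> = \<one>\<^bsub>Val A c\<^esub>" if "c \<in> Obj C" "V c" for c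
  proof -
    interpret comm_group "Val A c" using G that .
    show "\<one>\<^bsub>Val A c\<^esub> \<in> carrier (Val A c)" "\<one>\<^bsub>Val A c\<^esub> \<otimes>\<^bsub>Val A c\<^esub> \<one>\<^bsub>Val A c\<^esub> = \<one>\<^bsub>Val A c\<^esub>" by simp_all
  qed
  show ?thesis
  proof (rule cat_module.intro)
    show "comm_group (Val (extend_by_zero V A) c)" if "c \<in> Obj C" for c
      using G T that by (simp add: extend_by_zero_def)
  next
    fix c d f assume cd: "c \<in> Obj C" "d \<in> Obj C" "f \<in> Arr C c d"
    show "Res (extend_by_zero V A) c d f \<in> hom (Val (extend_by_zero V A) d) (Val (extend_by_zero V A) c)"
    proof (cases "V c \<and> V d")
      case True
      have "Res (extend_by_zero V A) c d f = Res A c d f" using True by (auto simp: extend_by_zero_def)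
      then show ?thesis
        using True cat_module.Res_hom[OF A, of c d f] cd by (simp add: extend_by_zero_def)
    next
      case False
      then show ?thesis using one cd by (auto simp: extend_by_zero_def hom_def)
    qed
  next
    fix c x assume "c \<in> Obj C" "x \<in> carrier (Val (extend_by_zero V A) c)"
    then show "Res (extend_by_zero V A) c c (Idn C c) x = x"
      using cat_module.Res_Idn[OF A, of c x] by (simp add: extend_by_zero_def split: if_splits)
  next
    fix b c d f g x
    assume *: "b \<in> Obj C" "c \<in> Obj C" "d \<in> Obj C" "f \<in> Arr C b c" "g \<in> Arr C c d"
      "x \<in> carrier (Val (extend_by_zero V A) d)"
    show "Res (extend_by_zero V A) b d (Cmp C g f) x =
        Res (extend_by_zero V A) b c f (Res (extend_by_zero V A) c d g x)"
    proof (cases "V b \<and> V d")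
      case True
      then have "V c" using V * unfolding convex_in_def by blast
      then show ?thesis using True * cat_module.Res_Cmp[OF A, of b c d f g x] by (simp add: extend_by_zero_def)
    next
      case False
      have "Res A b c f \<one>\<^bsub>Val A c\<^esub> = \<one>\<^bsub>Val A b\<^esub>" if "V b" "V c"
        using group_hom.hom_one[OF Res_group_hom[OF A, of b c f]] that * by simp
      then show ?thesis using False by (auto simp: extend_by_zero_def)
    qed
  qed
qed

text \<open>Morphisms from \<open>A\<close> to the supported part correspond to morphisms from the
  extension by zero of \<open>A\<close> to \<open>I\<close>, and extension by zero preserves
  monomorphisms.\<close>

lemma supported_part_injective:
  fixes I :: "('o, 'a, 'x) presheaf"
  assumes C: "small_category C" and V: "convex_in C V" and I: "injective_module C I"
  shows "injective_module (full_subcategory C V) (supported_part C V I)"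
  unfolding injective_module_def
proof (intro conjI allI impI; (elim conjE)?)
  let ?CV = "full_subcategory C V" and ?E = "extend_by_zero V" and ?S = "supported_part C V I"
  have Im: "cat_module C I" using I by (rule injective_cat_module)
  show "cat_module ?CV ?S"
    by (rule cat_module_full_subcategory[OF cat_module_supported_part[OF C Im]])
  fix A B :: "('o, 'a, 'x) presheaf" and \<iota> \<alpha>
  assume A: "cat_module ?CV A" and B: "cat_module ?CV B" and \<iota>: "\<iota> \<in> module_mono ?CV A B"
    and \<alpha>: "\<alpha> \<in> module_hom ?CV A ?S"
  have \<iota>h: "\<iota> \<in> module_hom ?CV A B" using \<iota> by (simp add: module_mono_def)
  have S: "cat_module ?CV ?S" by fact
  have EA: "cat_module C (?E A)" and EB: "cat_module C (?E B)"
    using cat_module_extend_by_zero V A B by blast+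
  define \<iota>' where "\<iota>' = (\<lambda>c x. if V c then \<iota> c x else undefined)"
  define \<alpha>' where "\<alpha>' = (\<lambda>c x. if V c then \<alpha> c x else \<one>\<^bsub>Val I c\<^esub>)"
  have \<iota>1: "\<iota> c \<one>\<^bsub>Val A c\<^esub> = \<one>\<^bsub>Val B c\<^esub>" if "c \<in> Obj C" "V c" for c
    using group_hom.hom_one[OF module_hom_group_hom[OF A B \<iota>h, of c]] that by simp
  have \<alpha>1: "\<alpha> c \<one>\<^bsub>Val A c\<^esub> = \<one>\<^bsub>Val I c\<^esub>" if "c \<in> Obj C" "V c" for c
    using group_hom.hom_one[OF module_hom_group_hom[OF A S \<alpha>, of c]] that by simp
  have R1: "Res I c d f \<one>\<^bsub>Val I d\<^esub> = \<one>\<^bsub>Val I c\<^esub>" if "c \<in> Obj C" "d \<in> Obj C" "f \<in> Arr C c d" for c d f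
    using group_hom.hom_one[OF Res_group_hom[OF Im that]] .
  have G: "\<one>\<^bsub>Val I c\<^esub> \<in> carrier (Val I c)" "\<one>\<^bsub>Val I c\<^esub> \<otimes>\<^bsub>Val I c\<^esub> \<one>\<^bsub>Val I c\<^esub> = \<one>\<^bsub>Val I c\<^esub>" if "c \<in> Obj C" for c
  proof -
    interpret comm_group "Val I c" using cat_module.Val_comm_group[OF Im that] .
    show "\<one>\<^bsub>Val I c\<^esub> \<in> carrier (Val I c)" "\<one>\<^bsub>Val I c\<^esub> \<otimes>\<^bsub>Val I c\<^esub> \<one>\<^bsub>Val I c\<^esub> = \<one>\<^bsub>Val I c\<^esub>" by simp_all
  qed
  have "\<iota>' \<in> module_mono C (?E A) (?E B)"
    unfolding module_mono_def
  proof (intro CollectI conjI ballI module_homI)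
    fix c assume c: "c \<in> Obj C"
    show "\<iota>' c \<in> hom (Val (?E A) c) (Val (?E B) c)"
    proof (cases "V c")
      case True
      then have "\<iota>' c = \<iota> c" by (auto simp: \<iota>'_def)
      then show ?thesis using module_homD[OF \<iota>h, of c] c True by (simp add: extend_by_zero_def)
    next
      case False
      then show ?thesis by (simp add: extend_by_zero_def hom_def \<iota>'_def)
    qed
    show "inj_on (\<iota>' c) (carrier (Val (?E A) c))"
      using \<iota> c by (auto simp: module_mono_def extend_by_zero_def \<iota>'_def inj_on_def)
  next
    fix c d f x assume cd: "c \<in> Obj C" "d \<in> Obj C" "f \<in> Arr C c d" "x \<in> carrier (Val (?E A) d)"
    then show "\<iota>' c (Res (?E A) c d f x) = Res (?E B) c d f (\<iota>' d x)"
      using module_hom_natural[OF \<iota>h, of c d f x] \<iota>1 by (auto simp: extend_by_zero_def \<iota>'_def)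
  qed
  moreover have "\<alpha>' \<in> module_hom C (?E A) I"
  proof (rule module_homI)
    fix c assume c: "c \<in> Obj C"
    show "\<alpha>' c \<in> hom (Val (?E A) c) (Val I c)"
    proof (cases "V c")
      case True
      then have "\<alpha>' c = \<alpha> c" by (auto simp: \<alpha>'_def)
      then show ?thesis
        using module_homD[OF \<alpha>, of c] c True by (auto simp: extend_by_zero_def hom_def Pi_iff supported_part_carrier)
    next
      case False
      then show ?thesis using G[OF c] by (simp add: extend_by_zero_def hom_def \<alpha>'_def)
    qed
  next
    fix c d f x assume cd: "c \<in> Obj C" "d \<in> Obj C" "f \<in> Arr C c d" and x: "x \<in> carrier (Val (?E A) d)"
    \<comment> \<open>At an arrow from outside \<open>V\<close> into \<open>V\<close> naturality
      demands that the restriction be trivial, which is the support condition.\<close>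
    have "Res I c d f (\<alpha> d x) = \<one>\<^bsub>Val I c\<^esub>" if "V d" "\<not> V c"
      using module_hom_closed[OF \<alpha>, of d x] x that cd by (simp add: extend_by_zero_def supported_part_carrier)
    then show "\<alpha>' c (Res (?E A) c d f x) = Res I c d f (\<alpha>' d x)"
      using module_hom_natural[OF \<alpha>, of c d f x] \<alpha>1 R1 cd x by (auto simp: extend_by_zero_def \<alpha>'_def)
  qed
  ultimately obtain \<beta> where \<beta>: "\<beta> \<in> module_hom C (?E B) I"
    and \<beta>\<iota>: "\<And>c x. c \<in> Obj C \<Longrightarrow> x \<in> carrier (Val (?E A) c) \<Longrightarrow> \<beta> c (\<iota>' c x) = \<alpha>' c x"
    using I EA EB unfolding injective_module_def by blast
  have "\<beta> \<in> module_hom ?CV B ?S"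
  proof (rule module_homI)
    fix d assume d: "d \<in> Obj ?CV"
    then have EBd: "Val (?E B) d = Val B d" by (simp add: extend_by_zero_def)
    \<comment> \<open>Conversely \<beta> takes values in the supported part: its restriction to an
      object outside \<open>V\<close> factors through a zero group.\<close>
    have "Res I c d f (\<beta> d x) = \<one>\<^bsub>Val I c\<^esub>" if c: "c \<in> Obj C" "\<not> V c" "f \<in> Arr C c d" and x: "x \<in> carrier (Val B d)" for c f x
    proof -
      have "Res I c d f (\<beta> d x) = \<beta> c (Res (?E B) c d f x)"
        using module_hom_natural[OF \<beta> c(1) _ c(3), of x] d x EBd by simp
      also have "Res (?E B) c d f x = \<one>\<^bsub>Val (?E B) c\<^esub>" using c(2) by (simp add: extend_by_zero_def)
      finally show ?thesis using group_hom.hom_one[OF module_hom_group_hom[OF EB Im \<beta> c(1)]] by simp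
    qed
    then show "\<beta> d \<in> hom (Val B d) (Val ?S d)"
      using module_homD[OF \<beta>, of d] d EBd by (auto simp: hom_def Pi_iff supported_part_carrier)
  next
    fix c d f x assume cd: "c \<in> Obj ?CV" "d \<in> Obj ?CV" "f \<in> Arr ?CV c d" "x \<in> carrier (Val B d)"
    then show "\<beta> c (Res B c d f x) = Res ?S c d f (\<beta> d x)"
      using module_hom_natural[OF \<beta>, of c d f x] by (simp add: extend_by_zero_def)
  qed
  moreover have "\<beta> c (\<iota> c x) = \<alpha> c x" if "c \<in> Obj ?CV" "x \<in> carrier (Val A c)" for c x
    using \<beta>\<iota>[of c x] that by (simp add: \<iota>'_def \<alpha>'_def extend_by_zero_def)
  ultimately show "\<exists>\<beta>\<in>module_hom ?CV B ?S. \<forall>c\<in>Obj ?CV. \<forall>x\<in>carrier (Val A c). \<beta> c (\<iota> c x) = \<alpha> c x"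
    by blast
qed

lemma injective_module_cong:
  assumes V: "\<And>c. c \<in> Obj C \<Longrightarrow> Val I c = Val J c" and R: "Res I = Res J" and I: "injective_module C I"
  shows "injective_module C J"
proof -
  have "cat_module C I = cat_module C J"
    unfolding cat_module_def using V R by simp
  moreover have "module_hom C A I = module_hom C A J" for A :: "('a, 'b, 'c) presheaf"
    using V R by (auto simp: module_hom_def)
  ultimately show ?thesis using I by (simp add: injective_module_def)
qed

text \<open>For a sieve no object outside \<open>V\<close> maps to one inside, so the support
  condition is empty and the supported part is all of \<open>I\<close> there.\<close>

lemma injective_restrict_sieve:
  assumes C: "small_category C" and I: "injective_module C I"
    and V: "\<And>c d. c \<in> Obj C \<Longrightarrow> d \<in> Obj C \<Longrightarrow> V d \<Longrightarrow> Arr C c d \<noteq> {} \<Longrightarrow> V c"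
  shows "injective_module (full_subcategory C V) I"
proof (rule injective_module_cong[OF _ _ supported_part_injective[OF C _ I]])
  show "convex_in C V" using V unfolding convex_in_def by blast
  show "Val (supported_part C V I) c = Val I c" if "c \<in> Obj (full_subcategory C V)" for c
  proof -
    have "{x \<in> carrier (Val I c). \<forall>b\<in>Obj C. \<not> V b \<longrightarrow> (\<forall>f\<in>Arr C b c. Res I b c f x = \<one>\<^bsub>Val I b\<^esub>)} = carrier (Val I c)"
      using V[of _ c] that by auto
    then show ?thesis by (simp add: supported_part_def)
  qed
qed simp

section \<open>Chains in directed posets\<close>

text \<open>Lists of length \<open>k\<close> are simplices of dimension \<open>k - 1\<close>; the complex is augmented, since \<open>bd [e] = frag_of []\<close>.\<close>

fun bd :: "'e list \<Rightarrow> ('e list \<Rightarrow>\<^sub>0 int)" where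
  "bd [] = 0"
| "bd (e # es) = frag_of es - frag_extend (\<lambda>l. frag_of (e # l)) (bd es)"

lemma frag_extend_fun_diff: "frag_extend (\<lambda>x. a x - b x) c = frag_extend a c - frag_extend b c"
  by (induction c rule: frag_induction[OF subset_UNIV]) (auto simp: frag_extend_diff algebra_simps)

lemma frag_extend_fun_add: "frag_extend (\<lambda>x. a x + b x) c = frag_extend a c + frag_extend b c"
  by (induction c rule: frag_induction[OF subset_UNIV]) (auto simp: frag_extend_diff algebra_simps)

lemma frag_extend_frag_extend: "frag_extend f (frag_extend g c) = frag_extend (\<lambda>x. frag_extend f (g x)) c"
  by (induction c rule: frag_induction[OF subset_UNIV]) (auto simp: frag_extend_diff)

lemma frag_extend_id: "frag_extend frag_of c = c"
  by (rule frag_expansion[symmetric])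

lemma frag_cmul_diff_right: "frag_cmul k (x - y) = frag_cmul k x - frag_cmul k y"
  using frag_cmul_distrib2[of k "x - y" y] by (simp add: eq_diff_eq)

lemma frag_extend_fun_cmul: "frag_extend (\<lambda>x. frag_cmul k (a x)) c = frag_cmul k (frag_extend a c)"
  by (induction c rule: frag_induction[OF subset_UNIV]) (auto simp: frag_extend_diff frag_cmul_diff_right)

text \<open>The recursion is a cone formula: the boundary of \<open>e # l\<close> is
  \<open>l\<close> minus the cone over the boundary of \<open>l\<close>, and the two copies of
  \<open>bd l\<close> that result from a second application cancel.\<close>

lemma bd_bd: "frag_extend bd (bd l) = 0"
proof (induction l)
  case (Cons e l)
  have "frag_extend bd (frag_extend (\<lambda>l. frag_of (e # l)) (bd l)) =
      frag_extend (\<lambda>l. frag_of l - frag_extend (\<lambda>l. frag_of (e # l)) (bd l)) (bd l)"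
    by (simp add: frag_extend_frag_extend)
  also have "\<dots> = bd l - frag_extend (\<lambda>l. frag_of (e # l)) (frag_extend bd (bd l))"
    by (simp add: frag_extend_fun_diff frag_extend_id frag_extend_frag_extend)
  finally show ?case using Cons by (simp add: frag_extend_diff)
qed simp

lemma bd_bd_extend: "frag_extend bd (frag_extend bd z) = 0"
  by (simp add: frag_extend_frag_extend bd_bd frag_extend_eq_0)

lemma bd_map: "bd (map g l) = frag_extend (\<lambda>l. frag_of (map g l)) (bd l)"
  by (induction l) (simp_all add: frag_extend_diff frag_extend_frag_extend)

lemma bd_map_extend:
  "frag_extend bd (frag_extend (\<lambda>l. frag_of (map g l)) z) = frag_extend (\<lambda>l. frag_of (map g l)) (frag_extend bd z)"
  by (simp add: frag_extend_frag_extend bd_map)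

text \<open>\<open>bd\<close> recurses at the head, whereas an upper bound has to be appended at the
  end; dropping the last vertex picks up one sign for each vertex before it.\<close>

lemma bd_snoc:
  "bd (l @ [T]) = frag_extend (\<lambda>l. frag_of (l @ [T])) (bd l) + frag_cmul ((- 1) ^ length l) (frag_of l)"
proof (induction l)
  case (Cons e l)
  have "bd ((e # l) @ [T]) = frag_of (l @ [T]) - frag_extend (\<lambda>l. frag_of (e # l)) (bd (l @ [T]))" by simp
  also have "\<dots> = frag_of (l @ [T]) - frag_extend (\<lambda>l. frag_of (e # l @ [T])) (bd l)
      - frag_cmul ((- 1) ^ length l) (frag_of (e # l))"
    by (simp add: Cons frag_extend_add frag_extend_cmul frag_extend_frag_extend)
  also have "\<dots> = frag_extend (\<lambda>l. frag_of (l @ [T])) (bd (e # l)) + frag_cmul ((- 1) ^ length (e # l)) (frag_of (e # l))"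
    by (simp add: frag_extend_diff frag_extend_frag_extend)
  finally show ?case .
qed simp

text \<open>Vertices may repeat when \<open>r\<close> is reflexive, so monotone maps send chains to
  chains; \<open>sorted_wrt\<close> compares all pairs and not only neighbours, so faces of chains
  are chains.\<close>

definition chains :: "('e \<Rightarrow> 'e \<Rightarrow> bool) \<Rightarrow> 'e set \<Rightarrow> nat \<Rightarrow> 'e list set" where
  "chains r E k = {l. length l = k \<and> set l \<subseteq> E \<and> sorted_wrt r l}"

lemma keys_bd: "Poly_Mapping.keys (bd l) \<subseteq> {m. Suc (length m) = length l \<and> set m \<subseteq> set l \<and> (sorted_wrt r l \<longrightarrow> sorted_wrt r m)}"
proof (induction l)
  case (Cons e l)
  have "Poly_Mapping.keys (bd (e # l)) \<subseteq> {l} \<union> Poly_Mapping.keys (frag_extend (\<lambda>l. frag_of (e # l)) (bd l))"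
    using keys_diff[of "frag_of l"] by fastforce
  also have "\<dots> \<subseteq> {l} \<union> (\<lambda>m. e # m) ` Poly_Mapping.keys (bd l)"
    using keys_frag_extend[of "\<lambda>l. frag_of (e # l)" "bd l"] by fastforce
  finally have *: "Poly_Mapping.keys (bd (e # l)) \<subseteq> {l} \<union> (\<lambda>m. e # m) ` Poly_Mapping.keys (bd l)" .
  show ?case
  proof
    fix m assume "m \<in> Poly_Mapping.keys (bd (e # l))"
    then consider "m = l" | m' where "m = e # m'" "m' \<in> Poly_Mapping.keys (bd l)" using * by blast
    then show "m \<in> {m. Suc (length m) = length (e # l) \<and> set m \<subseteq> set (e # l) \<and> (sorted_wrt r (e # l) \<longrightarrow> sorted_wrt r m)}"
      by cases (use Cons in auto)
  qed
qed simp

lemma frag_extend_hom: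
  assumes "\<And>x. x \<in> S \<Longrightarrow> Poly_Mapping.keys (b x) \<subseteq> T"
  shows "frag_extend b \<in> hom (free_Abelian_group S) (free_Abelian_group T)"
  by (rule homI) (use assms keys_frag_extend[of b] in \<open>fastforce simp: frag_extend_add\<close>)+

lemma bd_chains: "l \<in> chains r E (Suc k) \<Longrightarrow> Poly_Mapping.keys (bd l) \<subseteq> chains r E k"
  using keys_bd[of l r] by (auto simp: chains_def)

lemma bd_hom: "frag_extend bd \<in> hom (free_Abelian_group (chains r E (Suc k))) (free_Abelian_group (chains r E k))"
  using bd_chains by (rule frag_extend_hom)

lemma bd_closed:
  "Poly_Mapping.keys z \<subseteq> chains r E (Suc k) \<Longrightarrow> Poly_Mapping.keys (frag_extend bd z) \<subseteq> chains r E k"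
  using hom_in_carrier[OF bd_hom, of z r E k] by simp

lemma hom_eq_on_free:
  assumes "group G" "f \<in> hom (free_Abelian_group S) G" "g \<in> hom (free_Abelian_group S) G"
    and eq: "\<And>x. x \<in> S \<Longrightarrow> f (frag_of x) = g (frag_of x)" and z: "Poly_Mapping.keys z \<subseteq> S"
  shows "f z = g z"
proof -
  interpret f: group_hom "free_Abelian_group S" G f
    using assms by (simp add: group_hom_def group_hom_axioms_def)
  interpret g: group_hom "free_Abelian_group S" G g
    using assms by (simp add: group_hom_def group_hom_axioms_def)
  have "Poly_Mapping.keys z \<subseteq> S \<and> f z = g z"
    using z
  proof (induction rule: frag_induction)
    case zero
    show ?case using f.hom_one g.hom_one by simp
  next
    case (one x) then show ?case using eq by simp
  next
    case (diff a b)
    have "f (a - b) = g (a - b)"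
      using diff f.hom_mult[of a "- b"] f.hom_inv[of b] g.hom_mult[of a "- b"] g.hom_inv[of b] by simp
    moreover have "Poly_Mapping.keys (a - b) \<subseteq> S" using diff keys_diff[of a b] by blast
    ultimately show ?case by simp
  qed
  then show ?thesis by blast
qed

lemma directed_finite:
  assumes "finite F" "F \<subseteq> E" "E \<noteq> {}"
    and "\<And>a b. a \<in> E \<Longrightarrow> b \<in> E \<Longrightarrow> \<exists>c\<in>E. r a c \<and> r b c"
    and "\<And>a b c. a \<in> E \<Longrightarrow> b \<in> E \<Longrightarrow> c \<in> E \<Longrightarrow> r a b \<Longrightarrow> r b c \<Longrightarrow> r a c"
  shows "\<exists>T\<in>E. \<forall>e\<in>F. r e T"
  using assms(1,2)
proof (induction F rule: finite_induct)
  case empty then show ?case using assms(3) by blast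
next
  case (insert e F)
  then obtain T where T: "T \<in> E" "\<forall>e\<in>F. r e T" by blast
  obtain U where "U \<in> E" "r e U" "r T U" using assms(4)[of e T] insert T by blast
  then show ?case using T insert assms(5) by blast
qed

text \<open>Coning off with an upper bound of all vertices of a cycle shows that it is a boundary.\<close>

lemma directed_acyclic:
  assumes dir: "\<And>a b. a \<in> E \<Longrightarrow> b \<in> E \<Longrightarrow> \<exists>c\<in>E. r a c \<and> r b c"
    and tr: "\<And>a b c. a \<in> E \<Longrightarrow> b \<in> E \<Longrightarrow> c \<in> E \<Longrightarrow> r a b \<Longrightarrow> r b c \<Longrightarrow> r a c"
    and z: "Poly_Mapping.keys z \<subseteq> chains r E (Suc k)" and cyc: "frag_extend bd z = 0"
  shows "\<exists>w. Poly_Mapping.keys w \<subseteq> chains r E (Suc (Suc k)) \<and> frag_extend bd w = z"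
proof (cases "E = {}")
  \<comment> \<open>An empty poset offers no vertex to cone with, but it has no chains of positive
    length either.\<close>
  case True
  then have "chains r E (Suc k) = {}" by (auto simp: chains_def)
  then have "z = 0" using z by (metis keys_eq_empty subset_empty)
  then show ?thesis by (intro exI[of _ 0]) simp
next
  case False
  have "finite (\<Union>(set ` Poly_Mapping.keys z))" "\<Union>(set ` Poly_Mapping.keys z) \<subseteq> E"
    using z by (auto simp: chains_def)
  then have "\<exists>T\<in>E. \<forall>e\<in>\<Union>(set ` Poly_Mapping.keys z). r e T"
    using False dir tr by (rule directed_finite)
  then obtain T where T: "T \<in> E" "\<And>l e. l \<in> Poly_Mapping.keys z \<Longrightarrow> e \<in> set l \<Longrightarrow> r e T"
    by blast
  define w where "w = frag_extend (\<lambda>l. frag_of (l @ [T])) z"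
  have w: "Poly_Mapping.keys w \<subseteq> chains r E (Suc (Suc k))"
    using keys_frag_extend[of "\<lambda>l. frag_of (l @ [T])" z] z T
    by (fastforce simp: w_def chains_def sorted_wrt_append)
  have "frag_extend bd w = frag_extend (\<lambda>l. frag_extend (\<lambda>l. frag_of (l @ [T])) (bd l) + frag_cmul ((- 1) ^ length l) (frag_of l)) z"
    by (simp add: w_def frag_extend_frag_extend bd_snoc)
  also have "\<dots> = frag_extend (\<lambda>l. frag_cmul ((- 1) ^ length l) (frag_of l)) z"
    using cyc by (simp add: frag_extend_fun_add flip: frag_extend_frag_extend)
  also have "\<dots> = frag_extend (\<lambda>l. frag_cmul ((- 1) ^ Suc k) (frag_of l)) z"
    by (rule frag_extend_eq) (use z in \<open>auto simp: chains_def\<close>)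
  also have "\<dots> = frag_cmul ((- 1) ^ Suc k) z"
    by (simp only: frag_extend_fun_cmul frag_extend_id)
  \<comment> \<open>The sign in front of \<open>z\<close> is its own inverse, so \<open>z\<close> is
    bounded by \<open>w\<close> with that sign.\<close>
  finally have "frag_extend bd (frag_cmul ((- 1) ^ Suc k) w) = z"
    by (simp add: frag_extend_cmul flip: power_add power_mult_distrib)
  moreover have "Poly_Mapping.keys (frag_cmul ((- 1) ^ Suc k) w) \<subseteq> chains r E (Suc (Suc k))"
    using w keys_cmul by blast
  ultimately show ?thesis by blast
qed

text \<open>Dual form of acyclicity: the kernel of \<open>bd\<close> consists of boundaries, on
  which a cocycle vanishes, and a homomorphism to a divisible group that vanishes on the kernel of
  \<open>bd\<close> extends along \<open>bd\<close>.\<close>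

lemma directed_cocycle_extends:
  assumes dir: "\<And>a b. a \<in> E \<Longrightarrow> b \<in> E \<Longrightarrow> \<exists>c\<in>E. r a c \<and> r b c"
    and tr: "\<And>a b c. a \<in> E \<Longrightarrow> b \<in> E \<Longrightarrow> c \<in> E \<Longrightarrow> r a b \<Longrightarrow> r b c \<Longrightarrow> r a c"
    and D: "divisible_group D" and \<phi>: "\<phi> \<in> hom (free_Abelian_group (chains r E (Suc k))) D"
    and cocycle: "\<And>w. Poly_Mapping.keys w \<subseteq> chains r E (Suc (Suc k)) \<Longrightarrow> \<phi> (frag_extend bd w) = \<one>\<^bsub>D\<^esub>"
  shows "\<exists>\<psi>\<in>hom (free_Abelian_group (chains r E k)) D.
     \<forall>z. Poly_Mapping.keys z \<subseteq> chains r E (Suc k) \<longrightarrow> \<psi> (frag_extend bd z) = \<phi> z"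
proof -
  have "\<exists>\<psi>\<in>hom (free_Abelian_group (chains r E k)) D.
     \<forall>z\<in>carrier (free_Abelian_group (chains r E (Suc k))). \<psi> (frag_extend bd z) = \<phi> z"
  proof (rule divisible_factor[OF abelian_free_Abelian_group abelian_free_Abelian_group D bd_hom \<phi>])
    fix z assume z: "z \<in> carrier (free_Abelian_group (chains r E (Suc k)))"
      and cyc: "frag_extend bd z = \<one>\<^bsub>free_Abelian_group (chains r E k)\<^esub>"
    have "\<exists>w. Poly_Mapping.keys w \<subseteq> chains r E (Suc (Suc k)) \<and> frag_extend bd w = z"
      by (rule directed_acyclic[OF dir tr]) (use z cyc in auto)
    then show "\<phi> z = \<one>\<^bsub>D\<^esub>" using cocycle by blast
  qed
  then show ?thesis by (simp add: Ball_def)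
qed

section \<open>Cohomology of posets with coefficients\<close>

definition poset_category :: "'o set \<Rightarrow> ('o \<Rightarrow> 'o \<Rightarrow> bool) \<Rightarrow> ('o, unit) cat" where
  "poset_category S r = \<lparr>Obj = S, Arr = (\<lambda>a b. {f. r a b}), Idn = (\<lambda>_. ()), Cmp = (\<lambda>_ _. ())\<rparr>"

lemma poset_category_simps [simp]:
  "Obj (poset_category S r) = S" "f \<in> Arr (poset_category S r) a b \<longleftrightarrow> r a b"
  by (simp_all add: poset_category_def)

locale poset =
  fixes S :: "'o set" and r :: "'o \<Rightarrow> 'o \<Rightarrow> bool"
  assumes refl: "a \<in> S \<Longrightarrow> r a a"
    and trans: "\<lbrakk>a \<in> S; b \<in> S; c \<in> S; r a b; r b c\<rbrakk> \<Longrightarrow> r a c"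
begin

definition up :: "'o \<Rightarrow> 'o set" where "up Q = {R \<in> S. r Q R}"

abbreviation up_chains :: "'o \<Rightarrow> nat \<Rightarrow> 'o list set" where "up_chains Q k \<equiv> chains r (up Q) k"

text \<open>A natural transformation to \<open>Y\<close> from the free abelian groups on chains of length \<open>k\<close> above \<open>Q\<close>. A cochain for \<open>k = 0\<close> is
  an element of the limit of \<open>Y\<close>, the only chain of length 0 being \<open>[]\<close>.\<close>

definition cochain :: "('o, unit, 'x) presheaf \<Rightarrow> nat \<Rightarrow> ('o \<Rightarrow> ('o list \<Rightarrow>\<^sub>0 int) \<Rightarrow> 'x) \<Rightarrow> bool" where
  "cochain Y k \<Phi> \<longleftrightarrow> (\<forall>Q\<in>S. \<Phi> Q \<in> hom (free_Abelian_group (up_chains Q k)) (Val Y Q)) \<and>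
     (\<forall>Q\<in>S. \<forall>R\<in>S. r Q R \<longrightarrow> (\<forall>z. Poly_Mapping.keys z \<subseteq> up_chains R k \<longrightarrow> Res Y Q R () (\<Phi> R z) = \<Phi> Q z))"

definition cocycle :: "('o, unit, 'x) presheaf \<Rightarrow> nat \<Rightarrow> ('o \<Rightarrow> ('o list \<Rightarrow>\<^sub>0 int) \<Rightarrow> 'x) \<Rightarrow> bool" where
  "cocycle Y k \<Phi> \<longleftrightarrow> cochain Y k \<Phi> \<and>
     (\<forall>Q\<in>S. \<forall>w. Poly_Mapping.keys w \<subseteq> up_chains Q (Suc k) \<longrightarrow> \<Phi> Q (frag_extend bd w) = \<one>\<^bsub>Val Y Q\<^esub>)"

text \<open>Exactness of the augmented cochain complex. Length 0 is the limit itself, so at length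
  \<open>Suc k\<close> with \<open>k > 0\<close> the condition says that the \<open>k\<close>-th
  derived limit of \<open>Y\<close> vanishes.\<close>

definition acyclic :: "('o, unit, 'x) presheaf \<Rightarrow> bool" where
  "acyclic Y \<longleftrightarrow> (\<forall>k \<Phi>. cocycle Y (Suc k) \<Phi> \<longrightarrow> (\<exists>\<Psi>. cochain Y k \<Psi> \<and>
     (\<forall>Q\<in>S. \<forall>z. Poly_Mapping.keys z \<subseteq> up_chains Q (Suc k) \<longrightarrow> \<Psi> Q (frag_extend bd z) = \<Phi> Q z)))"

lemma up_mono: "Q \<in> S \<Longrightarrow> R \<in> S \<Longrightarrow> r Q R \<Longrightarrow> up R \<subseteq> up Q"
  unfolding up_def using trans by blast

lemma chains_mono: "A \<subseteq> B \<Longrightarrow> chains r A k \<subseteq> chains r B k"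
  by (auto simp: chains_def)

lemma up_chains_mono: "Q \<in> S \<Longrightarrow> R \<in> S \<Longrightarrow> r Q R \<Longrightarrow> up_chains R k \<subseteq> up_chains Q k"
  by (intro chains_mono up_mono)

text \<open>A nonempty chain above \<open>Q\<close> is also a chain above its head, from which it is
  induced along \<open>r Q (hd l)\<close>. The modules of nonempty chains are thus generated freely
  by chains placed at their heads.\<close>

lemma up_chains_hd:
  assumes "l \<in> up_chains Q (Suc k)"
  shows "hd l \<in> S" "r Q (hd l)" "l \<in> up_chains (hd l) (Suc k)"
proof -
  obtain a m where l: "l = a # m" using assms by (auto simp: chains_def length_Suc_conv)
  then show "hd l \<in> S" "r Q (hd l)" using assms by (auto simp: chains_def up_def)
  show "l \<in> up_chains (hd l) (Suc k)" using assms l refl by (auto simp: chains_def up_def)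
qed

lemma cochain_hom: "cochain Y k \<Phi> \<Longrightarrow> Q \<in> S \<Longrightarrow> \<Phi> Q \<in> hom (free_Abelian_group (up_chains Q k)) (Val Y Q)"
  by (simp add: cochain_def)

lemma cochain_closed:
  "cochain Y k \<Phi> \<Longrightarrow> Q \<in> S \<Longrightarrow> Poly_Mapping.keys z \<subseteq> up_chains Q k \<Longrightarrow> \<Phi> Q z \<in> carrier (Val Y Q)"
  using hom_in_carrier[OF cochain_hom, of Y k \<Phi> Q z] by simp

lemma cochain_Res:
  "cochain Y k \<Phi> \<Longrightarrow> Q \<in> S \<Longrightarrow> R \<in> S \<Longrightarrow> r Q R \<Longrightarrow> Poly_Mapping.keys z \<subseteq> up_chains R k
   \<Longrightarrow> Res Y Q R () (\<Phi> R z) = \<Phi> Q z"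
  by (simp add: cochain_def)

lemma cochain_group_hom:
  "cat_module (poset_category S r) Y \<Longrightarrow> cochain Y k \<Phi> \<Longrightarrow> Q \<in> S \<Longrightarrow>
   group_hom (free_Abelian_group (up_chains Q k)) (Val Y Q) (\<Phi> Q)"
  by (rule group_hom_of_comm[OF abelian_free_Abelian_group _ cochain_hom])
     (use cat_module.Val_comm_group[of "poset_category S r" Y Q] in auto)

lemma cochain_bd:
  assumes Y: "cat_module (poset_category S r) Y" and \<Phi>: "cochain Y k \<Phi>"
  shows "cocycle Y (Suc k) (\<lambda>Q z. \<Phi> Q (frag_extend bd z))"
  unfolding cocycle_def cochain_def
proof (intro conjI ballI impI allI)
  fix Q assume Q: "Q \<in> S"
  show "(\<lambda>z. \<Phi> Q (frag_extend bd z)) \<in> hom (free_Abelian_group (up_chains Q (Suc k))) (Val Y Q)"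
    using hom_compose[OF bd_hom cochain_hom[OF \<Phi> Q]] by (simp add: o_def)
  show "\<Phi> Q (frag_extend bd (frag_extend bd w)) = \<one>\<^bsub>Val Y Q\<^esub>" for w
    using group_hom.hom_one[OF cochain_group_hom[OF Y \<Phi> Q]] by (simp add: bd_bd_extend)
  show "Res Y Q R () (\<Phi> R (frag_extend bd z)) = \<Phi> Q (frag_extend bd z)"
    if "R \<in> S" "r Q R" "Poly_Mapping.keys z \<subseteq> up_chains R (Suc k)" for R z
    by (rule cochain_Res[OF \<Phi> Q that(1,2) bd_closed[OF that(3)]])
qed

lemma cochain_map:
  assumes \<eta>: "\<eta> \<in> module_hom (poset_category S r) Y Z" and \<Phi>: "cochain Y k \<Phi>"
  shows "cochain Z k (\<lambda>Q z. \<eta> Q (\<Phi> Q z))"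
  unfolding cochain_def
proof (intro conjI ballI impI allI)
  show "(\<lambda>z. \<eta> Q (\<Phi> Q z)) \<in> hom (free_Abelian_group (up_chains Q k)) (Val Z Q)" if "Q \<in> S" for Q
    using hom_compose[OF cochain_hom[OF \<Phi> that] module_homD[OF \<eta>, of Q]] that by (simp add: o_def)
  show "Res Z Q R () (\<eta> R (\<Phi> R z)) = \<eta> Q (\<Phi> Q z)"
    if "Q \<in> S" "R \<in> S" "r Q R" "Poly_Mapping.keys z \<subseteq> up_chains R k" for Q R z
    using module_hom_natural[OF \<eta>, of Q R "()" "\<Phi> R z"] that cochain_closed[OF \<Phi> that(2,4)] cochain_Res[OF \<Phi> that]
    by simp
qed

lemma cochain_diff:
  assumes Y: "cat_module (poset_category S r) Y" and \<Phi>: "cochain Y k \<Phi>" and \<Psi>: "cochain Y k \<Psi>"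
  shows "cochain Y k (\<lambda>Q z. \<Phi> Q z \<otimes>\<^bsub>Val Y Q\<^esub> inv\<^bsub>Val Y Q\<^esub> \<Psi> Q z)"
  unfolding cochain_def
proof (intro conjI ballI impI allI)
  fix Q assume Q: "Q \<in> S"
  interpret G: comm_group "Val Y Q" using cat_module.Val_comm_group[OF Y] Q by simp
  interpret f: group_hom "free_Abelian_group (up_chains Q k)" "Val Y Q" "\<Phi> Q" by (rule cochain_group_hom[OF Y \<Phi> Q])
  interpret g: group_hom "free_Abelian_group (up_chains Q k)" "Val Y Q" "\<Psi> Q" by (rule cochain_group_hom[OF Y \<Psi> Q])
  show "(\<lambda>z. \<Phi> Q z \<otimes>\<^bsub>Val Y Q\<^esub> inv\<^bsub>Val Y Q\<^esub> \<Psi> Q z) \<in> hom (free_Abelian_group (up_chains Q k)) (Val Y Q)"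
    using f.hom_mult g.hom_mult f.hom_closed g.hom_closed
    by (intro homI) (simp_all add: G.inv_mult G.m_ac)
  fix R and z :: "'o list \<Rightarrow>\<^sub>0 int" assume R: "R \<in> S" "r Q R" "Poly_Mapping.keys z \<subseteq> up_chains R k"
  interpret Rs: group_hom "Val Y R" "Val Y Q" "Res Y Q R ()"
    using Res_group_hom[OF Y, of Q R "()"] Q R by simp
  show "Res Y Q R () (\<Phi> R z \<otimes>\<^bsub>Val Y R\<^esub> inv\<^bsub>Val Y R\<^esub> \<Psi> R z) = \<Phi> Q z \<otimes>\<^bsub>Val Y Q\<^esub> inv\<^bsub>Val Y Q\<^esub> \<Psi> Q z"
    using cochain_Res[OF \<Phi> Q R] cochain_Res[OF \<Psi> Q R] cochain_closed[OF \<Phi> R(1,3)] cochain_closed[OF \<Psi> R(1,3)] by simp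
qed

lemma cochain_one:
  assumes Y: "cat_module (poset_category S r) Y"
  shows "cochain Y k (\<lambda>Q z. \<one>\<^bsub>Val Y Q\<^esub>)"
  unfolding cochain_def
proof (intro conjI ballI impI allI)
  fix Q assume Q: "Q \<in> S"
  interpret G: comm_group "Val Y Q" using cat_module.Val_comm_group[OF Y] Q by simp
  show "(\<lambda>z. \<one>\<^bsub>Val Y Q\<^esub>) \<in> hom (free_Abelian_group (up_chains Q k)) (Val Y Q)" by (simp add: hom_def)
  show "Res Y Q R () \<one>\<^bsub>Val Y R\<^esub> = \<one>\<^bsub>Val Y Q\<^esub>" if "R \<in> S" "r Q R" for R
    using group_hom.hom_one[OF Res_group_hom[OF Y, of Q R "()"]] Q that by simp
qed

lemma cochain_eq:
  assumes Y: "cat_module (poset_category S r) Y" and \<Phi>: "cochain Y (Suc k) \<Phi>" and \<Psi>: "cochain Y (Suc k) \<Psi>"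
    and eq: "\<And>Q l. Q \<in> S \<Longrightarrow> l \<in> up_chains Q (Suc k) \<Longrightarrow> hd l = Q \<Longrightarrow> \<Phi> Q (frag_of l) = \<Psi> Q (frag_of l)"
    and Q: "Q \<in> S" and z: "Poly_Mapping.keys z \<subseteq> up_chains Q (Suc k)"
  shows "\<Phi> Q z = \<Psi> Q z"
proof (rule hom_eq_on_free[OF _ cochain_hom[OF \<Phi> Q] cochain_hom[OF \<Psi> Q] _ z])
  show "group (Val Y Q)" using cat_module.Val_comm_group[OF Y, of Q] Q by (simp add: comm_group.axioms)
  fix l assume l: "l \<in> up_chains Q (Suc k)"
  note h = up_chains_hd[OF l]
  have k: "Poly_Mapping.keys (frag_of l) \<subseteq> up_chains (hd l) (Suc k)" using h(3) by simp
  show "\<Phi> Q (frag_of l) = \<Psi> Q (frag_of l)"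
    using cochain_Res[OF \<Phi> Q h(1,2) k] cochain_Res[OF \<Psi> Q h(1,2) k] eq[OF h(1,3)] by simp
qed

text \<open>The Yoneda lemma for these modules: values at the heads may be prescribed at will, and
  the value at \<open>Q\<close> is then forced to be the restriction from \<open>hd l\<close>.
  \<open>cochain_eq\<close> is the uniqueness half.\<close>

lemma cochain_exists:
  assumes Y: "cat_module (poset_category S r) Y"
    and \<phi>: "\<And>Q l. Q \<in> S \<Longrightarrow> l \<in> up_chains Q (Suc k) \<Longrightarrow> hd l = Q \<Longrightarrow> \<phi> l \<in> carrier (Val Y Q)"
  shows "\<exists>\<Phi>. cochain Y (Suc k) \<Phi> \<and> (\<forall>Q\<in>S. \<forall>l\<in>up_chains Q (Suc k). hd l = Q \<longrightarrow> \<Phi> Q (frag_of l) = \<phi> l)"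
proof -
  have c: "\<phi> l \<in> carrier (Val Y (hd l))" if "l \<in> up_chains Q (Suc k)" for Q l
    using \<phi>[OF up_chains_hd(1,3)[OF that]] by simp
  have R: "Res Y Q (hd l) () (\<phi> l) \<in> carrier (Val Y Q)" if "Q \<in> S" "l \<in> up_chains Q (Suc k)" for Q l
    using Res_closed[OF Y, of Q "hd l" "()"] c that up_chains_hd[OF that(2)] by simp
  have "\<exists>h\<in>hom (free_Abelian_group (up_chains Q (Suc k))) (Val Y Q).
      \<forall>l\<in>up_chains Q (Suc k). h (frag_of l) = Res Y Q (hd l) () (\<phi> l)" if Q: "Q \<in> S" for Q
  proof -
    interpret G: comm_group "Val Y Q" using cat_module.Val_comm_group[OF Y] Q by simp
    show ?thesis
      by (rule G.free_Abelian_group_universal[of "\<lambda>l. Res Y Q (hd l) () (\<phi> l)" "up_chains Q (Suc k)"])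
         (use R[OF Q] in auto)
  qed
  then obtain \<Phi> where h: "\<And>Q. Q \<in> S \<Longrightarrow> \<Phi> Q \<in> hom (free_Abelian_group (up_chains Q (Suc k))) (Val Y Q)"
    and l: "\<And>Q l. Q \<in> S \<Longrightarrow> l \<in> up_chains Q (Suc k) \<Longrightarrow> \<Phi> Q (frag_of l) = Res Y Q (hd l) () (\<phi> l)"
    by metis
  have "cochain Y (Suc k) \<Phi>"
    unfolding cochain_def
  proof (intro conjI ballI impI allI)
    fix Q R and z :: "'o list \<Rightarrow>\<^sub>0 int" assume QR: "Q \<in> S" "R \<in> S" "r Q R" and z: "Poly_Mapping.keys z \<subseteq> up_chains R (Suc k)"
    note sub = up_chains_mono[OF QR, of "Suc k"]
    have "(\<lambda>z. Res Y Q R () (\<Phi> R z)) \<in> hom (free_Abelian_group (up_chains R (Suc k))) (Val Y Q)"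
      using hom_compose[OF h[OF QR(2)] cat_module.Res_hom[OF Y, of Q R "()"]] QR by (simp add: o_def)
    moreover have "\<Phi> Q \<in> hom (free_Abelian_group (up_chains R (Suc k))) (Val Y Q)"
      using h[OF QR(1)] sub by (auto simp: hom_def Pi_iff)
    moreover have "Res Y Q R () (\<Phi> R (frag_of m)) = \<Phi> Q (frag_of m)" if m: "m \<in> up_chains R (Suc k)" for m
      using l[OF QR(2) m] l[OF QR(1), of m] m sub up_chains_hd[OF m] QR
        cat_module.Res_Cmp[OF Y, of Q R "hd m" "()" "()" "\<phi> m"] c[OF m] by auto
    ultimately show "Res Y Q R () (\<Phi> R z) = \<Phi> Q z"
      using z cat_module.Val_comm_group[OF Y, of Q] QR
      by (intro hom_eq_on_free[of "Val Y Q" "\<lambda>z. Res Y Q R () (\<Phi> R z)" "up_chains R (Suc k)" "\<Phi> Q" z])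
         (auto simp: comm_group.axioms)
  qed (fact h)
  moreover have "\<Phi> Q (frag_of m) = \<phi> m" if "Q \<in> S" "m \<in> up_chains Q (Suc k)" "hd m = Q" for Q m
    using l[OF that(1,2)] cat_module.Res_Idn[OF Y, of Q "\<phi> m"] c[OF that(2)] that by simp
  ultimately show ?thesis by blast
qed

end

section \<open>Dimension shifting over a poset\<close>

locale exact_poset_complex = poset S r for S :: "'o set" and r +
  fixes E :: "nat \<Rightarrow> ('o, unit, 'x) presheaf" and \<delta>
  assumes module: "cat_module (poset_category S r) (E n)"
    and diff_hom: "\<delta> n \<in> module_hom (poset_category S r) (E n) (E (Suc n))"
    and exact_0: "\<lbrakk>Q \<in> S; x \<in> carrier (Val (E 0) Q); \<delta> 0 Q x = \<one>\<^bsub>Val (E (Suc 0)) Q\<^esub>\<rbrakk> \<Longrightarrow> x = \<one>\<^bsub>Val (E 0) Q\<^esub>"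
    and exact: "\<lbrakk>Q \<in> S; x \<in> carrier (Val (E (Suc n)) Q); \<delta> (Suc n) Q x = \<one>\<^bsub>Val (E (Suc (Suc n))) Q\<^esub>\<rbrakk>
        \<Longrightarrow> \<exists>y\<in>carrier (Val (E n) Q). x = \<delta> n Q y"
    and diff_diff: "\<lbrakk>Q \<in> S; x \<in> carrier (Val (E n) Q)\<rbrakk> \<Longrightarrow> \<delta> (Suc n) Q (\<delta> n Q x) = \<one>\<^bsub>Val (E (Suc (Suc n))) Q\<^esub>"
    and acyclic: "acyclic (E n)"
begin

text \<open>The cocycles \<open>Z n\<close> of the complex are acyclic since \<open>Z (n + 1)\<close> is the cokernel of \<open>Z n \<rightarrow> E n\<close>.\<close>

definition kernel_acyclic :: "nat \<Rightarrow> bool" where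
  "kernel_acyclic n \<longleftrightarrow> (\<forall>k \<Phi>. cocycle (E n) (Suc k) \<Phi> \<and>
     (\<forall>Q\<in>S. \<forall>z. Poly_Mapping.keys z \<subseteq> up_chains Q (Suc k) \<longrightarrow> \<delta> n Q (\<Phi> Q z) = \<one>\<^bsub>Val (E (Suc n)) Q\<^esub>) \<longrightarrow>
     (\<exists>\<Psi>. cochain (E n) k \<Psi> \<and>
       (\<forall>Q\<in>S. \<forall>z. Poly_Mapping.keys z \<subseteq> up_chains Q k \<longrightarrow> \<delta> n Q (\<Psi> Q z) = \<one>\<^bsub>Val (E (Suc n)) Q\<^esub>) \<and>
       (\<forall>Q\<in>S. \<forall>z. Poly_Mapping.keys z \<subseteq> up_chains Q (Suc k) \<longrightarrow> \<Psi> Q (frag_extend bd z) = \<Phi> Q z)))"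

lemma diff_group_hom: "Q \<in> S \<Longrightarrow> group_hom (Val (E n) Q) (Val (E (Suc n)) Q) (\<delta> n Q)"
  by (rule module_hom_group_hom[OF module module diff_hom]) simp

text \<open>The induction starts here: by \<open>exact_0\<close> the first kernel is zero, which
  reflects that the module resolved by the complex vanishes on \<open>S\<close>.\<close>

lemma kernel_acyclic_0: "kernel_acyclic 0"
  unfolding kernel_acyclic_def
proof (intro allI impI, elim conjE)
  fix k \<Phi>
  assume \<Phi>: "cocycle (E 0) (Suc k) \<Phi>"
    and d: "\<forall>Q\<in>S. \<forall>z. Poly_Mapping.keys z \<subseteq> up_chains Q (Suc k) \<longrightarrow> \<delta> 0 Q (\<Phi> Q z) = \<one>\<^bsub>Val (E (Suc 0)) Q\<^esub>"
  have "\<Phi> Q z = \<one>\<^bsub>Val (E 0) Q\<^esub>" if "Q \<in> S" "Poly_Mapping.keys z \<subseteq> up_chains Q (Suc k)" for Q z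
    using exact_0[OF that(1) cochain_closed[of "E 0" "Suc k" \<Phi> Q z]] \<Phi> d that by (simp add: cocycle_def)
  then show "\<exists>\<Psi>. cochain (E 0) k \<Psi> \<and>
       (\<forall>Q\<in>S. \<forall>z. Poly_Mapping.keys z \<subseteq> up_chains Q k \<longrightarrow> \<delta> 0 Q (\<Psi> Q z) = \<one>\<^bsub>Val (E (Suc 0)) Q\<^esub>) \<and>
       (\<forall>Q\<in>S. \<forall>z. Poly_Mapping.keys z \<subseteq> up_chains Q (Suc k) \<longrightarrow> \<Psi> Q (frag_extend bd z) = \<Phi> Q z)"
    using cochain_one[OF module[of 0], of k] group_hom.hom_one[OF diff_group_hom]
    by (intro exI[of _ "\<lambda>Q z. \<one>\<^bsub>Val (E 0) Q\<^esub>"]) simp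
qed

text \<open>A chase along Z n, E n, Z (n + 1), where Z denotes the kernels of \<delta>. A lift
  \<open>e\<close> of \<Phi> to \<open>E n\<close> need not be a cocycle, but its coboundary has
  values in Z n and there it is the coboundary of some \<open>z'\<close>. The lift corrected by
  \<open>z'\<close> is a cocycle of the acyclic module \<open>E n\<close>, hence the coboundary of
  \<open>w\<close>.\<close>

lemma cocycle_lift:
  assumes ka: "kernel_acyclic n" and \<Phi>: "cocycle (E (Suc n)) (Suc k) \<Phi>"
    and d: "\<And>Q z. Q \<in> S \<Longrightarrow> Poly_Mapping.keys z \<subseteq> up_chains Q (Suc k) \<Longrightarrow> \<delta> (Suc n) Q (\<Phi> Q z) = \<one>\<^bsub>Val (E (Suc (Suc n))) Q\<^esub>"
  shows "\<exists>w. cochain (E n) k w \<and>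
    (\<forall>Q\<in>S. \<forall>z. Poly_Mapping.keys z \<subseteq> up_chains Q (Suc k) \<longrightarrow> \<Phi> Q z = \<delta> n Q (w Q (frag_extend bd z)))"
proof -
  have \<Phi>c: "cochain (E (Suc n)) (Suc k) \<Phi>" using \<Phi> by (simp add: cocycle_def)
  \<comment> \<open>Preimages under \<open>\<delta> n\<close> are chosen only for chains at their
    heads; independent choices at every \<open>Q\<close> would not be natural.\<close>
  define \<phi> where "\<phi> = (\<lambda>l. SOME y. y \<in> carrier (Val (E n) (hd l)) \<and> \<Phi> (hd l) (frag_of l) = \<delta> n (hd l) y)"
  have \<phi>: "\<phi> l \<in> carrier (Val (E n) Q) \<and> \<Phi> Q (frag_of l) = \<delta> n Q (\<phi> l)"
    if Q: "Q \<in> S" and l: "l \<in> up_chains Q (Suc k)" "hd l = Q" for Q l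
  proof -
    have k: "Poly_Mapping.keys (frag_of l) \<subseteq> up_chains Q (Suc k)" using l by simp
    have "\<exists>y. y \<in> carrier (Val (E n) (hd l)) \<and> \<Phi> (hd l) (frag_of l) = \<delta> n (hd l) y"
      unfolding l(2) using exact[OF Q cochain_closed[OF \<Phi>c Q k] d[OF Q k]] by blast
    from someI_ex[OF this] show ?thesis unfolding \<phi>_def l(2) .
  qed
  have "\<exists>e. cochain (E n) (Suc k) e \<and> (\<forall>Q\<in>S. \<forall>l\<in>up_chains Q (Suc k). hd l = Q \<longrightarrow> e Q (frag_of l) = \<phi> l)"
    by (rule cochain_exists[OF module]) (use \<phi> in blast)
  then obtain e where e: "cochain (E n) (Suc k) e"
    and el: "\<And>Q l. Q \<in> S \<Longrightarrow> l \<in> up_chains Q (Suc k) \<Longrightarrow> hd l = Q \<Longrightarrow> e Q (frag_of l) = \<phi> l" by blast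
  have \<delta>e: "\<delta> n Q (e Q z) = \<Phi> Q z" if Q: "Q \<in> S" and z: "Poly_Mapping.keys z \<subseteq> up_chains Q (Suc k)" for Q z
    by (rule cochain_eq[OF module cochain_map[OF diff_hom e] \<Phi>c _ Q z]) (use \<phi> el in simp)
  have c1: "cocycle (E n) (Suc (Suc k)) (\<lambda>Q z. e Q (frag_extend bd z))" by (rule cochain_bd[OF module e])
  have c2: "\<forall>Q\<in>S. \<forall>z. Poly_Mapping.keys z \<subseteq> up_chains Q (Suc (Suc k)) \<longrightarrow> \<delta> n Q (e Q (frag_extend bd z)) = \<one>\<^bsub>Val (E (Suc n)) Q\<^esub>"
    using \<Phi> by (auto simp: cocycle_def \<delta>e[OF _ bd_closed])
  from ka[unfolded kernel_acyclic_def, THEN spec, THEN spec, THEN mp, OF conjI[OF c1 c2]]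
  obtain z' where z': "cochain (E n) (Suc k) z'"
    and \<delta>z': "\<And>Q z. Q \<in> S \<Longrightarrow> Poly_Mapping.keys z \<subseteq> up_chains Q (Suc k) \<Longrightarrow> \<delta> n Q (z' Q z) = \<one>\<^bsub>Val (E (Suc n)) Q\<^esub>"
    and z'bd: "\<And>Q z. Q \<in> S \<Longrightarrow> Poly_Mapping.keys z \<subseteq> up_chains Q (Suc (Suc k)) \<Longrightarrow> z' Q (frag_extend bd z) = e Q (frag_extend bd z)"
    by (elim exE conjE) (rule that, assumption, simp, simp)
  \<comment> \<open>Still a lift of \<Phi>, since \<open>z'\<close> is killed by
    \<open>\<delta> n\<close>.\<close>
  let ?x = "\<lambda>Q z. e Q z \<otimes>\<^bsub>Val (E n) Q\<^esub> inv\<^bsub>Val (E n) Q\<^esub> z' Q z"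
  have x: "cocycle (E n) (Suc k) ?x"
    unfolding cocycle_def
  proof (intro conjI ballI allI impI)
    show "cochain (E n) (Suc k) ?x" by (rule cochain_diff[OF module e z'])
    fix Q and w :: "'o list \<Rightarrow>\<^sub>0 int" assume Q: "Q \<in> S" and w: "Poly_Mapping.keys w \<subseteq> up_chains Q (Suc (Suc k))"
    interpret G: comm_group "Val (E n) Q" using cat_module.Val_comm_group[OF module, of Q] Q by simp
    show "?x Q (frag_extend bd w) = \<one>\<^bsub>Val (E n) Q\<^esub>"
      using z'bd[OF Q w] cochain_closed[OF e Q bd_closed[OF w]] by simp
  qed
  from acyclic[of n, unfolded acyclic_def, THEN spec, THEN spec, THEN mp, OF x]
  obtain w where w: "cochain (E n) k w"
    and wbd: "\<And>Q z. Q \<in> S \<Longrightarrow> Poly_Mapping.keys z \<subseteq> up_chains Q (Suc k) \<Longrightarrow> w Q (frag_extend bd z) = ?x Q z"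
    by (elim exE conjE) (rule that, assumption, simp)
  have "\<Phi> Q z = \<delta> n Q (w Q (frag_extend bd z))" if Q: "Q \<in> S" and z: "Poly_Mapping.keys z \<subseteq> up_chains Q (Suc k)" for Q z
  proof -
    interpret D: group_hom "Val (E n) Q" "Val (E (Suc n)) Q" "\<delta> n Q" by (rule diff_group_hom[OF Q])
    show ?thesis
      using wbd[OF Q z] \<delta>e[OF Q z] \<delta>z'[OF Q z] cochain_closed[OF e Q z] cochain_closed[OF z' Q z] cochain_closed[OF \<Phi>c Q z] by simp
  qed
  then show ?thesis using w by blast
qed

lemma kernel_acyclic: "kernel_acyclic n"
proof (induction n)
  case 0 show ?case by (rule kernel_acyclic_0)
next
  case (Suc n)
  show ?case
    unfolding kernel_acyclic_def
  proof (intro allI impI, elim conjE)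
    fix k \<Phi>
    assume \<Phi>: "cocycle (E (Suc n)) (Suc k) \<Phi>"
      and d: "\<forall>Q\<in>S. \<forall>z. Poly_Mapping.keys z \<subseteq> up_chains Q (Suc k) \<longrightarrow> \<delta> (Suc n) Q (\<Phi> Q z) = \<one>\<^bsub>Val (E (Suc (Suc n))) Q\<^esub>"
    have "\<exists>w. cochain (E n) k w \<and>
      (\<forall>Q\<in>S. \<forall>z. Poly_Mapping.keys z \<subseteq> up_chains Q (Suc k) \<longrightarrow> \<Phi> Q z = \<delta> n Q (w Q (frag_extend bd z)))"
      by (rule cocycle_lift[OF Suc \<Phi>]) (use d in blast)
    then obtain w where w: "cochain (E n) k w"
      and \<Phi>w: "\<And>Q z. Q \<in> S \<Longrightarrow> Poly_Mapping.keys z \<subseteq> up_chains Q (Suc k) \<Longrightarrow> \<Phi> Q z = \<delta> n Q (w Q (frag_extend bd z))"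
      by blast
    show "\<exists>\<Psi>. cochain (E (Suc n)) k \<Psi> \<and>
       (\<forall>Q\<in>S. \<forall>z. Poly_Mapping.keys z \<subseteq> up_chains Q k \<longrightarrow> \<delta> (Suc n) Q (\<Psi> Q z) = \<one>\<^bsub>Val (E (Suc (Suc n))) Q\<^esub>) \<and>
       (\<forall>Q\<in>S. \<forall>z. Poly_Mapping.keys z \<subseteq> up_chains Q (Suc k) \<longrightarrow> \<Psi> Q (frag_extend bd z) = \<Phi> Q z)"
      using cochain_map[OF diff_hom w] \<Phi>w diff_diff[OF _ cochain_closed[OF w]]
      by (intro exI[of _ "\<lambda>Q z. \<delta> n Q (w Q z)"]) simp
  qed
qed

lemma chains_0: "chains r A 0 = {[]}"
  by (auto simp: chains_def)

lemma lim_poset_exact_0: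
  assumes t: "t \<in> carrier (inv_lim (poset_category S r) (E 0))"
    and d: "\<And>Q. Q \<in> S \<Longrightarrow> \<delta> 0 Q (t Q) = \<one>\<^bsub>Val (E (Suc 0)) Q\<^esub>" and Q: "Q \<in> S"
  shows "t Q = \<one>\<^bsub>Val (E 0) Q\<^esub>"
  using exact_0[OF Q _ d[OF Q]] inv_lim_component[OF t] Q by simp

text \<open>An element \<open>t\<close> of the limit is a cochain \<open>T\<close> of length 0. Its
  coboundary has length 1, where \<open>cocycle_lift\<close> applies, and evaluation on the
  one-vertex chain \<open>[Q]\<close>, whose boundary is \<open>[]\<close>, recovers
  \<open>t Q\<close>.\<close>

theorem lim_poset_exact:
  assumes t: "t \<in> carrier (inv_lim (poset_category S r) (E (Suc n)))"
    and d: "\<And>Q. Q \<in> S \<Longrightarrow> \<delta> (Suc n) Q (t Q) = \<one>\<^bsub>Val (E (Suc (Suc n))) Q\<^esub>"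
  shows "\<exists>u\<in>carrier (inv_lim (poset_category S r) (E n)). \<forall>Q\<in>S. t Q = \<delta> n Q (u Q)"
proof -
  have tc: "t Q \<in> carrier (Val (E (Suc n)) Q)" if "Q \<in> S" for Q using inv_lim_component[OF t] that by simp
  have "\<exists>h\<in>hom (free_Abelian_group (up_chains Q 0)) (Val (E (Suc n)) Q). h (frag_of []) = t Q" if Q: "Q \<in> S" for Q
  proof -
    interpret G: comm_group "Val (E (Suc n)) Q" using cat_module.Val_comm_group[OF module, of Q] Q by simp
    show ?thesis
      by (rule G.free_Abelian_group_universal[of "\<lambda>_. t Q" "up_chains Q 0"]) (use tc[OF Q] in \<open>auto simp: chains_0\<close>)
  qed
  then obtain T where T: "\<And>Q. Q \<in> S \<Longrightarrow> T Q \<in> hom (free_Abelian_group (up_chains Q 0)) (Val (E (Suc n)) Q)"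
    and Tt: "\<And>Q. Q \<in> S \<Longrightarrow> T Q (frag_of []) = t Q" by metis
  have Tc: "cochain (E (Suc n)) 0 T"
    unfolding cochain_def
  proof (intro conjI ballI impI allI)
    fix Q R and z :: "'o list \<Rightarrow>\<^sub>0 int"
    assume QR: "Q \<in> S" "R \<in> S" "r Q R" and z: "Poly_Mapping.keys z \<subseteq> up_chains R 0"
    have "(\<lambda>z. Res (E (Suc n)) Q R () (T R z)) \<in> hom (free_Abelian_group {[]}) (Val (E (Suc n)) Q)"
      using hom_compose[OF T[OF QR(2)] cat_module.Res_hom[OF module, of Q R "()"]] QR by (simp add: o_def chains_0)
    moreover have "T Q \<in> hom (free_Abelian_group {[]}) (Val (E (Suc n)) Q)" using T[OF QR(1)] by (simp add: chains_0)
    ultimately show "Res (E (Suc n)) Q R () (T R z) = T Q z"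
      using z cat_module.Val_comm_group[OF module, of Q] QR inv_lim_Res[OF t, of Q R "()"]
      by (intro hom_eq_on_free[of "Val (E (Suc n)) Q" "\<lambda>z. Res (E (Suc n)) Q R () (T R z)" "{[]}" "T Q" z])
         (auto simp: comm_group.axioms chains_0 Tt)
  qed (fact T)
  have dT: "\<delta> (Suc n) Q (T Q z) = \<one>\<^bsub>Val (E (Suc (Suc n))) Q\<^esub>" if Q: "Q \<in> S" and z: "Poly_Mapping.keys z \<subseteq> up_chains Q 0" for Q z
  proof (rule hom_eq_on_free[OF _ cochain_hom[OF cochain_map[OF diff_hom Tc] Q] cochain_hom[OF cochain_one[OF module] Q] _ z])
    show "group (Val (E (Suc (Suc n))) Q)" using cat_module.Val_comm_group[OF module, of Q] Q by (simp add: comm_group.axioms)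
  qed (use d[OF Q] Tt[OF Q] in \<open>simp add: chains_0\<close>)
  have "\<exists>w. cochain (E n) 0 w \<and>
    (\<forall>Q\<in>S. \<forall>z. Poly_Mapping.keys z \<subseteq> up_chains Q (Suc 0) \<longrightarrow> T Q (frag_extend bd z) = \<delta> n Q (w Q (frag_extend bd z)))"
    by (rule cocycle_lift[OF kernel_acyclic cochain_bd[OF module Tc]]) (use dT bd_closed in blast)
  then obtain w where w: "cochain (E n) 0 w"
    and Tw: "\<And>Q z. Q \<in> S \<Longrightarrow> Poly_Mapping.keys z \<subseteq> up_chains Q (Suc 0) \<Longrightarrow> T Q (frag_extend bd z) = \<delta> n Q (w Q (frag_extend bd z))"
    by blast
  define u where "u = (\<lambda>Q\<in>S. w Q (frag_of []))"
  have k: "Poly_Mapping.keys (frag_of []) \<subseteq> up_chains Q 0" for Q by (simp add: chains_0)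
  have "u \<in> carrier (inv_lim (poset_category S r) (E n))"
    unfolding inv_lim_iff using cochain_closed[OF w _ k] cochain_Res[OF w _ _ _ k] by (auto simp: u_def)
  moreover have "t Q = \<delta> n Q (u Q)" if Q: "Q \<in> S" for Q
  proof -
    have "[Q] \<in> up_chains Q (Suc 0)" using Q refl by (simp add: chains_def up_def)
    then show ?thesis using Tw[OF Q, of "frag_of [Q]"] Q Tt by (simp add: u_def)
  qed
  ultimately show ?thesis by blast
qed

end

section \<open>Directed systems of objects with a common target\<close>

lemma hom_free_subset:
  assumes "f \<in> hom (free_Abelian_group T) G" "S \<subseteq> T" shows "f \<in> hom (free_Abelian_group S) G"
proof (rule homI)
  fix x y assume xy: "x \<in> carrier (free_Abelian_group S)" "y \<in> carrier (free_Abelian_group S)"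
  then have "x \<in> carrier (free_Abelian_group T)" "y \<in> carrier (free_Abelian_group T)" using assms(2) by auto
  from hom_in_carrier[OF assms(1) this(1)] hom_mult[OF assms(1) this]
  show "f x \<in> carrier G" "f (x \<otimes>\<^bsub>free_Abelian_group S\<^esub> y) = f x \<otimes>\<^bsub>G\<^esub> f y" by simp_all
qed

text \<open>A diagram of objects over \<open>P\<close>. The axiom \<open>directed\<close> says that
  arrows from \<open>c\<close> into the diagram with equal composites to \<open>P\<close> become
  equal at a later stage: the colimit of the sets \<open>Arr C c Q\<close> injects into
  \<open>Arr C c P\<close>. Surjectivity is left to a separate hypothesis, as it is available for
  some \<open>c\<close> only.\<close>

locale directed_system = small_category C + poset S r
  for C :: "('o, 'a) cat" and S :: "'o set" and r +
  fixes u :: "'o \<Rightarrow> 'o \<Rightarrow> 'a" and v :: "'o \<Rightarrow> 'a" and P :: 'o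
  assumes S_Obj: "Q \<in> S \<Longrightarrow> Q \<in> Obj C"
    and P_Obj: "P \<in> Obj C"
    and u_Arr: "\<lbrakk>Q \<in> S; R \<in> S; r Q R\<rbrakk> \<Longrightarrow> u Q R \<in> Arr C Q R"
    and v_Arr: "Q \<in> S \<Longrightarrow> v Q \<in> Arr C Q P"
    and u_refl: "Q \<in> S \<Longrightarrow> u Q Q = Idn C Q"
    and u_comp: "\<lbrakk>Q \<in> S; R \<in> S; T \<in> S; r Q R; r R T\<rbrakk> \<Longrightarrow> Cmp C (u R T) (u Q R) = u Q T"
    and v_comp: "\<lbrakk>Q \<in> S; R \<in> S; r Q R\<rbrakk> \<Longrightarrow> Cmp C (v R) (u Q R) = v Q"
    and directed: "\<lbrakk>c \<in> Obj C; Q \<in> S; R \<in> S; f \<in> Arr C c Q; g \<in> Arr C c R; Cmp C (v Q) f = Cmp C (v R) g\<rbrakk>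
        \<Longrightarrow> \<exists>T\<in>S. r Q T \<and> r R T \<and> Cmp C (u Q T) f = Cmp C (u R T) g"
begin

definition pull :: "('o, 'a, 'x) presheaf \<Rightarrow> ('o, unit, 'x) presheaf" where
  "pull Y = \<lparr>Val = Val Y, Res = (\<lambda>Q R _. Res Y Q R (u Q R))\<rparr>"

lemma pull_simps [simp]: "Val (pull Y) = Val Y" "Res (pull Y) Q R i = Res Y Q R (u Q R)"
  by (simp_all add: pull_def)

lemma pull_module:
  assumes "cat_module C Y" shows "cat_module (poset_category S r) (pull Y)"
proof (rule cat_module.intro; simp)
  show "comm_group (Val Y c)" if "c \<in> S" for c using cat_module.Val_comm_group[OF assms S_Obj[OF that]] .
  show "Res Y c d (u c d) \<in> hom (Val Y d) (Val Y c)" if "c \<in> S" "d \<in> S" "r c d" for c d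
    using cat_module.Res_hom[OF assms S_Obj S_Obj u_Arr] that by blast
  show "Res Y c c (u c c) x = x" if "c \<in> S" "x \<in> carrier (Val Y c)" for c x
    using cat_module.Res_Idn[OF assms S_Obj] that u_refl by simp
  show "Res Y b d (u b d) x = Res Y b c (u b c) (Res Y c d (u c d) x)"
    if "b \<in> S" "c \<in> S" "d \<in> S" "r b c" "r c d" "x \<in> carrier (Val Y d)" for b c d x
    using cat_module.Res_Cmp[OF assms, of b c d "u b c" "u c d" x] that u_comp[of b c d] u_Arr S_Obj by simp
qed

lemma pull_hom: "\<eta> \<in> module_hom C Y Z \<Longrightarrow> \<eta> \<in> module_hom (poset_category S r) (pull Y) (pull Z)"
  using S_Obj u_Arr by (auto simp: module_hom_def)

section \<open>Posets of lifts of an arrow to \<open>P\<close>\<close>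

text \<open>The elements of the colimit of the sets \<open>Arr C c Q\<close> that represent the arrow \<open>h\<close> from \<open>c\<close> to \<open>P\<close>.\<close>

definition lifts :: "'o \<Rightarrow> 'a \<Rightarrow> ('o \<times> 'a) set" where
  "lifts c h = {(Q, f). Q \<in> S \<and> f \<in> Arr C c Q \<and> Cmp C (v Q) f = h}"

text \<open>As in a category of elements, the arrow of the larger lift is determined by that of the
  smaller one.\<close>

definition lift_le :: "'o \<times> 'a \<Rightarrow> 'o \<times> 'a \<Rightarrow> bool" where
  "lift_le a b \<longleftrightarrow> r (fst a) (fst b) \<and> snd b = Cmp C (u (fst a) (fst b)) (snd a)"

lemma u_comp_arrow:
  assumes "c \<in> Obj C" "Q \<in> S" "R \<in> S" "T \<in> S" "r Q R" "r R T" "f \<in> Arr C c Q"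
  shows "Cmp C (u R T) (Cmp C (u Q R) f) = Cmp C (u Q T) f"
  using Cmp_assoc[of c Q R T f "u Q R" "u R T"] u_comp[of Q R T] assms S_Obj u_Arr by simp

lemma v_comp_arrow:
  assumes "c \<in> Obj C" "Q \<in> S" "R \<in> S" "r Q R" "f \<in> Arr C c Q"
  shows "Cmp C (v R) (Cmp C (u Q R) f) = Cmp C (v Q) f"
  using Cmp_assoc[of c Q R P f "u Q R" "v R"] v_comp[of Q R] assms S_Obj u_Arr v_Arr P_Obj by simp

lemma u_arrow:
  assumes "c \<in> Obj C" "Q \<in> S" "R \<in> S" "r Q R" "f \<in> Arr C c Q"
  shows "Cmp C (u Q R) f \<in> Arr C c R"
  using Cmp_in_Arr[of c Q R f "u Q R"] assms S_Obj u_Arr by simp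

lemma lifts_trans:
  assumes "c \<in> Obj C" "a \<in> lifts c h" "b \<in> lifts c h" "e \<in> lifts c h" "lift_le a b" "lift_le b e"
  shows "lift_le a e"
  using assms u_comp_arrow[of c "fst a" "fst b" "fst e" "snd a"] trans[of "fst a" "fst b" "fst e"]
  by (auto simp: lifts_def lift_le_def)

lemma lifts_directed:
  assumes c: "c \<in> Obj C" and "a \<in> lifts c h" "b \<in> lifts c h"
  shows "\<exists>e\<in>lifts c h. lift_le a e \<and> lift_le b e"
proof -
  obtain Q f R g where ab: "a = (Q, f)" "b = (R, g)" by (metis surj_pair)
  then have QR: "Q \<in> S" "R \<in> S" "f \<in> Arr C c Q" "g \<in> Arr C c R" "Cmp C (v Q) f = h" "Cmp C (v R) g = h"
    using assms by (auto simp: lifts_def)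
  then obtain T where T: "T \<in> S" "r Q T" "r R T" "Cmp C (u Q T) f = Cmp C (u R T) g"
    using directed[OF c QR(1-4)] by auto
  have "(T, Cmp C (u Q T) f) \<in> lifts c h"
    using u_arrow[OF c QR(1) T(1,2) QR(3)] v_comp_arrow[OF c QR(1) T(1,2) QR(3)] QR T by (simp add: lifts_def)
  then show ?thesis using T by (intro bexI) (auto simp: lift_le_def ab)
qed

text \<open>Pushes \<open>f\<close> forward to every vertex of a chain above \<open>Q\<close>;
  \<open>map fst\<close> undoes it.\<close>

definition lift_chain :: "'o \<Rightarrow> 'a \<Rightarrow> 'o list \<Rightarrow> ('o \<times> 'a) list" where
  "lift_chain Q f = map (\<lambda>R. (R, Cmp C (u Q R) f))"

lemma lift_chain_in:
  assumes c: "c \<in> Obj C" and Q: "Q \<in> S" and f: "f \<in> Arr C c Q" and l: "l \<in> up_chains Q k"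
  shows "lift_chain Q f l \<in> chains lift_le (lifts c (Cmp C (v Q) f)) k"
proof -
  have up: "R \<in> S \<and> r Q R" if "R \<in> set l" for R using l that by (auto simp: chains_def up_def)
  have "sorted_wrt r l" using l by (simp add: chains_def)
  then have "sorted_wrt (\<lambda>R T. lift_le (R, Cmp C (u Q R) f) (T, Cmp C (u Q T) f)) l"
  proof (rule sorted_wrt_mono_rel[rotated])
    fix R T assume "R \<in> set l" "T \<in> set l" "r R T"
    then show "lift_le (R, Cmp C (u Q R) f) (T, Cmp C (u Q T) f)"
      using u_comp_arrow[OF c Q _ _ _ _ f, of R T] up[of R] up[of T] by (simp add: lift_le_def)
  qed
  moreover have "(R, Cmp C (u Q R) f) \<in> lifts c (Cmp C (v Q) f)" if "R \<in> set l" for R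
    using l that u_arrow[OF c Q _ _ f] v_comp_arrow[OF c Q _ _ f] by (auto simp: chains_def up_def lifts_def)
  ultimately show ?thesis using l by (auto simp: lift_chain_def chains_def sorted_wrt_map)
qed

text \<open>The component of a cochain at \<open>(c, f)\<close> belongs to the lift
  \<open>(Q, f)\<close> of one arrow \<open>h\<close> from \<open>c\<close> to \<open>P\<close>. For
  fixed \<open>c\<close> and \<open>h\<close> these components form a cochain on the poset
  \<open>lifts c h\<close> with constant coefficients \<open>D c\<close>. That poset is directed and
  \<open>D c\<close> is divisible, so the cocycle is a coboundary for each \<open>c\<close> and
  \<open>h\<close>, and the solutions are reassembled.\<close>

lemma coind_acyclic:
  fixes D :: "'o \<Rightarrow> ('o \<times> 'a, 'm) univ monoid"
  assumes D: "\<And>c. c \<in> Obj C \<Longrightarrow> divisible_group (D c)"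
  shows "acyclic (pull (coind C D))"
  unfolding acyclic_def
proof (intro allI impI)
  fix k \<Phi>
  assume \<Phi>: "cocycle (pull (coind C D)) (Suc k) \<Phi>"
  let ?Y = "coind C D"
  have Dc: "comm_group (D c)" "group (D c)" if "c \<in> Obj C" for c
    using D[OF that] by (simp_all add: divisible_group_def comm_group.axioms)
  have Y: "cat_module C ?Y" by (rule coind_cat_module[OF small_category_axioms Dc(1)])
  have \<Phi>c: "cochain (pull ?Y) (Suc k) \<Phi>"
    and \<Phi>1: "\<And>Q w. Q \<in> S \<Longrightarrow> Poly_Mapping.keys w \<subseteq> up_chains Q (Suc (Suc k)) \<Longrightarrow> \<Phi> Q (frag_extend bd w) = \<one>\<^bsub>Val ?Y Q\<^esub>"
    using \<Phi> by (auto simp: cocycle_def)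
  have comp_hom: "(\<lambda>z. unFam (\<Phi> Q z) (c, f)) \<in> hom (free_Abelian_group (up_chains Q (Suc k))) (D c)"
    if "c \<in> Obj C" "Q \<in> S" "f \<in> Arr C c Q" for c Q f
  proof (rule homI)
    fix x y assume xy: "x \<in> carrier (free_Abelian_group (up_chains Q (Suc k)))" "y \<in> carrier (free_Abelian_group (up_chains Q (Suc k)))"
    show "unFam (\<Phi> Q (x \<otimes>\<^bsub>free_Abelian_group (up_chains Q (Suc k))\<^esub> y)) (c, f) = unFam (\<Phi> Q x) (c, f) \<otimes>\<^bsub>D c\<^esub> unFam (\<Phi> Q y) (c, f)"
      using hom_mult[OF cochain_hom[OF \<Phi>c that(2)] xy] by (simp add: coind_mult[OF that(1,3)])
    show "unFam (\<Phi> Q x) (c, f) \<in> carrier (D c)"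
      using cochain_closed[OF \<Phi>c that(2), of x] xy(1) coind_component[OF _ that(1,3)] by simp
  qed
  have "\<exists>\<psi>\<in>hom (free_Abelian_group (chains lift_le (lifts c h) k)) (D c).
      \<forall>Q f z. Q \<in> S \<and> f \<in> Arr C c Q \<and> Cmp C (v Q) f = h \<and> Poly_Mapping.keys z \<subseteq> up_chains Q (Suc k) \<longrightarrow>
        \<psi> (frag_extend (\<lambda>l. frag_of (lift_chain Q f l)) (frag_extend bd z)) = unFam (\<Phi> Q z) (c, f)"
    if c: "c \<in> Obj C" for c h
  proof -
    interpret Dc: comm_group "D c" using Dc[OF c] by simp
    \<comment> \<open>A chain of lifts is evaluated by applying \<Phi> to the underlying chain at
      its head and reading off the component at the arrow of the head.\<close>
    let ?E = "lifts c h" and ?\<Phi> = "\<lambda>l. unFam (\<Phi> (fst (hd l)) (frag_of (map fst l))) (c, snd (hd l))"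
    let ?fst = "frag_extend (\<lambda>l. frag_of (map fst l))"
    have hd_l: "fst (hd l) \<in> S \<and> snd (hd l) \<in> Arr C c (fst (hd l)) \<and> map fst l \<in> up_chains (fst (hd l)) m"
      if l: "l \<in> chains lift_le ?E m" "m > 0" for l m
    proof -
      obtain a l' where al: "l = a # l'" using l by (cases l) (auto simp: chains_def)
      have lS: "fst b \<in> S \<and> snd b \<in> Arr C c (fst b)" if "b \<in> set l" for b
        using l that by (auto simp: chains_def lifts_def)
      have sl: "sorted_wrt lift_le l" using l by (simp add: chains_def)
      then have srt: "sorted_wrt (\<lambda>a b. r (fst a) (fst b)) l"
        by (rule sorted_wrt_mono_rel[rotated]) (simp add: lift_le_def)
      have "r (fst a) (fst b)" if "b \<in> set l" for b
      proof (cases "b = a")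
        case True then show ?thesis using refl lS[OF that] by simp
      next
        case False then show ?thesis using srt al that by simp
      qed
      with srt have "map fst l \<in> up_chains (fst a) m"
        using l lS by (auto simp: chains_def up_def sorted_wrt_map)
      then show ?thesis using al lS[of a] by simp
    qed
    obtain \<phi> where \<phi>: "\<phi> \<in> hom (free_Abelian_group (chains lift_le ?E (Suc k))) (D c)"
      and \<phi>l: "\<And>l. l \<in> chains lift_le ?E (Suc k) \<Longrightarrow> \<phi> (frag_of l) = ?\<Phi> l"
    proof (rule Dc.free_Abelian_group_universal[of ?\<Phi> "chains lift_le ?E (Suc k)"])
      show "?\<Phi> ` chains lift_le ?E (Suc k) \<subseteq> carrier (D c)"
      proof (intro image_subsetI)
        fix l assume "l \<in> chains lift_le ?E (Suc k)"
        from hd_l[OF this] show "?\<Phi> l \<in> carrier (D c)"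
          using hom_in_carrier[OF comp_hom[OF c, of "fst (hd l)" "snd (hd l)"], of "frag_of (map fst l)"] by simp
      qed
    qed blast
    \<comment> \<open>Any lift \<open>(Q, f)\<close> below the whole chain may serve in place of the
      head: restriction along \<open>u\<close> turns the component at the pushforward of
      \<open>f\<close> into the one at \<open>f\<close>.\<close>
    have \<phi>_eq: "\<phi> w = unFam (\<Phi> Q (?fst w)) (c, f)"
      if Qf: "Q \<in> S" "f \<in> Arr C c Q" and w: "Poly_Mapping.keys w \<subseteq> {l \<in> chains lift_le ?E (Suc k). \<forall>b\<in>set l. lift_le (Q, f) b}" for Q f w
    proof -
      let ?W = "{l \<in> chains lift_le ?E (Suc k). \<forall>b\<in>set l. lift_le (Q, f) b}"
      have W: "map fst l \<in> up_chains Q (Suc k)" if "l \<in> ?W" for l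
        using that hd_l[of l "Suc k"] by (auto simp: chains_def up_def lift_le_def lifts_def)
      have fh: "?fst \<in> hom (free_Abelian_group ?W) (free_Abelian_group (up_chains Q (Suc k)))"
        by (rule frag_extend_hom) (use W in simp)
      show ?thesis
      proof (rule hom_eq_on_free[OF Dc.group_axioms _ _ _ w])
        show "\<phi> \<in> hom (free_Abelian_group ?W) (D c)" by (rule hom_free_subset[OF \<phi>]) blast
        show "(\<lambda>w. unFam (\<Phi> Q (?fst w)) (c, f)) \<in> hom (free_Abelian_group ?W) (D c)"
          using hom_compose[OF fh comp_hom[OF c Qf]] by (simp add: o_def)
        fix l assume l: "l \<in> ?W"
        then have l1: "l \<in> chains lift_le ?E (Suc k)" by simp
        have "hd l \<in> set l" using l1 by (intro hd_in_set) (auto simp: chains_def)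
        then have le: "lift_le (Q, f) (hd l)" using l by blast
        note h = hd_l[OF l1]
        have "unFam (\<Phi> (fst (hd l)) (frag_of (map fst l))) (c, snd (hd l))
            = unFam (Res ?Y Q (fst (hd l)) (u Q (fst (hd l))) (\<Phi> (fst (hd l)) (frag_of (map fst l)))) (c, f)"
          using le by (simp add: lift_le_def coind_Res[OF c Qf(2)])
        also have "\<dots> = unFam (\<Phi> Q (frag_of (map fst l))) (c, f)"
          using cochain_Res[OF \<Phi>c Qf(1), of "fst (hd l)" "frag_of (map fst l)"] h le by (simp add: lift_le_def)
        finally show "\<phi> (frag_of l) = unFam (\<Phi> Q (?fst (frag_of l))) (c, f)" using \<phi>l[OF l1] by simp
      qed
    qed
    have cocyc: "\<phi> (frag_extend bd w) = \<one>\<^bsub>D c\<^esub>" if w: "Poly_Mapping.keys w \<subseteq> chains lift_le ?E (Suc (Suc k))" for w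
    proof (rule hom_eq_on_free[OF Dc.group_axioms _ _ _ w])
      show "(\<lambda>w. \<phi> (frag_extend bd w)) \<in> hom (free_Abelian_group (chains lift_le ?E (Suc (Suc k)))) (D c)"
        using hom_compose[OF bd_hom \<phi>] by (simp add: o_def)
      show "(\<lambda>w. \<one>\<^bsub>D c\<^esub>) \<in> hom (free_Abelian_group (chains lift_le ?E (Suc (Suc k)))) (D c)"
        by (simp add: hom_def)
      fix l assume l: "l \<in> chains lift_le ?E (Suc (Suc k))"
      obtain Q f l' where al: "l = (Q, f) # l'" using l by (cases l) (auto simp: chains_def)
      have h: "Q \<in> S" "f \<in> Arr C c Q" "map fst l \<in> up_chains Q (Suc (Suc k))" using hd_l[OF l] al by auto
      have "lift_le (Q, f) (Q, f)" using h refl u_refl S_Obj Cmp_Idn_left[of c Q f] c by (simp add: lift_le_def)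
      then have all: "\<forall>b\<in>set l. lift_le (Q, f) b" using l al by (auto simp: chains_def)
      \<comment> \<open>One face of \<open>l\<close> loses the head of \<open>l\<close>, so all
        faces are evaluated through that head, which lies below all their vertices.\<close>
      have "Poly_Mapping.keys (bd l) \<subseteq> {l \<in> chains lift_le ?E (Suc k). \<forall>b\<in>set l. lift_le (Q, f) b}"
        using bd_chains[OF l] keys_bd[of l] all by blast
      from \<phi>_eq[OF h(1,2) this] have "\<phi> (bd l) = unFam (\<Phi> Q (frag_extend bd (frag_of (map fst l)))) (c, f)"
        by (simp add: bd_map)
      also have "\<dots> = \<one>\<^bsub>D c\<^esub>"
        using \<Phi>1[OF h(1), of "frag_of (map fst l)"] h by (simp add: coind_one[OF c h(2)])
      finally show "\<phi> (frag_extend bd (frag_of l)) = \<one>\<^bsub>D c\<^esub>" by simp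
    qed
    have "\<exists>\<psi>\<in>hom (free_Abelian_group (chains lift_le ?E k)) (D c).
        \<forall>z. Poly_Mapping.keys z \<subseteq> chains lift_le ?E (Suc k) \<longrightarrow> \<psi> (frag_extend bd z) = \<phi> z"
      by (rule directed_cocycle_extends[OF lifts_directed[OF c] lifts_trans[OF c] D[OF c] \<phi> cocyc])
    then obtain \<psi> where \<psi>: "\<psi> \<in> hom (free_Abelian_group (chains lift_le ?E k)) (D c)"
      and \<psi>\<phi>: "\<And>z. Poly_Mapping.keys z \<subseteq> chains lift_le ?E (Suc k) \<Longrightarrow> \<psi> (frag_extend bd z) = \<phi> z" by blast
    have "\<psi> (frag_extend (\<lambda>l. frag_of (lift_chain Q f l)) (frag_extend bd z)) = unFam (\<Phi> Q z) (c, f)"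
      if Q: "Q \<in> S" and f: "f \<in> Arr C c Q" "Cmp C (v Q) f = h" and z: "Poly_Mapping.keys z \<subseteq> up_chains Q (Suc k)" for Q f z
    proof -
      let ?w = "frag_extend (\<lambda>l. frag_of (lift_chain Q f l)) z"
      have lc: "lift_chain Q f l \<in> {l \<in> chains lift_le ?E (Suc k). \<forall>b\<in>set l. lift_le (Q, f) b}"
        if l: "l \<in> up_chains Q (Suc k)" for l
        using lift_chain_in[OF c Q f(1) l] f(2) l by (auto simp: lift_chain_def lift_le_def chains_def up_def)
      have w: "Poly_Mapping.keys ?w \<subseteq> {l \<in> chains lift_le ?E (Suc k). \<forall>b\<in>set l. lift_le (Q, f) b}"
        using keys_frag_extend[of "\<lambda>l. frag_of (lift_chain Q f l)" z] lc z by fastforce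
      have "\<psi> (frag_extend (\<lambda>l. frag_of (lift_chain Q f l)) (frag_extend bd z)) = \<psi> (frag_extend bd ?w)"
        unfolding lift_chain_def by (simp add: bd_map_extend)
      also have "\<dots> = \<phi> ?w" by (rule \<psi>\<phi>) (use w in blast)
      also have "\<dots> = unFam (\<Phi> Q (?fst ?w)) (c, f)" by (rule \<phi>_eq[OF Q f(1) w])
      also have "?fst ?w = z" by (simp add: frag_extend_frag_extend lift_chain_def o_def frag_extend_id)
      finally show ?thesis .
    qed
    then show ?thesis using \<psi> by (intro bexI[of _ \<psi>]) auto
  qed
  then obtain \<psi> where \<psi>: "\<And>c h. c \<in> Obj C \<Longrightarrow> \<psi> c h \<in> hom (free_Abelian_group (chains lift_le (lifts c h) k)) (D c)"
    and \<psi>\<Phi>: "\<And>c Q f z. c \<in> Obj C \<Longrightarrow> Q \<in> S \<Longrightarrow> f \<in> Arr C c Q \<Longrightarrow> Poly_Mapping.keys z \<subseteq> up_chains Q (Suc k) \<Longrightarrow>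
        \<psi> c (Cmp C (v Q) f) (frag_extend (\<lambda>l. frag_of (lift_chain Q f l)) (frag_extend bd z)) = unFam (\<Phi> Q z) (c, f)"
    by metis
  \<comment> \<open>A solution \<psi> was found separately for each arrow to \<open>P\<close>; at
    \<open>f\<close> the one for the composite of \<open>f\<close> with \<open>v Q\<close> is
    used.\<close>
  define \<Psi> where "\<Psi> = (\<lambda>Q z. Fam (\<lambda>i\<in>arrows_to C Q. \<psi> (fst i) (Cmp C (v Q) (snd i)) (frag_extend (\<lambda>l. frag_of (lift_chain Q (snd i) l)) z)))"
  have \<Psi>at: "unFam (\<Psi> Q z) (c, f) = \<psi> c (Cmp C (v Q) f) (frag_extend (\<lambda>l. frag_of (lift_chain Q f l)) z)"
    if "c \<in> Obj C" "f \<in> Arr C c Q" for Q z c f using that by (simp add: \<Psi>_def)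
  have \<Psi>hom: "(\<lambda>z. unFam (\<Psi> Q z) (c, f)) \<in> hom (free_Abelian_group (up_chains Q k)) (D c)"
    if "c \<in> Obj C" "Q \<in> S" "f \<in> Arr C c Q" for Q c f
  proof -
    have "frag_extend (\<lambda>l. frag_of (lift_chain Q f l)) \<in> hom (free_Abelian_group (up_chains Q k))
        (free_Abelian_group (chains lift_le (lifts c (Cmp C (v Q) f)) k))"
      by (rule frag_extend_hom) (use lift_chain_in[OF that] in simp)
    from hom_compose[OF this \<psi>[OF that(1)]] show ?thesis using \<Psi>at[OF that(1,3)] by (simp add: o_def)
  qed
  have \<Psi>closed: "\<Psi> Q z \<in> carrier (Val ?Y Q)" if "Q \<in> S" "Poly_Mapping.keys z \<subseteq> up_chains Q k" for Q z
    unfolding \<Psi>_def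
    by (rule coind_carrierI) (use hom_in_carrier[OF \<Psi>hom, of _ Q _ z] that in \<open>simp add: \<Psi>at\<close>)
  have "cochain (pull ?Y) k \<Psi>"
    unfolding cochain_def
  proof (intro conjI ballI impI allI)
    fix Q assume Q: "Q \<in> S"
    interpret G: comm_group "Val ?Y Q" using cat_module.Val_comm_group[OF Y S_Obj[OF Q]] .
    show "\<Psi> Q \<in> hom (free_Abelian_group (up_chains Q k)) (Val (pull ?Y) Q)"
    proof (rule homI)
      fix x y assume xy: "x \<in> carrier (free_Abelian_group (up_chains Q k))" "y \<in> carrier (free_Abelian_group (up_chains Q k))"
      have xy': "Poly_Mapping.keys x \<subseteq> up_chains Q k" "Poly_Mapping.keys y \<subseteq> up_chains Q k" "Poly_Mapping.keys (x + y) \<subseteq> up_chains Q k"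
        using xy keys_add[of x y] by auto
      have "\<Psi> Q (x + y) = \<Psi> Q x \<otimes>\<^bsub>Val ?Y Q\<^esub> \<Psi> Q y"
      proof (rule coind_ext[of _ C D Q])
        fix c f assume cf: "c \<in> Obj C" "f \<in> Arr C c Q"
        show "unFam (\<Psi> Q (x + y)) (c, f) = unFam (\<Psi> Q x \<otimes>\<^bsub>Val ?Y Q\<^esub> \<Psi> Q y) (c, f)"
          using hom_mult[OF \<Psi>hom[OF cf(1) Q cf(2)] xy] by (simp add: coind_mult[OF cf])
      qed (use \<Psi>closed[OF Q] xy' in auto)
      then show "\<Psi> Q (x \<otimes>\<^bsub>free_Abelian_group (up_chains Q k)\<^esub> y) = \<Psi> Q x \<otimes>\<^bsub>Val (pull ?Y) Q\<^esub> \<Psi> Q y" by simp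
    qed (use \<Psi>closed[OF Q] in auto)
  next
    fix Q R and z :: "'o list \<Rightarrow>\<^sub>0 int"
    assume QR: "Q \<in> S" "R \<in> S" "r Q R" and z: "Poly_Mapping.keys z \<subseteq> up_chains R k"
    have zQ: "Poly_Mapping.keys z \<subseteq> up_chains Q k" using z up_chains_mono[OF QR] by blast
    have "Res ?Y Q R (u Q R) (\<Psi> R z) = \<Psi> Q z"
    proof (rule coind_ext[of _ C D Q])
      fix c f assume cf: "c \<in> Obj C" "f \<in> Arr C c Q"
      \<comment> \<open>Naturality: \<open>f\<close> reaches the vertices of a chain above
        \<open>R\<close> equally well through \<open>R\<close>. The composite to \<open>P\<close>
        does not change either, so the same \<psi> is applied.\<close>
      have "frag_extend (\<lambda>l. frag_of (lift_chain R (Cmp C (u Q R) f) l)) z = frag_extend (\<lambda>l. frag_of (lift_chain Q f l)) z"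
      proof (rule frag_extend_eq)
        fix l assume "l \<in> Poly_Mapping.keys z"
        then have "l \<in> up_chains R k" using z by blast
        then have "lift_chain R (Cmp C (u Q R) f) l = lift_chain Q f l"
          using u_comp_arrow[OF cf(1) QR(1,2) _ QR(3) _ cf(2)] by (auto simp: lift_chain_def chains_def up_def)
        then show "frag_of (lift_chain R (Cmp C (u Q R) f) l) = frag_of (lift_chain Q f l)" by simp
      qed
      then show "unFam (Res ?Y Q R (u Q R) (\<Psi> R z)) (c, f) = unFam (\<Psi> Q z) (c, f)"
        using coind_Res[OF cf, of D R "u Q R"] \<Psi>at[OF cf] \<Psi>at[OF cf(1) u_arrow[OF cf(1) QR cf(2)]] v_comp_arrow[OF cf(1) QR cf(2)] by simp
    qed (use \<Psi>closed[OF QR(1) zQ] \<Psi>closed[OF QR(2) z] Res_closed[OF Y S_Obj[OF QR(1)] S_Obj[OF QR(2)] u_Arr[OF QR]] in auto)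
    then show "Res (pull ?Y) Q R () (\<Psi> R z) = \<Psi> Q z" by simp
  qed
  moreover have "\<Psi> Q (frag_extend bd z) = \<Phi> Q z" if Q: "Q \<in> S" and z: "Poly_Mapping.keys z \<subseteq> up_chains Q (Suc k)" for Q z
  proof (rule coind_ext[of _ C D Q])
    show "unFam (\<Psi> Q (frag_extend bd z)) (c, f) = unFam (\<Phi> Q z) (c, f)" if "c \<in> Obj C" "f \<in> Arr C c Q" for c f
      using \<Psi>at[OF that] \<psi>\<Phi>[OF that(1) Q that(2) z] by simp
  qed (use \<Psi>closed[OF Q bd_closed[OF z]] cochain_closed[OF \<Phi>c Q z] in auto)
  ultimately show "\<exists>\<Psi>. cochain (pull ?Y) k \<Psi> \<and>
      (\<forall>Q\<in>S. \<forall>z. Poly_Mapping.keys z \<subseteq> up_chains Q (Suc k) \<longrightarrow> \<Psi> Q (frag_extend bd z) = \<Phi> Q z)" by blast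
qed

text \<open>An element of the limit is a compatible family of functions on the sets
  \<open>Arr C c Q\<close>, hence a function on their colimit. By \<open>directed\<close> that
  colimit is a part of \<open>Arr C c P\<close>, and a function on a part extends to the
  whole.\<close>

lemma coind_lim_extends:
  fixes D :: "'o \<Rightarrow> ('o \<times> 'a, 'm) univ monoid"
  assumes D: "\<And>c. c \<in> Obj C \<Longrightarrow> comm_group (D c)"
    and t: "t \<in> carrier (inv_lim (poset_category S r) (pull (coind C D)))"
  shows "\<exists>x\<in>carrier (Val (coind C D) P). \<forall>Q\<in>S. Res (coind C D) Q P (v Q) x = t Q"
proof -
  let ?Y = "coind C D"
  have Y: "cat_module C ?Y" by (rule coind_cat_module[OF small_category_axioms D])
  have tc: "t Q \<in> carrier (Val ?Y Q)" if "Q \<in> S" for Q using inv_lim_component[OF t] that by simp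
  have tR: "Res ?Y Q R (u Q R) (t R) = t Q" if "Q \<in> S" "R \<in> S" "r Q R" for Q R
    using inv_lim_Res[OF t, of Q R "()"] that by simp
  have wd: "unFam (t Q) (c, f) = unFam (t R) (c, g)"
    if cQ: "c \<in> Obj C" "Q \<in> S" "R \<in> S" "f \<in> Arr C c Q" "g \<in> Arr C c R" "Cmp C (v Q) f = Cmp C (v R) g" for c Q R f g
  proof -
    obtain T where T: "T \<in> S" "r Q T" "r R T" "Cmp C (u Q T) f = Cmp C (u R T) g"
      using directed[OF cQ] by blast
    have "unFam (t Q) (c, f) = unFam (t T) (c, Cmp C (u Q T) f)"
      using tR[OF cQ(2) T(1,2)] coind_Res[OF cQ(1,4), of D T "u Q T" "t T"] by simp
    also have "\<dots> = unFam (t R) (c, g)"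
      using tR[OF cQ(3) T(1,3)] coind_Res[OF cQ(1,5), of D T "u R T" "t T"] T(4) by simp
    finally show ?thesis .
  qed
  \<comment> \<open>Arrows that do not factor through the diagram get the value
    \<open>\<one>\<close>; for the others every lift gives the same value by
    \<open>wd\<close>.\<close>
  define x where "x = Fam (\<lambda>i\<in>arrows_to C P. if lifts (fst i) (snd i) = {} then \<one>\<^bsub>D (fst i)\<^esub>
      else let (Q, f) = (SOME a. a \<in> lifts (fst i) (snd i)) in unFam (t Q) (fst i, f))"
  have x: "x \<in> carrier (Val ?Y P)"
    unfolding x_def
  proof (rule coind_carrierI)
    fix c h assume c: "c \<in> Obj C" "h \<in> Arr C c P"
    obtain Q f where s: "(SOME a. a \<in> lifts c h) = (Q, f)" by fastforce
    have "(Q, f) \<in> lifts c h" if "lifts c h \<noteq> {}"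
      unfolding s[symmetric] using that by (simp add: some_in_eq)
    then show "(if lifts (fst (c, h)) (snd (c, h)) = {} then \<one>\<^bsub>D (fst (c, h))\<^esub>
      else let (Q, f) = (SOME a. a \<in> lifts (fst (c, h)) (snd (c, h))) in unFam (t Q) (fst (c, h), f)) \<in> carrier (D c)"
      using coind_component[OF tc c(1)] monoid.one_closed[of "D c"] D[OF c(1)] s
      by (auto simp: lifts_def comm_group_def comm_monoid_def)
  qed
  moreover have "Res ?Y Q P (v Q) x = t Q" if Q: "Q \<in> S" for Q
  proof (rule coind_ext[of _ C D Q])
    fix c f assume cf: "c \<in> Obj C" "f \<in> Arr C c Q"
    have vf: "Cmp C (v Q) f \<in> Arr C c P" using Cmp_in_Arr[OF cf(1) S_Obj[OF Q] P_Obj cf(2) v_Arr[OF Q]] .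
    have Qf: "(Q, f) \<in> lifts c (Cmp C (v Q) f)" using Q cf by (simp add: lifts_def)
    obtain R g where s: "(SOME a. a \<in> lifts c (Cmp C (v Q) f)) = (R, g)" by fastforce
    have "(R, g) \<in> lifts c (Cmp C (v Q) f)" unfolding s[symmetric] using Qf by (rule someI)
    then have "unFam (t R) (c, g) = unFam (t Q) (c, f)"
      using wd[OF cf(1) _ Q _ cf(2), of R g] by (simp add: lifts_def)
    then show "unFam (Res ?Y Q P (v Q) x) (c, f) = unFam (t Q) (c, f)"
      using coind_Res[OF cf, of D P "v Q" x] Qf vf cf s by (auto simp: x_def)
  qed (use tc[OF Q] Res_closed[OF Y S_Obj[OF Q] P_Obj v_Arr[OF Q] x] in auto)
  ultimately show ?thesis by blast
qed

end

section \<open>Restriction to a sieve\<close>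

text \<open>A preimage \<open>y0\<close> of \<open>x\<close> restricts to a cocycle \<open>t\<close>
  over \<open>S\<close>. It need not be trivial, but it comes from the previous degree by
  \<open>lim_poset_exact\<close>, through an element that extends to some \<open>z\<close> at
  \<open>P\<close>; correcting \<open>y0\<close> by the differential of \<open>z\<close> removes
  \<open>t\<close>. In the application \<open>V\<close> marks the objects outside a sieve, and
  \<open>factor\<close> reduces vanishing on the sieve to vanishing on \<open>S\<close>.\<close>

lemma (in directed_system) supported_part_exact:
  fixes D :: "nat \<Rightarrow> 'o \<Rightarrow> ('o \<times> 'a, 'm) univ monoid" and \<Phi> :: "('o, 'a, 'y) presheaf"
  assumes res: "resolution C \<Phi> \<epsilon> (\<lambda>n. coind C (D n)) \<delta>"
    and D: "\<And>n c. c \<in> Obj C \<Longrightarrow> divisible_group (D n c)"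
    and \<Phi>S: "\<And>Q. Q \<in> S \<Longrightarrow> carrier (Val \<Phi> Q) = {\<one>\<^bsub>Val \<Phi> Q\<^esub>}"
    and \<Phi>P: "carrier (Val \<Phi> P) = {\<one>\<^bsub>Val \<Phi> P\<^esub>}"
    and V: "\<And>Q. Q \<in> S \<Longrightarrow> \<not> V Q"
    and factor: "\<And>c f. c \<in> Obj C \<Longrightarrow> \<not> V c \<Longrightarrow> f \<in> Arr C c P \<Longrightarrow> \<exists>Q\<in>S. \<exists>g\<in>Arr C c Q. f = Cmp C (v Q) g"
  shows "x \<in> carrier (Val (coind C (D 0)) P) \<Longrightarrow> \<delta> 0 P x = \<one>\<^bsub>Val (coind C (D (Suc 0))) P\<^esub> \<Longrightarrow> x = \<one>\<^bsub>Val (coind C (D 0)) P\<^esub>"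
    and "x \<in> carrier (Val (coind C (D (Suc n))) P) \<Longrightarrow>
      (\<And>Q. Q \<in> S \<Longrightarrow> Res (coind C (D (Suc n))) Q P (v Q) x = \<one>\<^bsub>Val (coind C (D (Suc n))) Q\<^esub>) \<Longrightarrow>
      \<delta> (Suc n) P x = \<one>\<^bsub>Val (coind C (D (Suc (Suc n)))) P\<^esub> \<Longrightarrow>
      \<exists>y\<in>carrier (Val (supported_part C V (coind C (D n))) P). x = \<delta> n P y"
proof -
  let ?I = "\<lambda>n. coind C (D n)"
  interpret R: resolution C \<Phi> \<epsilon> ?I \<delta> by (rule res)
  have Dc: "comm_group (D n c)" if "c \<in> Obj C" for n c using D[OF that] by (simp add: divisible_group_def)
  have zero: "y = \<one>\<^bsub>Val (?I 0) c\<^esub>"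
    if "c \<in> Obj C" "carrier (Val \<Phi> c) = {\<one>\<^bsub>Val \<Phi> c\<^esub>}" "y \<in> carrier (Val (?I 0) c)" "\<delta> 0 c y = \<one>\<^bsub>Val (?I (Suc 0)) c\<^esub>" for y c
    using R.ker0[OF that(1,3,4)] that(2) group_hom.hom_one[OF module_hom_group_hom[OF R.mod R.modI R.\<epsilon>_hom that(1)]] by auto
  show "x = \<one>\<^bsub>Val (?I 0) P\<^esub>" if "x \<in> carrier (Val (?I 0) P)" "\<delta> 0 P x = \<one>\<^bsub>Val (?I (Suc 0)) P\<^esub>"
    using zero[OF P_Obj \<Phi>P that] .
  have E: "exact_poset_complex S r (\<lambda>n. pull (?I n)) \<delta>"
  proof (rule exact_poset_complex.intro[OF poset_axioms], rule exact_poset_complex_axioms.intro)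
    show "cat_module (poset_category S r) (pull (?I n))" for n by (rule pull_module[OF R.modI])
    show "\<delta> n \<in> module_hom (poset_category S r) (pull (?I n)) (pull (?I (Suc n)))" for n by (rule pull_hom[OF R.\<delta>_hom])
    show "acyclic (pull (?I n))" for n by (rule coind_acyclic) (rule D)
    show "x = \<one>\<^bsub>Val (pull (?I 0)) Q\<^esub>"
      if "Q \<in> S" "x \<in> carrier (Val (pull (?I 0)) Q)" "\<delta> 0 Q x = \<one>\<^bsub>Val (pull (?I (Suc 0))) Q\<^esub>" for Q x
      using zero[OF S_Obj[OF that(1)] \<Phi>S[OF that(1)]] that by simp
    show "\<exists>y\<in>carrier (Val (pull (?I n)) Q). x = \<delta> n Q y"
      if "Q \<in> S" "x \<in> carrier (Val (pull (?I (Suc n))) Q)" "\<delta> (Suc n) Q x = \<one>\<^bsub>Val (pull (?I (Suc (Suc n)))) Q\<^esub>" for Q x n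
      using R.kerS[OF S_Obj[OF that(1)]] that by simp
    show "\<delta> (Suc n) Q (\<delta> n Q x) = \<one>\<^bsub>Val (pull (?I (Suc (Suc n)))) Q\<^esub>"
      if "Q \<in> S" "x \<in> carrier (Val (pull (?I n)) Q)" for Q x n
      using R.\<delta>\<delta>[OF S_Obj[OF that(1)]] that by simp
  qed
  interpret E: exact_poset_complex S r "\<lambda>n. pull (?I n)" \<delta> by (rule E)
  assume x: "x \<in> carrier (Val (?I (Suc n)) P)" and xS: "\<And>Q. Q \<in> S \<Longrightarrow> Res (?I (Suc n)) Q P (v Q) x = \<one>\<^bsub>Val (?I (Suc n)) Q\<^esub>"
    and dx: "\<delta> (Suc n) P x = \<one>\<^bsub>Val (?I (Suc (Suc n))) P\<^esub>"
  obtain y0 where y0: "y0 \<in> carrier (Val (?I n) P)" "x = \<delta> n P y0" using R.kerS[OF P_Obj x dx] by blast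
  have supp: "y \<in> carrier (Val (supported_part C V (?I n)) P)"
    if y: "y \<in> carrier (Val (?I n) P)" and yS: "\<And>Q. Q \<in> S \<Longrightarrow> Res (?I n) Q P (v Q) y = \<one>\<^bsub>Val (?I n) Q\<^esub>" for y
    unfolding supported_part_carrier
  proof (intro conjI ballI impI)
    fix c f assume c: "c \<in> Obj C" "\<not> V c" "f \<in> Arr C c P"
    then obtain Q g where Q: "Q \<in> S" "g \<in> Arr C c Q" "f = Cmp C (v Q) g" using factor by blast
    have "Res (?I n) c P f y = Res (?I n) c Q g (Res (?I n) Q P (v Q) y)"
      unfolding Q(3) by (rule cat_module.Res_Cmp[OF R.modI c(1) S_Obj[OF Q(1)] P_Obj Q(2) v_Arr[OF Q(1)] y])
    then show "Res (?I n) c P f y = \<one>\<^bsub>Val (?I n) c\<^esub>"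
      using yS[OF Q(1)] group_hom.hom_one[OF Res_group_hom[OF R.modI c(1) S_Obj[OF Q(1)] Q(2)]] by simp
  qed (rule y)
  define t where "t = (\<lambda>Q\<in>S. Res (?I n) Q P (v Q) y0)"
  have t: "t \<in> carrier (inv_lim (poset_category S r) (pull (?I n)))"
    unfolding inv_lim_iff
  proof (intro conjI ballI)
    show "t \<in> (\<Pi>\<^sub>E Q\<in>Obj (poset_category S r). carrier (Val (pull (?I n)) Q))"
      using Res_closed[OF R.modI S_Obj P_Obj v_Arr y0(1)] by (auto simp: t_def)
    fix Q T f assume "Q \<in> Obj (poset_category S r)" "T \<in> Obj (poset_category S r)" "f \<in> Arr (poset_category S r) Q T"
    then have QT: "Q \<in> S" "T \<in> S" "r Q T" by simp_all
    then show "Res (pull (?I n)) Q T f (t T) = t Q"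
      using cat_module.Res_Cmp[OF R.modI S_Obj[OF QT(1)] S_Obj[OF QT(2)] P_Obj u_Arr[OF QT] v_Arr[OF QT(2)] y0(1)] v_comp[OF QT]
      by (simp add: t_def)
  qed
  have dt: "\<delta> n Q (t Q) = \<one>\<^bsub>Val (pull (?I (Suc n))) Q\<^esub>" if Q: "Q \<in> S" for Q
    using module_hom_natural[OF R.\<delta>_hom S_Obj[OF Q] P_Obj v_Arr[OF Q] y0(1)] xS[OF Q] y0(2) Q by (simp add: t_def)
  show "\<exists>y\<in>carrier (Val (supported_part C V (?I n)) P). x = \<delta> n P y"
  proof (cases n)
    \<comment> \<open>In degree 0 \<open>t\<close> is trivial already, since \<Phi> vanishes on
      \<open>S\<close>, and \<open>y0\<close> itself is supported on \<open>V\<close>.\<close>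
    case 0
    have "t Q = \<one>\<^bsub>Val (?I 0) Q\<^esub>" if "Q \<in> S" for Q
      using E.lim_poset_exact_0[of t Q] t dt that unfolding 0 by simp
    then show ?thesis using supp[OF y0(1)] y0(2) 0 by (auto simp: t_def)
  next
    case (Suc m)
    obtain w where w: "w \<in> carrier (inv_lim (poset_category S r) (pull (?I m)))" and tw: "\<And>Q. Q \<in> S \<Longrightarrow> t Q = \<delta> m Q (w Q)"
      using E.lim_poset_exact[of t m] t dt unfolding Suc by blast
    obtain z where z: "z \<in> carrier (Val (?I m) P)" "\<And>Q. Q \<in> S \<Longrightarrow> Res (?I m) Q P (v Q) z = w Q"
      using coind_lim_extends[OF _ w] Dc by blast
    have \<delta>z: "\<delta> m P z \<in> carrier (Val (?I n) P)" using module_hom_closed[OF R.\<delta>_hom P_Obj z(1)] Suc by simp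
    define y where "y = y0 \<otimes>\<^bsub>Val (?I n) P\<^esub> inv\<^bsub>Val (?I n) P\<^esub> \<delta> m P z"
    interpret G: comm_group "Val (?I n) P" using cat_module.Val_comm_group[OF R.modI P_Obj] .
    have y: "y \<in> carrier (Val (?I n) P)" using y0 \<delta>z by (simp add: y_def)
    have "Res (?I n) Q P (v Q) y = \<one>\<^bsub>Val (?I n) Q\<^esub>" if Q: "Q \<in> S" for Q
    proof -
      interpret Rs: group_hom "Val (?I n) P" "Val (?I n) Q" "Res (?I n) Q P (v Q)"
        using Res_group_hom[OF R.modI S_Obj[OF Q] P_Obj v_Arr[OF Q]] .
      have "Res (?I n) Q P (v Q) (\<delta> m P z) = t Q"
        using module_hom_natural[OF R.\<delta>_hom S_Obj[OF Q] P_Obj v_Arr[OF Q] z(1)] z(2)[OF Q] tw[OF Q] Suc by simp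
      moreover have "Res (?I n) Q P (v Q) y0 = t Q" using Q by (simp add: t_def)
      moreover have "t Q \<in> carrier (Val (?I n) Q)" using inv_lim_component[OF t, of Q] Q by simp
      ultimately show ?thesis using y0(1) \<delta>z by (simp add: y_def)
    qed
    from supp[OF y this] have "y \<in> carrier (Val (supported_part C V (?I n)) P)" by simp
    moreover have "\<delta> n P y = x"
    proof -
      interpret d: group_hom "Val (?I n) P" "Val (?I (Suc n)) P" "\<delta> n P"
        using module_hom_group_hom[OF R.modI R.modI R.\<delta>_hom P_Obj] .
      have "\<delta> n P (\<delta> m P z) = \<one>\<^bsub>Val (?I (Suc n)) P\<^esub>" using R.\<delta>\<delta>[OF P_Obj z(1)] Suc by simp
      then show ?thesis using y0 \<delta>z d.hom_closed[OF y0(1)] by (simp add: y_def)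
    qed
    ultimately show ?thesis by blast
  qed
qed

text \<open>A compatible family in a coinduced module amounts to one element of \<open>D c\<close>
  for each \<open>c\<close>, read off at the identity. Restriction to a sieve forgets the factors
  outside it, which may be filled with \<open>\<one>\<close>.\<close>

lemma coind_lim_restrict_surj:
  fixes D :: "'o \<Rightarrow> ('o \<times> 'a, 'm) univ monoid"
  assumes C: "small_category C" and D: "\<And>c. c \<in> Obj C \<Longrightarrow> comm_group (D c)"
    and W: "\<And>c d. c \<in> Obj C \<Longrightarrow> d \<in> Obj C \<Longrightarrow> W d \<Longrightarrow> Arr C c d \<noteq> {} \<Longrightarrow> W c"
    and s: "s \<in> carrier (inv_lim (full_subcategory C W) (coind C D))"
  shows "\<exists>t\<in>carrier (inv_lim C (coind C D)). \<forall>c\<in>Obj C. W c \<longrightarrow> t c = s c"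
proof -
  interpret small_category C by fact
  let ?I = "coind C D"
  have I: "cat_module C ?I" by (rule coind_cat_module[OF C D])
  have sc: "s c \<in> carrier (Val ?I c)" if "c \<in> Obj C" "W c" for c using inv_lim_component[OF s] that by simp
  define k where "k c = (if W c then unFam (s c) (c, Idn C c) else \<one>\<^bsub>D c\<^esub>)" for c
  have k: "k c \<in> carrier (D c)" if c: "c \<in> Obj C" for c
    using coind_component[OF sc[OF c] c Idn_in_Arr[OF c]] D[OF c]
    by (simp add: k_def comm_group_def comm_monoid_def monoid.one_closed)
  define t where "t = (\<lambda>x\<in>Obj C. Fam (\<lambda>i\<in>arrows_to C x. k (fst i)))"
  have tx: "t x \<in> carrier (Val ?I x)" if "x \<in> Obj C" for x
  proof -
    have "Fam (\<lambda>i\<in>arrows_to C x. k (fst i)) \<in> carrier (Val ?I x)" by (rule coind_carrierI) (use k in simp)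
    then show ?thesis using that by (simp add: t_def)
  qed
  have "t \<in> carrier (inv_lim C ?I)"
    unfolding inv_lim_iff
  proof (intro conjI ballI)
    show "t \<in> (\<Pi>\<^sub>E c\<in>Obj C. carrier (Val ?I c))" using tx by (auto simp: t_def)
    fix c d f assume cd: "c \<in> Obj C" "d \<in> Obj C" "f \<in> Arr C c d"
    show "Res ?I c d f (t d) = t c"
      by (rule coind_ext[of _ C D c])
         (use cd tx Res_closed[OF I cd tx] Cmp_in_Arr[of _ c d _ f] in \<open>simp_all add: coind_Res t_def\<close>)
  qed
  moreover have "t x = s x" if x: "x \<in> Obj C" "W x" for x
  proof (rule coind_ext[OF tx[OF x(1)] sc[OF x]])
    fix c f assume cf: "c \<in> Obj C" "f \<in> Arr C c x"
    then have Wc: "W c" using W x by blast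
    have "s c = Res ?I c x f (s x)" using inv_lim_Res[OF s, of c x f] cf x Wc by simp
    then have "unFam (s c) (c, Idn C c) = unFam (s x) (c, f)"
      using coind_Res[OF cf(1) Idn_in_Arr[OF cf(1)], of D x f "s x"] Cmp_Idn_right[OF cf(1) x(1) cf(2)] by simp
    then show "unFam (t x) (c, f) = unFam (s x) (c, f)" using x cf Wc by (simp add: t_def k_def)
  qed
  ultimately show ?thesis by blast
qed

text \<open>The sections over \<open>C\<close>, those over the sieve \<open>W\<close>, and the
  sections that vanish on \<open>W\<close> form a short exact sequence of complexes. The complex of
  sections vanishing on \<open>W\<close> is exact, so restriction induces an isomorphism on
  cohomology. The hypothesis \<open>sys\<close> supplies, at each object outside \<open>W\<close>,
  the diagram that makes the supported sections exact there.\<close>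

theorem higher_lim_full_subcategory:
  fixes C :: "('o, 'a) cat" and \<Phi> :: "('o, 'a, 'm) presheaf"
  assumes C: "small_category C" and \<Phi>: "cat_module C \<Phi>"
    and W: "\<And>c d. c \<in> Obj C \<Longrightarrow> d \<in> Obj C \<Longrightarrow> W d \<Longrightarrow> Arr C c d \<noteq> {} \<Longrightarrow> W c"
    and sys: "\<And>P. P \<in> Obj C \<Longrightarrow> \<not> W P \<Longrightarrow> carrier (Val \<Phi> P) = {\<one>\<^bsub>Val \<Phi> P\<^esub>} \<and>
       (\<exists>S r u v. directed_system C S r u v P \<and>
         (\<forall>Q\<in>S. W Q \<and> carrier (Val \<Phi> Q) = {\<one>\<^bsub>Val \<Phi> Q\<^esub>}) \<and>
         (\<forall>c\<in>Obj C. \<forall>f\<in>Arr C c P. W c \<longrightarrow> (\<exists>Q\<in>S. \<exists>g\<in>Arr C c Q. f = Cmp C (v Q) g)))"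
  shows "higher_lim C \<Phi> i \<cong> higher_lim (full_subcategory C W) \<Phi> i"
proof -
  let ?CW = "full_subcategory C W" and ?CV = "full_subcategory C (\<lambda>c. \<not> W c)"
  obtain \<epsilon> and D :: "nat \<Rightarrow> 'o \<Rightarrow> ('o \<times> 'a, 'm) univ monoid" and \<delta>
    where "(\<forall>n. \<forall>c\<in>Obj C. divisible_group (D n c)) \<and> injective_resolution C \<Phi> \<epsilon> (\<lambda>n. coind C (D n)) \<delta>"
    using coind_resolution_exists[OF C \<Phi>] by (elim exE) (rule that)
  then have D: "\<And>n c. c \<in> Obj C \<Longrightarrow> divisible_group (D n c)"
    and res: "injective_resolution C \<Phi> \<epsilon> (\<lambda>n. coind C (D n)) \<delta>" by simp_all
  have Dc: "comm_group (D n c)" if "c \<in> Obj C" for n c using D[OF that] by (simp add: divisible_group_def)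
  define I where "I = (\<lambda>n. coind C (D n))"
  have R: "resolution C \<Phi> \<epsilon> I \<delta>" using \<Phi> res unfolding I_def by (rule resolution.intro)
  interpret R: resolution C \<Phi> \<epsilon> I \<delta> by (rule R)
  interpret X: module_complex C I \<delta> by (rule R.complex)
  \<comment> \<open>Exactness is objectwise and injectivity passes to a sieve, so the same complex
    \<open>I\<close> computes both higher limits.\<close>
  have "injective_resolution ?CW \<Phi> \<epsilon> I \<delta>"
    unfolding injective_resolution_def
  proof (intro conjI allI ballI)
    show "injective_module ?CW (I n)" for n by (rule injective_restrict_sieve[OF C R.injective W])
    show "\<epsilon> \<in> module_mono ?CW \<Phi> (I 0)"
      using module_hom_full_subcategory[OF R.\<epsilon>_hom] R.\<epsilon>_inj by (simp add: module_mono_def)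
    show "\<delta> n \<in> module_hom ?CW (I n) (I (Suc n))" for n by (rule module_hom_full_subcategory[OF R.\<delta>_hom])
  qed (use R.exact0 R.exactS in simp_all)
  then have RW: "resolution ?CW \<Phi> \<epsilon> I \<delta>"
    using cat_module_full_subcategory[OF \<Phi>] by (intro resolution.intro)
  interpret RW: resolution ?CW \<Phi> \<epsilon> I \<delta> by (rule RW)
  interpret Y: module_complex ?CW I \<delta> by (rule RW.complex)
  \<comment> \<open>Sections that restrict trivially to every object of \<open>W\<close>. They are
    considered over the complement \<open>?CV\<close>, which is convex because \<open>W\<close> is a
    sieve.\<close>
  define J where "J = (\<lambda>n. supported_part C (\<lambda>c. \<not> W c) (I n))"
  have J: "injective_module ?CV (J n)" for n
    unfolding J_def
  proof (rule supported_part_injective[OF C _ R.injective])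
    show "convex_in C (\<lambda>c. \<not> W c)" unfolding convex_in_def using W by blast
  qed
  have \<delta>J: "\<delta> n \<in> module_hom ?CV (J n) (J (Suc n))" for n
    unfolding J_def by (rule module_hom_full_subcategory[OF supported_part_hom[OF R.modI R.modI R.\<delta>_hom]])
  have Jsub: "x \<in> carrier (Val (I n) c)" if "x \<in> carrier (Val (J n) c)" for x n c
    using that by (simp add: J_def supported_part_carrier)
  have J1: "\<one>\<^bsub>Val (J n) c\<^esub> = \<one>\<^bsub>Val (I n) c\<^esub>" for n c by (simp add: J_def)
  have exJ: "x = \<one>\<^bsub>Val (I 0) P\<^esub>" if P: "P \<in> Obj C" "\<not> W P" "x \<in> carrier (Val (J 0) P)" "\<delta> 0 P x = \<one>\<^bsub>Val (I (Suc 0)) P\<^esub>" for P x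
  proof -
    obtain S r u v where "directed_system C S r u v P" and SW: "\<And>Q. Q \<in> S \<Longrightarrow> W Q"
      and S1: "\<And>Q. Q \<in> S \<Longrightarrow> carrier (Val \<Phi> Q) = {\<one>\<^bsub>Val \<Phi> Q\<^esub>}"
      and P1: "carrier (Val \<Phi> P) = {\<one>\<^bsub>Val \<Phi> P\<^esub>}"
      and fac: "\<And>c f. c \<in> Obj C \<Longrightarrow> W c \<Longrightarrow> f \<in> Arr C c P \<Longrightarrow> \<exists>Q\<in>S. \<exists>g\<in>Arr C c Q. f = Cmp C (v Q) g"
      using sys[OF P(1,2)] by metis
    interpret directed_system C S r u v P by fact
    show ?thesis
      using P(4) Jsub[OF P(3)] unfolding I_def
      by (intro supported_part_exact(1)[OF R[unfolded I_def] D S1 P1, of "\<lambda>c. \<not> W c"]) (use SW fac in auto)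
  qed
  have exJS: "\<exists>y\<in>carrier (Val (J n) P). x = \<delta> n P y"
    if P: "P \<in> Obj C" "\<not> W P" and x: "x \<in> carrier (Val (J (Suc n)) P)" "\<delta> (Suc n) P x = \<one>\<^bsub>Val (I (Suc (Suc n))) P\<^esub>" for P n x
  proof -
    obtain S r u v where "directed_system C S r u v P" and SW: "\<And>Q. Q \<in> S \<Longrightarrow> W Q"
      and S1: "\<And>Q. Q \<in> S \<Longrightarrow> carrier (Val \<Phi> Q) = {\<one>\<^bsub>Val \<Phi> Q\<^esub>}"
      and P1: "carrier (Val \<Phi> P) = {\<one>\<^bsub>Val \<Phi> P\<^esub>}"
      and fac: "\<And>c f. c \<in> Obj C \<Longrightarrow> W c \<Longrightarrow> f \<in> Arr C c P \<Longrightarrow> \<exists>Q\<in>S. \<exists>g\<in>Arr C c Q. f = Cmp C (v Q) g"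
      using sys[OF P] by metis
    interpret directed_system C S r u v P by fact
    have "Res (I (Suc n)) Q P (v Q) x = \<one>\<^bsub>Val (I (Suc n)) Q\<^esub>" if "Q \<in> S" for Q
      using x(1) S_Obj[OF that] v_Arr[OF that] SW[OF that] by (simp add: J_def supported_part_carrier)
    then show ?thesis
      using x(2) Jsub[OF x(1)] unfolding I_def J_def
      by (intro supported_part_exact(2)[OF R[unfolded I_def] D S1 P1, of "\<lambda>c. \<not> W c"]) (use SW fac in auto)
  qed
  \<comment> \<open>Over \<open>?CV\<close> the complex \<open>J\<close> is exact and has injective
    terms, so its limit is exact.\<close>
  have acyc: "lim_cocycles ?CV J \<delta> n \<subseteq> lim_coboundaries ?CV J \<delta> n" for n
  proof (rule lim_exact[where C = ?CV and I = J and \<delta> = \<delta>, OF J \<delta>J])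
    fix c assume c: "c \<in> Obj ?CV"
    have one: "\<one>\<^bsub>Val (J 0) c\<^esub> \<in> carrier (Val (J 0) c)"
      using cat_module.Val_comm_group[OF injective_cat_module[OF J] c]
      by (simp add: comm_group_def comm_monoid_def monoid.one_closed)
    have "\<delta> 0 c \<one>\<^bsub>Val (J 0) c\<^esub> = \<one>\<^bsub>Val (J 1) c\<^esub>"
      using group_hom.hom_one[OF module_hom_group_hom[OF injective_cat_module[OF J] injective_cat_module[OF J] \<delta>J c]] by simp
    then have "\<one>\<^bsub>Val (J 0) c\<^esub> \<in> kernel (Val (J 0) c) (Val (J 1) c) (\<delta> 0 c)"
      using one by (simp add: kernel_def)
    moreover have "x = \<one>\<^bsub>Val (J 0) c\<^esub>" if "x \<in> kernel (Val (J 0) c) (Val (J 1) c) (\<delta> 0 c)" for x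
      unfolding J1 by (rule exJ[of c x]) (use that c in \<open>simp_all add: kernel_def J1\<close>)
    ultimately show "kernel (Val (J 0) c) (Val (J 1) c) (\<delta> 0 c) = {\<one>\<^bsub>Val (J 0) c\<^esub>}" by blast
  next
    fix n c assume c: "c \<in> Obj ?CV"
    show "\<delta> n c ` carrier (Val (J n) c) = kernel (Val (J (Suc n)) c) (Val (J (Suc (Suc n))) c) (\<delta> (Suc n) c)"
    proof (intro equalityI subsetI)
      fix x assume "x \<in> \<delta> n c ` carrier (Val (J n) c)"
      then obtain y where y: "y \<in> carrier (Val (J n) c)" "x = \<delta> n c y" by blast
      then show "x \<in> kernel (Val (J (Suc n)) c) (Val (J (Suc (Suc n))) c) (\<delta> (Suc n) c)"
        using module_hom_closed[OF \<delta>J c y(1)] R.\<delta>\<delta>[of c y n] Jsub[OF y(1)] c by (simp add: kernel_def J1)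
    next
      fix x assume "x \<in> kernel (Val (J (Suc n)) c) (Val (J (Suc (Suc n))) c) (\<delta> (Suc n) c)"
      then have "\<exists>y\<in>carrier (Val (J n) c). x = \<delta> n c y"
        by (intro exJS) (use c in \<open>simp_all add: kernel_def J1\<close>)
      then show "x \<in> \<delta> n c ` carrier (Val (J n) c)" by blast
    qed
  qed
  interpret Z: module_complex ?CV J \<delta>
    by (rule module_complex.intro[where C = ?CV and I = J and \<delta> = \<delta>, OF injective_cat_module[OF J] \<delta>J])
       (use R.\<delta>\<delta> Jsub in \<open>simp add: J1\<close>)
  \<comment> \<open>Identifies the kernel of the restriction to \<open>W\<close> with the limit of
    \<open>J\<close> over \<open>?CV\<close>: compatibility along arrows from \<open>W\<close> to
    the outside is the support condition.\<close>
  have restr: "(\<lambda>c\<in>Obj ?CV. t c) \<in> lim_cocycles ?CV J \<delta> n"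
    if t: "t \<in> lim_cocycles C I \<delta> n" and tW: "\<And>c. c \<in> Obj C \<Longrightarrow> W c \<Longrightarrow> t c = \<one>\<^bsub>Val (I n) c\<^esub>" for t n
  proof -
    have tc: "t \<in> carrier (inv_lim C (I n))" and dt: "\<And>c. c \<in> Obj C \<Longrightarrow> \<delta> n c (t c) = \<one>\<^bsub>Val (I (Suc n)) c\<^esub>"
      using t unfolding X.cocycles_iff by auto
    have "t c \<in> carrier (Val (J n) c)" if "c \<in> Obj C" for c
      using inv_lim_component[OF tc that] inv_lim_Res[OF tc _ that] tW by (simp add: J_def supported_part_carrier)
    then show ?thesis
      unfolding Z.cocycles_iff inv_lim_iff using inv_lim_Res[OF tc] dt by (auto simp: J1) (simp add: J_def)
  qed
  have K0: "t c = \<one>\<^bsub>Val (I 0) c\<^esub>"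
    if t: "t \<in> lim_cocycles C I \<delta> 0" and tW: "\<And>c. c \<in> Obj C \<Longrightarrow> W c \<Longrightarrow> t c = \<one>\<^bsub>Val (I 0) c\<^esub>" and c: "c \<in> Obj C" for t c
  proof (cases "W c")
    case False
    have "(\<lambda>c\<in>Obj ?CV. t c) = \<one>\<^bsub>inv_lim ?CV (J 0)\<^esub>" using restr[OF t tW] acyc[of 0] by auto
    then have "(\<lambda>c\<in>Obj ?CV. t c) c = \<one>\<^bsub>Val (J 0) c\<^esub>" using inv_lim_one[of c ?CV "J 0"] c False by simp
    then show ?thesis using c False by (simp add: J1)
  qed (use tW c in blast)
  have KS: "\<exists>u\<in>carrier (inv_lim C (I n)). (\<forall>c\<in>Obj C. W c \<longrightarrow> u c = \<one>\<^bsub>Val (I n) c\<^esub>) \<and> t = inv_lim_map C (\<delta> n) u"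
    if t: "t \<in> lim_cocycles C I \<delta> (Suc n)" and tW: "\<And>c. c \<in> Obj C \<Longrightarrow> W c \<Longrightarrow> t c = \<one>\<^bsub>Val (I (Suc n)) c\<^esub>" for t n
  proof -
    have tc: "t \<in> carrier (inv_lim C (I (Suc n)))" using t unfolding X.cocycles_iff by auto
    obtain u' where u': "u' \<in> carrier (inv_lim ?CV (J n))" "(\<lambda>c\<in>Obj ?CV. t c) = inv_lim_map ?CV (\<delta> n) u'"
      using subsetD[OF acyc restr[OF t tW]] by auto
    define u where "u = (\<lambda>c\<in>Obj C. if W c then \<one>\<^bsub>Val (I n) c\<^esub> else u' c)"
    have u'J: "u' c \<in> carrier (Val (J n) c)" if "c \<in> Obj C" "\<not> W c" for c using inv_lim_component[OF u'(1)] that by simp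
    have one: "\<one>\<^bsub>Val (I n) c\<^esub> \<in> carrier (Val (I n) c)" if "c \<in> Obj C" for c
      using cat_module.Val_comm_group[OF R.modI that] by (simp add: comm_group_def comm_monoid_def monoid.one_closed)
    have u: "u \<in> carrier (inv_lim C (I n))"
      unfolding inv_lim_iff
    proof (intro conjI ballI)
      show "u \<in> (\<Pi>\<^sub>E c\<in>Obj C. carrier (Val (I n) c))" using one Jsub[OF u'J] by (auto simp: u_def)
      fix c d f assume cd: "c \<in> Obj C" "d \<in> Obj C" "f \<in> Arr C c d"
      \<comment> \<open>An arrow into \<open>W\<close> starts in \<open>W\<close>, so the one mixed
        case is an arrow from \<open>W\<close> to the outside, where the support condition of
        \<open>J\<close> gives compatibility.\<close>
      consider "W c" "W d" | "W c" "\<not> W d" | "\<not> W c" "\<not> W d" using W[OF cd(1,2)] cd(3) by blast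
      then show "Res (I n) c d f (u d) = u c"
      proof cases
        case 1 then show ?thesis using cd group_hom.hom_one[OF Res_group_hom[OF R.modI cd]] by (simp add: u_def)
      next
        case 2 then show ?thesis using cd u'J[of d] by (simp add: u_def J_def supported_part_carrier)
      next
        case 3 then show ?thesis using cd inv_lim_Res[OF u'(1), of c d f] by (simp add: u_def J_def)
      qed
    qed
    have "t = inv_lim_map C (\<delta> n) u"
    proof (rule inv_lim_ext[OF tc inv_lim_map_closed[OF R.\<delta>_hom u]])
      fix c assume c: "c \<in> Obj C"
      show "t c = inv_lim_map C (\<delta> n) u c"
      proof (cases "W c")
        case True
        then show ?thesis
          using c tW group_hom.hom_one[OF module_hom_group_hom[OF R.modI R.modI R.\<delta>_hom c]] by (simp add: inv_lim_map_apply u_def)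
      next
        case False
        then have "t c = inv_lim_map ?CV (\<delta> n) u' c" using fun_cong[OF u'(2), of c] c by simp
        then show ?thesis using c False by (simp add: inv_lim_map_apply u_def)
      qed
    qed
    then show ?thesis using u by (intro bexI[of _ u]) (auto simp: u_def)
  qed
  have ext: "\<exists>t\<in>carrier (inv_lim C (I n)). \<forall>c\<in>Obj C. W c \<longrightarrow> t c = s c"
    if "s \<in> carrier (inv_lim ?CW (I n))" for s n
    unfolding I_def by (rule coind_lim_restrict_surj[OF C Dc W that[unfolded I_def]])
  define h where "h = (\<lambda>t :: 'o \<Rightarrow> ('o \<times> 'a, 'm) univ. \<lambda>c\<in>Obj ?CW. t c)"
  have hc: "h t \<in> carrier (inv_lim ?CW (I n))" if "t \<in> carrier (inv_lim C (I n))" for t n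
    unfolding inv_lim_iff using inv_lim_component[OF that] inv_lim_Res[OF that] by (auto simp: h_def)
  have hmap: "h (inv_lim_map C (\<delta> n) t) = inv_lim_map ?CW (\<delta> n) (h t)" for t n
    by (auto simp: h_def inv_lim_map_def)
  have hhom: "h \<in> hom (inv_lim C (I n)) (inv_lim ?CW (I n))" for n
  proof (rule homI[OF hc])
    fix t s assume ts: "t \<in> carrier (inv_lim C (I n))" "s \<in> carrier (inv_lim C (I n))"
    interpret A: comm_group "inv_lim C (I n)" by (rule X.lim_comm_group)
    interpret B: comm_group "inv_lim ?CW (I n)" by (rule Y.lim_comm_group)
    show "h (t \<otimes>\<^bsub>inv_lim C (I n)\<^esub> s) = h t \<otimes>\<^bsub>inv_lim ?CW (I n)\<^esub> h s"
      by (rule inv_lim_ext[OF hc B.m_closed[OF hc hc]]) (use ts in \<open>auto simp: inv_lim_mult h_def\<close>)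
  qed
  have hcoc: "h t \<in> lim_cocycles ?CW I \<delta> n" if "t \<in> lim_cocycles C I \<delta> n" for t n
    using that hc unfolding X.cocycles_iff Y.cocycles_iff by (auto simp: h_def)
  have "lim_cohomology C I \<delta> i \<cong> lim_cohomology ?CW I \<delta> i"
  proof (rule lim_cohomology_isoI[OF X.module_complex_axioms Y.module_complex_axioms hhom hcoc])
    interpret A: comm_group "inv_lim C (I i)" by (rule X.lim_comm_group)
    interpret B: comm_group "inv_lim ?CW (I i)" by (rule Y.lim_comm_group)
    interpret h: group_hom "inv_lim C (I i)" "inv_lim ?CW (I i)" h
      by (rule group_hom_of_comm[OF X.lim_comm_group Y.lim_comm_group hhom])
    fix t assume t: "t \<in> lim_cocycles C I \<delta> i"
    then have tc: "t \<in> carrier (inv_lim C (I i))" unfolding X.cocycles_iff by auto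
    have one: "t c = \<one>\<^bsub>Val (I i) c\<^esub>" if "h t = \<one>\<^bsub>inv_lim ?CW (I i)\<^esub>" "c \<in> Obj C" "W c" for t c
      using fun_cong[OF that(1), of c] that inv_lim_one[of c ?CW "I i"] by (simp add: h_def)
    show "h t \<in> lim_coboundaries ?CW I \<delta> i \<longleftrightarrow> t \<in> lim_coboundaries C I \<delta> i"
    proof (cases i)
      case 0
      have "t = \<one>\<^bsub>inv_lim C (I 0)\<^esub>" if "h t = \<one>\<^bsub>inv_lim ?CW (I 0)\<^esub>"
        using inv_lim_ext[OF tc A.one_closed] K0[of t] t one[of t] that unfolding 0 by (simp add: inv_lim_one)
      then show ?thesis using 0 h.hom_one by auto
    next
      case (Suc m)
      show ?thesis
      proof
        assume "h t \<in> lim_coboundaries ?CW I \<delta> i"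
        then obtain s where s: "s \<in> carrier (inv_lim ?CW (I m))" "h t = inv_lim_map ?CW (\<delta> m) s" using Suc by auto
        \<comment> \<open>With \<open>s\<close> extended to \<open>u\<close> over all of
          \<open>C\<close>, the cocycle \<open>t\<close> and the differential of \<open>u\<close>
          agree on \<open>W\<close>; their difference is a cocycle vanishing on \<open>W\<close>,
          hence a coboundary.\<close>
        obtain u where u: "u \<in> carrier (inv_lim C (I m))" "\<And>c. c \<in> Obj C \<Longrightarrow> W c \<Longrightarrow> u c = s c" using ext[OF s(1)] by blast
        have "inv_lim_map C (\<delta> m) u \<in> lim_coboundaries C I \<delta> i" using u(1) Suc by simp
        note du = this this[THEN subsetD[OF X.coboundaries_cocycles]]
        have duc: "inv_lim_map C (\<delta> m) u \<in> carrier (inv_lim C (I i))" using du(2) unfolding X.cocycles_iff by auto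
        have "h (inv_lim_map C (\<delta> m) u) = h t"
          using s u(2) unfolding hmap by (auto simp: h_def inv_lim_map_def)
        then have ht: "h (t \<otimes>\<^bsub>inv_lim C (I i)\<^esub> inv\<^bsub>inv_lim C (I i)\<^esub> inv_lim_map C (\<delta> m) u) = \<one>\<^bsub>inv_lim ?CW (I i)\<^esub>"
          using tc duc by simp
        have coc: "t \<otimes>\<^bsub>inv_lim C (I i)\<^esub> inv\<^bsub>inv_lim C (I i)\<^esub> inv_lim_map C (\<delta> m) u \<in> lim_cocycles C I \<delta> i"
          using subgroup.m_closed[OF X.cocycles_subgroup t subgroup.m_inv_closed[OF X.cocycles_subgroup du(2)]] .
        obtain w where "w \<in> carrier (inv_lim C (I m))" "t \<otimes>\<^bsub>inv_lim C (I i)\<^esub> inv\<^bsub>inv_lim C (I i)\<^esub> inv_lim_map C (\<delta> m) u = inv_lim_map C (\<delta> m) w"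
          using KS[of _ m] coc one[OF ht] Suc by blast
        then have "t \<otimes>\<^bsub>inv_lim C (I i)\<^esub> inv\<^bsub>inv_lim C (I i)\<^esub> inv_lim_map C (\<delta> m) u \<in> lim_coboundaries C I \<delta> i" using Suc by simp
        from subgroup.m_closed[OF X.coboundaries_subgroup this du(1)]
        show "t \<in> lim_coboundaries C I \<delta> i" using tc duc by (simp add: A.m_assoc)
      next
        assume "t \<in> lim_coboundaries C I \<delta> i"
        then obtain u where "u \<in> carrier (inv_lim C (I m))" "t = inv_lim_map C (\<delta> m) u" using Suc by auto
        then show "h t \<in> lim_coboundaries ?CW I \<delta> i" using hmap hc Suc by auto
      qed
    qed
  next
    interpret A: comm_group "inv_lim C (I i)" by (rule X.lim_comm_group)
    interpret B: comm_group "inv_lim ?CW (I i)" by (rule Y.lim_comm_group)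
    interpret h: group_hom "inv_lim C (I i)" "inv_lim ?CW (I i)" h
      by (rule group_hom_of_comm[OF X.lim_comm_group Y.lim_comm_group hhom])
    interpret d: group_hom "inv_lim C (I i)" "inv_lim C (I (Suc i))" "inv_lim_map C (\<delta> i)" by (rule X.lim_map_group_hom)
    fix z assume z: "z \<in> lim_cocycles ?CW I \<delta> i"
    then have zc: "z \<in> carrier (inv_lim ?CW (I i))" and dz: "\<And>c. c \<in> Obj C \<Longrightarrow> W c \<Longrightarrow> \<delta> i c (z c) = \<one>\<^bsub>Val (I (Suc i)) c\<^esub>"
      unfolding Y.cocycles_iff by auto
    \<comment> \<open>An arbitrary extension \<open>t\<close> of \<open>z\<close> need not be a
      cocycle, but its differential vanishes on \<open>W\<close> and is therefore also the
      differential of some \<open>u\<close> that vanishes on \<open>W\<close>. The difference of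
      \<open>t\<close> and \<open>u\<close> is a cocycle that restricts to \<open>z\<close>.\<close>
    obtain t where t: "t \<in> carrier (inv_lim C (I i))" "\<And>c. c \<in> Obj C \<Longrightarrow> W c \<Longrightarrow> t c = z c" using ext[OF zc] by blast
    have ht: "h t = z"
      by (rule inv_lim_ext[OF hc[OF t(1)] zc]) (use t(2) in \<open>simp add: h_def\<close>)
    have "inv_lim_map C (\<delta> i) t \<in> lim_coboundaries C I \<delta> (Suc i)" using t(1) by simp
    then have dt: "inv_lim_map C (\<delta> i) t \<in> lim_cocycles C I \<delta> (Suc i)" using X.coboundaries_cocycles by blast
    have "inv_lim_map C (\<delta> i) t c = \<one>\<^bsub>Val (I (Suc i)) c\<^esub>" if "c \<in> Obj C" "W c" for c
      using that t(2) dz by (simp add: inv_lim_map_apply)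
    then obtain u where u: "u \<in> carrier (inv_lim C (I i))" "\<And>c. c \<in> Obj C \<Longrightarrow> W c \<Longrightarrow> u c = \<one>\<^bsub>Val (I i) c\<^esub>"
      and du: "inv_lim_map C (\<delta> i) t = inv_lim_map C (\<delta> i) u"
      using KS[OF dt] by blast
    have hu: "h u = \<one>\<^bsub>inv_lim ?CW (I i)\<^esub>"
      by (rule inv_lim_ext[OF hc[OF u(1)] B.one_closed]) (use u(2) inv_lim_one[of _ ?CW "I i"] in \<open>simp add: h_def\<close>)
    let ?t = "t \<otimes>\<^bsub>inv_lim C (I i)\<^esub> inv\<^bsub>inv_lim C (I i)\<^esub> u"
    have "inv_lim_map C (\<delta> i) ?t = \<one>\<^bsub>inv_lim C (I (Suc i))\<^esub>" using t u(1) du d.eq_iff_diff by simp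
    then have "?t \<in> lim_cocycles C I \<delta> i" using t u(1) by (simp add: lim_cocycles_def kernel_def)
    moreover have "z = \<one>\<^bsub>inv_lim ?CW (I i)\<^esub> \<otimes>\<^bsub>inv_lim ?CW (I i)\<^esub> h ?t" using t u(1) hu ht zc by simp
    ultimately show "\<exists>t\<in>lim_cocycles C I \<delta> i. \<exists>b\<in>lim_coboundaries ?CW I \<delta> i. z = b \<otimes>\<^bsub>inv_lim ?CW (I i)\<^esub> h t"
      using subgroup.one_closed[OF Y.coboundaries_subgroup] by blast
  qed
  then show ?thesis
    using higher_lim_resolution(1)[OF R, of i] higher_lim_resolution(2)[OF RW, of i] iso_trans by blast
qed

section \<open>Finite subgroups of infinite p-subgroups\<close>

lemma ord_carrier_update:
  "group.ord (G\<lparr>carrier := H\<rparr>) x = group.ord (G\<lparr>carrier := K\<rparr>) x" if "group G" "subgroup H G" "subgroup K G"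
proof -
  have "group (G\<lparr>carrier := H\<rparr>)" "group (G\<lparr>carrier := K\<rparr>)"
    using group.subgroup_imp_group that by blast+
  then show ?thesis by (simp add: group.ord_def nat_pow_def)
qed

lemma p_group_subgroup:
  assumes "group G" "subgroup H G" "subgroup K G" "H \<subseteq> K" "p_group p (G\<lparr>carrier := K\<rparr>)"
  shows "p_group p (G\<lparr>carrier := H\<rparr>)"
  using assms ord_carrier_update[OF assms(1-3)] group.subgroup_imp_group[OF assms(1,2)]
  by (auto simp: p_group_def)

locale infinite_p_subgroup = group G for G :: "('g, 'b) monoid_scheme" (structure) +
  fixes p :: nat and P :: "'g set"
  assumes P: "subgroup P G" and p_P: "p_group p (G\<lparr>carrier := P\<rparr>)" and infinite_P: "infinite P"
    and loc_fin: "locally_finite_group (G\<lparr>carrier := P\<rparr>)"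
begin

definition finite_subgroups :: "'g set set" where
  "finite_subgroups = {Q. subgroup Q G \<and> Q \<subseteq> P \<and> finite Q \<and> Q \<noteq> {\<one>}}"

abbreviation "Op \<equiv> orbit_category_p p G"

lemma Obj_iff: "Q \<in> Obj Op \<longleftrightarrow> subgroup Q G \<and> p_group p (G\<lparr>carrier := Q\<rparr>)"
  by (simp add: orbit_category_p_def full_subcategory_def orbit_category_def)

lemma Arr_iff: "f \<in> Arr Op c d \<longleftrightarrow> (\<exists>g. f = d #> g \<and> g \<in> carrier G \<and> (\<forall>h\<in>c. g \<otimes> h \<otimes> inv g \<in> d))"
  by (auto simp: orbit_category_p_def full_subcategory_def orbit_category_def)

lemma small_category_Op: "small_category Op"
  unfolding orbit_category_p_def
  by (intro small_category_full_subcategory small_category_orbit_category group_axioms)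

text \<open>The inclusion of \<open>Q\<close> in \<open>R\<close> is the coset of the identity in
  \<open>R\<close>, that is, the set \<open>R\<close> itself. This is why \<open>R\<close> and
  \<open>P\<close> appear as arrows of the directed system below.\<close>

lemma Cmp_inclusion:
  assumes "subgroup Q G" "subgroup R G" "Q \<subseteq> R" "g \<in> carrier G"
  shows "Cmp Op R (Q #> g) = R #> g"
proof -
  have "Cmp (orbit_category G) (R #> \<one>) (Q #> g) = R #> (\<one> \<otimes> g)"
    by (rule orbit_category_Cmp[OF group_axioms assms(1,2) one_closed assms(4)])
       (use assms subgroup.mem_carrier in fastforce)
  then show ?thesis
    using assms coset_mult_one[OF subgroup.subset[OF assms(2)]]
    by (simp add: orbit_category_p_def full_subcategory_def)
qed

lemma inclusion_Arr:
  assumes "subgroup Q G" "subgroup R G" "Q \<subseteq> R" shows "R \<in> Arr Op Q R"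
  unfolding Arr_iff using assms coset_mult_one[OF subgroup.subset[OF assms(2)]] subgroup.mem_carrier[OF assms(1)]
  by (intro exI[of _ \<one>]) auto

text \<open>Local finiteness of \<open>P\<close> enters here. The element \<open>y\<close> keeps the
  generated subgroup nontrivial.\<close>

lemma finite_generate:
  assumes F: "F \<subseteq> P" "finite F" and y: "y \<in> F" "y \<noteq> \<one>"
  shows "generate G F \<in> finite_subgroups"
proof -
  have "finite (generate (G\<lparr>carrier := P\<rparr>) F)" using loc_fin F by (simp add: locally_finite_group_def)
  then have "finite (generate G F)" using generate_consistent[OF F(1) P] by simp
  moreover have "F \<subseteq> carrier G" using F subgroup.subset[OF P] by blast
  moreover have "generate G F \<subseteq> P" by (rule generate_subgroup_incl[OF F(1) P])
  moreover have "y \<in> generate G F" using y(1) by (rule generate.incl)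
  ultimately show ?thesis using generate_is_subgroup y(2) by (auto simp: finite_subgroups_def)
qed

lemma nontrivial_element: "\<exists>y\<in>Q. y \<noteq> \<one>" if "subgroup Q G" "Q \<noteq> {\<one>}"
  using that subgroup.one_closed by blast

text \<open>If the cosets of \<open>g\<close> and \<open>g'\<close> agree modulo \<open>P\<close>,
  then they differ by a single element of \<open>P\<close>, and they agree already modulo any
  subgroup that contains this element.\<close>

lemma directed_finite_subgroups: "directed_system Op finite_subgroups (\<subseteq>) (\<lambda>Q R. R) (\<lambda>Q. P) P"
proof (intro directed_system.intro directed_system_axioms.intro small_category_Op poset.intro)
  have sub: "subgroup Q G" "Q \<subseteq> P" if "Q \<in> finite_subgroups" for Q using that by (auto simp: finite_subgroups_def)
  have one: "Q #> \<one> = Q" if "subgroup Q G" for Q using coset_mult_one[OF subgroup.subset[OF that]] .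
  show "Q \<in> Obj Op" if "Q \<in> finite_subgroups" for Q
    using sub[OF that] p_group_subgroup[OF group_axioms _ P _ p_P] by (simp add: Obj_iff)
  show "P \<in> Obj Op" using P p_P by (simp add: Obj_iff)
  show "R \<in> Arr Op Q R" if "Q \<in> finite_subgroups" "R \<in> finite_subgroups" "Q \<subseteq> R" for Q R
    using inclusion_Arr sub that by blast
  show "P \<in> Arr Op Q P" if "Q \<in> finite_subgroups" for Q using inclusion_Arr sub P that by blast
  show "Q = Idn Op Q" if "Q \<in> finite_subgroups" for Q
    using one[OF sub(1)[OF that]] by (simp add: orbit_category_p_def full_subcategory_def orbit_category_def)
  show "Cmp Op T R = T" if "Q \<in> finite_subgroups" "R \<in> finite_subgroups" "T \<in> finite_subgroups" "Q \<subseteq> R" "R \<subseteq> T" for Q R T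
    using Cmp_inclusion[OF sub(1)[OF that(2)] sub(1)[OF that(3)] that(5) one_closed] one sub that by simp
  show "Cmp Op P R = P" if "Q \<in> finite_subgroups" "R \<in> finite_subgroups" "Q \<subseteq> R" for Q R
    using Cmp_inclusion[OF sub(1)[OF that(2)] P sub(2)[OF that(2)] one_closed] one sub that P by simp
  show "\<exists>T\<in>finite_subgroups. Q \<subseteq> T \<and> R \<subseteq> T \<and> Cmp Op T f = Cmp Op T k"
    if "c \<in> Obj Op" and QR: "Q \<in> finite_subgroups" "R \<in> finite_subgroups" and fk: "f \<in> Arr Op c Q" "k \<in> Arr Op c R"
      and eq: "Cmp Op P f = Cmp Op P k" for c Q R f k
  proof -
    obtain g where g: "f = Q #> g" "g \<in> carrier G" using fk(1) by (auto simp: Arr_iff)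
    obtain g' where g': "k = R #> g'" "g' \<in> carrier G" using fk(2) by (auto simp: Arr_iff)
    have "P #> g = P #> g'"
      using eq Cmp_inclusion[OF sub(1)[OF QR(1)] P sub(2)[OF QR(1)] g(2)]
        Cmp_inclusion[OF sub(1)[OF QR(2)] P sub(2)[OF QR(2)] g'(2)] g g' by simp
    then have "g' \<in> P #> g" using rcos_self[OF g'(2) P] by simp
    then obtain x where x: "x \<in> P" "g' = x \<otimes> g" by (auto simp: r_coset_def)
    \<comment> \<open>A finite subgroup of \<open>P\<close> that contains \<open>Q\<close>,
      \<open>R\<close> and the element \<open>x\<close> by which the two representatives
      differ.\<close>
    define T where "T = generate G (Q \<union> R \<union> {x})"
    obtain y where y: "y \<in> Q" "y \<noteq> \<one>" using nontrivial_element QR(1) by (auto simp: finite_subgroups_def)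
    have T: "T \<in> finite_subgroups"
      unfolding T_def by (rule finite_generate[of _ y]) (use QR x y in \<open>auto simp: finite_subgroups_def\<close>)
    have QT: "Q \<subseteq> T" "R \<subseteq> T" "x \<in> T" unfolding T_def by (auto intro: generate.incl)
    have "g' \<in> T #> g" using QT(3) x(2) by (auto simp: r_coset_def)
    then have "T #> g = T #> g'" by (rule repr_independence[OF _ g(2) sub(1)[OF T]])
    then have "Cmp Op T f = Cmp Op T k"
      using Cmp_inclusion[OF sub(1)[OF QR(1)] sub(1)[OF T] QT(1) g(2)]
        Cmp_inclusion[OF sub(1)[OF QR(2)] sub(1)[OF T] QT(2) g'(2)] g g' by simp
    then show ?thesis using T QT by blast
  qed
qed auto

text \<open>Conjugation by \<open>g\<close> takes \<open>c\<close> to a finite subset of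
  \<open>P\<close>, which generates a finite subgroup through which the arrow factors. The
  nontrivial \<open>y\<close>, which exists because \<open>P\<close> is infinite, is added to cover
  a trivial \<open>c\<close>.\<close>

lemma arrow_factors:
  assumes c: "c \<in> Obj Op" "finite c" and f: "f \<in> Arr Op c P"
  shows "\<exists>Q\<in>finite_subgroups. \<exists>k\<in>Arr Op c Q. f = Cmp Op P k"
proof -
  obtain g where g: "f = P #> g" "g \<in> carrier G" "\<And>h. h \<in> c \<Longrightarrow> g \<otimes> h \<otimes> inv g \<in> P" using f by (auto simp: Arr_iff)
  have "P \<noteq> {\<one>}" using infinite_P by auto
  then obtain y where y: "y \<in> P" "y \<noteq> \<one>" using nontrivial_element[OF P] by blast
  let ?F = "insert y ((\<lambda>h. g \<otimes> h \<otimes> inv g) ` c)"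
  have Q: "generate G ?F \<in> finite_subgroups"
    by (rule finite_generate[of _ y]) (use y g c in auto)
  have "generate G ?F #> g \<in> Arr Op c (generate G ?F)"
    unfolding Arr_iff using g(2) by (intro exI[of _ g]) (auto intro: generate.incl)
  moreover have "f = Cmp Op P (generate G ?F #> g)"
    using Cmp_inclusion[of "generate G ?F" P g] Q P g by (simp add: finite_subgroups_def)
  ultimately show ?thesis using Q by blast
qed

end

section \<open>Application to the orbit categories\<close>

lemma orbit_category_pf_eq: "orbit_category_pf p G = full_subcategory (orbit_category_p p G) finite"
  by (simp add: orbit_category_pf_def orbit_category_p_def full_subcategory_def conj_ac)

theorem theorem2:
  fixes p :: nat and G :: "('g, 'b) monoid_scheme" and M :: "'m monoid"
    and act :: "'g \<Rightarrow> 'm \<Rightarrow> 'm"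
  assumes "Factorial_Ring.prime p"
    and "group G"
    and "\<And>P. subgroup P G \<Longrightarrow> p_group p (G\<lparr>carrier := P\<rparr>) \<Longrightarrow> locally_finite_group (G\<lparr>carrier := P\<rparr>)"
    and "ZG_module G M act"
  shows "\<forall>i. Lambda p i G M act \<cong> Lambda_f p i G M act"
proof
  fix i
  let ?C = "orbit_category_p p G" and ?F = "F_functor G M act"
  interpret group G by fact
  have Obj: "c \<in> Obj ?C \<longleftrightarrow> subgroup c G \<and> p_group p (G\<lparr>carrier := c\<rparr>)" for c
    by (simp add: orbit_category_p_def full_subcategory_def orbit_category_def)
  have C: "small_category ?C"
    unfolding orbit_category_p_def
    by (intro small_category_full_subcategory small_category_orbit_category assms(2))
  have trivial: "carrier (Val ?F P) = {\<one>\<^bsub>Val ?F P\<^esub>}" if "P \<noteq> {\<one>\<^bsub>G\<^esub>}" for P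
    using that by (simp add: F_functor_def)
  have "higher_lim ?C ?F i \<cong> higher_lim (full_subcategory ?C finite) ?F i"
  proof (rule higher_lim_full_subcategory[OF C cat_module_F_functor[OF assms(4)]])
    fix c d assume c: "c \<in> Obj ?C" and d: "finite d" "Arr ?C c d \<noteq> {}"
    \<comment> \<open>Conjugation by a representative of the arrow embeds \<open>c\<close> in
      \<open>d\<close>, so the finite subgroups form a sieve.\<close>
    obtain g where g: "g \<in> carrier G" "\<And>h. h \<in> c \<Longrightarrow> g \<otimes>\<^bsub>G\<^esub> h \<otimes>\<^bsub>G\<^esub> inv\<^bsub>G\<^esub> g \<in> d"
      using d(2) by (auto simp: orbit_category_p_def full_subcategory_def orbit_category_def)
    have "inj_on (\<lambda>h. g \<otimes>\<^bsub>G\<^esub> h \<otimes>\<^bsub>G\<^esub> inv\<^bsub>G\<^esub> g) c"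
      using g(1) c subgroup.mem_carrier by (intro inj_onI) (fastforce simp: Obj)
    then show "finite c" using inj_on_finite[of _ c d] g(2) d(1) by blast
  next
    fix P assume inf: "P \<in> Obj ?C" "infinite P"
    interpret infinite_p_subgroup G p P
      by (intro infinite_p_subgroup.intro infinite_p_subgroup_axioms.intro group_axioms)
         (use inf assms(3) in \<open>auto simp: Obj\<close>)
    have "P \<noteq> {\<one>\<^bsub>G\<^esub>}" using inf(2) by auto
    moreover have "\<forall>Q\<in>finite_subgroups. finite Q \<and> carrier (Val ?F Q) = {\<one>\<^bsub>Val ?F Q\<^esub>}"
      using trivial by (simp add: finite_subgroups_def)
    ultimately show "carrier (Val ?F P) = {\<one>\<^bsub>Val ?F P\<^esub>} \<and> (\<exists>S r u v. directed_system ?C S r u v P \<and>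
         (\<forall>Q\<in>S. finite Q \<and> carrier (Val ?F Q) = {\<one>\<^bsub>Val ?F Q\<^esub>}) \<and>
         (\<forall>c\<in>Obj ?C. \<forall>f\<in>Arr ?C c P. finite c \<longrightarrow> (\<exists>Q\<in>S. \<exists>g\<in>Arr ?C c Q. f = Cmp ?C (v Q) g)))"
      using trivial directed_finite_subgroups arrow_factors
      by (intro conjI exI[of _ finite_subgroups] exI[of _ "(\<subseteq>)"] exI[of _ "\<lambda>Q R. R"] exI[of _ "\<lambda>Q. P"]) auto
  qed
  then show "Lambda p i G M act \<cong> Lambda_f p i G M act"
    by (simp add: Lambda_def Lambda_f_def orbit_category_pf_eq)
qed

end
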